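(* Let $K\in\mathbb{N}$ and $A,B\subset\{0,1,\dots,K-1\}$ with $|A|\cdot|B|=K$, $|A|>1$, $|B|>1$, and let $E_n$ ($n\ge 1$) and $E_\infty$ be the associated product Cantor iterations and product Cantor set. Assume that there is a direction $\theta_0$ such that the projection $\pi_{\theta_0}(E_\infty)$ has positive 1-dimensional (Lebesgue) measure. Then there is a $p\in(6,\infty)$, depending on the choice of $K,A,B$, and a constant $C$ independent of $n$, such that $$\mathrm{Fav}(E_n)\le C\,n^{-1/p}\qquad\text{for all } n\ge 1.$$
   Context: The set $E_1$ is obtained by dividing the unit square $[0,1]^2$ into $K^2$ congruent squares of sidelength $K^{-1}$ and keeping those whose bottom left vertex is in $K^{-1}(A\times B)$; the procedure is iterated in each kept square, and $E_n$ is the set obtained after $n$ iterations, consisting of $K^n$ squares of sidelength $K^{-n}$. Equivalently, with $A^n=\{\sum_{j=1}^n K^{-j}a_j:\ a_j\in A\}$ and $B^n=\{\sum_{j=1}^n K^{-j}b_j:\ b_j\in B\}$, one has $E_n=(A^n\times B^n)+[0,K^{-n}]^2$. Set $E_\infty=\bigcap_{n\ge1}E_n$. For $\theta\in[0,\pi]$ let $\pi_\theta(x,y)=x\cos\theta+y\sin\theta$. The Favard length of $\Omega\subset\mathbb{R}^2$ is $\mathrm{Fav}(\Omega)=\int_0^\pi|\pi_\theta(\Omega)|\,d\theta$, where $|\cdot|$ is Lebesgue measure on $\mathbb{R}$. *)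

theory Defs
  imports "HOL-Analysis.Analysis"
begin

text \<open>The sets \<open>A\<^sup>n\<close> of base-\<open>K\<close> expansions of length \<open>n\<close> with digits in \<open>A\<close>.\<close>

definition digit_sums :: "nat \<Rightarrow> nat set \<Rightarrow> nat \<Rightarrow> real set" where
  "digit_sums K A n =
     {(\<Sum>j=1..n. real (a j) / real K ^ j) | a :: nat \<Rightarrow> nat. \<forall>j\<in>{1..n}. a j \<in> A}"

text \<open>\<open>E\<^sub>n = (A\<^sup>n \<times> B\<^sup>n) + [0, K\<^sup>-\<^sup>n]\<^sup>2\<close>; the outer \<open>+\<close> is the Minkowski sum of sets in the plane.\<close>

definition cantor_iter :: "nat \<Rightarrow> nat set \<Rightarrow> nat set \<Rightarrow> nat \<Rightarrow> (real \<times> real) set" where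
  "cantor_iter K A B n =
     digit_sums K A n \<times> digit_sums K B n + {0..1 / real K ^ n} \<times> {0..1 / real K ^ n}"

definition cantor_limit :: "nat \<Rightarrow> nat set \<Rightarrow> nat set \<Rightarrow> (real \<times> real) set" where
  "cantor_limit K A B = (\<Inter>n\<in>{1..}. cantor_iter K A B n)"

definition proj :: "real \<Rightarrow> real \<times> real \<Rightarrow> real" where
  "proj \<theta> z = fst z * cos \<theta> + snd z * sin \<theta>"

text \<open>The integral is taken in \<open>[0, \<infinity>]\<close>, so an infinite value is not replaced by a default
  value. The definition is meant for sets with measurable projections (such as compact sets),
  since \<open>emeasure\<close> assigns \<open>0\<close> to non-measurable sets.\<close>

definition favard :: "(real \<times> real) set \<Rightarrow> ennreal" where
  "favard \<Omega> = (\<integral>\<^sup>+ \<theta>\<in>{0..pi}. emeasure lebesgue (proj \<theta> ` \<Omega>) \<partial>lebesgue)"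

end

theory Submission
  imports Defs "HOL-Computational_Algebra.Fundamental_Theorem_Algebra"
begin

text \<open>Write \<open>\<pi>\<^sub>t\<close> for the projection \<open>(x, y) \<mapsto> x + t y\<close> and let \<open>\<nu>\<^sub>t\<close> be the projected Cantor measure. If
  many level-\<open>k\<close> squares project near each other, self-similarity makes the stacks multiply over
  further generations and \<open>\<pi>\<^sub>t(E\<^sub>n)\<close> becomes small. So only the slopes \<open>t\<close> whose energy (the number of pairs
  of level-\<open>k\<close> squares with nearby projections, over \<open>K\<^sup>k\<close>) stays below \<open>2L\<close> for all \<open>k \<le> N\<close> matter,
  and it suffices that they form a set of measure at most \<open>1/L\<close> once \<open>N\<close> exceeds a power of \<open>L\<close>.

  The energy dominates the \<open>L\<^sup>2\<close> norm of the Fourier transform of \<open>\<nu>\<^sub>t\<close>, a product of the factors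
  \<open>\<phi>\<^sub>A(K\<^sup>k \<xi>) \<phi>\<^sub>B(t K\<^sup>k \<xi>)\<close>. By pigeonhole some shell of \<open>m\<close> consecutive scales carries little of it. On
  the other hand, for a set \<open>\<Gamma>\<close> positive definiteness gives the high-frequency factors mass at
  least \<open>|\<Gamma>|\<close> on \<open>\<Gamma> - \<Gamma>\<close>, far more than they have near \<open>0\<close> if \<open>|\<Gamma>| \<ge> c K\<^bsup>-m/2\<^esup>\<close>. So there would be a
  contradiction if the \<open>m\<close> low-frequency factors were at least \<open>K\<^bsup>-Cm\<^esup>\<close> on \<open>\<Gamma> - \<Gamma>\<close>. Zeros of \<open>\<phi>\<^sub>A\<close> and \<open>\<phi>\<^sub>B\<close>
  outside \<open>\<int>[1/K]\<close> are avoided by prescribing a sparse set of digits of the elements of \<open>\<Gamma>\<close>; zeros in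
  \<open>\<int>[1/K]\<close> only do harm in tiny neighbourhoods, whose mass is negligible on average over \<open>t\<close> because
  \<open>|A|, |B| < K\<close>.\<close>

section \<open>Stacks of projected squares\<close>

text \<open>A large energy is only a second moment and could come from a few very crowded words.
  Stopping at the coarsest ancestor with at least \<open>L\<close> neighbours caps the crowding at
  \<open>K * L\<close>, and at the level where the energy per word is largest the recursion closes:
  a fraction of at least \<open>1 / (8 * K * L)\<close> of all words is crowded. Each new block of
  digits is a fresh trial, so a multiple of \<open>L^2\<close> blocks leaves at most a fraction
  \<open>1 / L\<close> of words uncrowded in every block.

  On the Fourier side let \<open>u = K^i\<close>, \<open>L = u\<close>, \<open>m = 4 * i\<close>.
  The prescribed digits leave \<open>|\<Gamma>|\<close> at least of order \<open>u^-2\<close>, while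
  the frequencies below the shell carry only about \<open>L * K^-m = u^-3\<close>. Slopes are not
  controlled individually near the remaining zeros; on average over \<open>t\<close> the
  substitution \<open>v = t * x\<close> separates the factors of \<open>A\<close> and
  \<open>B\<close>, and the one near a zero gains a factor 2 per level. The squared low factors may
  be as small as \<open>lam^-m\<close>, exponential in \<open>i\<close>; \<open>K^(e * i)\<close>
  disjoint shells with a fixed \<open>e\<close> outweigh this, which is why \<open>N\<close> is a
  power of \<open>L\<close> and the final bound a power of \<open>n\<close>.\<close>

definition words :: "'d set \<Rightarrow> nat \<Rightarrow> 'd list set" where
  "words D n = {w. set w \<subseteq> D \<and> length w = n}"

text \<open>The head of the list is the lowest digit, so the cylinders containing a given one are its
  suffixes.\<close>

primrec sig :: "nat \<Rightarrow> ('d \<Rightarrow> real) \<Rightarrow> 'd list \<Rightarrow> real" where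
  "sig K v [] = 0"
| "sig K v (d # w) = v d + real K * sig K v w"

text \<open>Lengths are in units of the level-\<open>n\<close> squares. The threshold 4 solves
  \<open>4 + 2 * 2 * (K - 1) = 4 * K\<close>: for digit values bounded by
  \<open>2 * (K - 1)\<close>, near words have near parents.\<close>

definition near_pairs :: "nat \<Rightarrow> 'd set \<Rightarrow> ('d \<Rightarrow> real) \<Rightarrow> nat \<Rightarrow> ('d list \<times> 'd list) set" where
  "near_pairs K D v n = {(w, w') \<in> words D n \<times> words D n. \<bar>sig K v w - sig K v w'\<bar> \<le> 4}"

definition energy :: "nat \<Rightarrow> 'd set \<Rightarrow> ('d \<Rightarrow> real) \<Rightarrow> nat \<Rightarrow> nat" where
  "energy K D v n = card (near_pairs K D v n)"

text \<open>The radius 2 solves \<open>2 + 2 * (K - 1) = 2 * K\<close>, so the covers decrease with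
  \<open>n\<close>; it also leaves room for the projection of a whole unit square.\<close>

definition cover :: "nat \<Rightarrow> 'd set \<Rightarrow> ('d \<Rightarrow> real) \<Rightarrow> nat \<Rightarrow> real set" where
  "cover K D v n = {x. \<exists>w\<in>words D n. \<bar>real K ^ n * x - sig K v w\<bar> \<le> 2}"

text \<open>The radius is \<open>6 = 2 + 4\<close>: a point within 2 of a word is within 6 of all
  its neighbours.\<close>

definition stack :: "nat \<Rightarrow> 'd set \<Rightarrow> ('d \<Rightarrow> real) \<Rightarrow> nat \<Rightarrow> real \<Rightarrow> nat" where
  "stack K D v n x = card {w \<in> words D n. \<bar>real K ^ n * x - sig K v w\<bar> \<le> 6}"

lemma finite_words [simp, intro]: "finite D \<Longrightarrow> finite (words D n)"
  unfolding words_def by (rule finite_lists_length_eq)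

lemma card_words: "finite D \<Longrightarrow> card (words D n) = card D ^ n"
  unfolding words_def by (rule card_lists_length_eq)

lemma words_0 [simp]: "words D 0 = {[]}"
  by (auto simp: words_def)

lemma Cons_in_words [simp]: "d # w \<in> words D (Suc n) \<longleftrightarrow> d \<in> D \<and> w \<in> words D n"
  by (auto simp: words_def)

lemma words_Suc: "words D (Suc n) = (\<lambda>(d, w). d # w) ` (D \<times> words D n)"
proof -
  have "w \<in> (\<lambda>(d, w). d # w) ` (D \<times> words D n)" if "w \<in> words D (Suc n)" for w
    using that by (cases w) (auto simp: words_def)
  then show ?thesis by auto
qed

lemma words_append: "words D (a + b) = (\<lambda>(s, u). u @ s) ` (words D b \<times> words D a)"
proof -
  have "w \<in> (\<lambda>(s, u). u @ s) ` (words D b \<times> words D a)" if "w \<in> words D (a + b)" for w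
  proof -
    have "w = take a w @ drop a w" by simp
    moreover have "take a w \<in> words D a" "drop a w \<in> words D b"
      using that by (auto simp: words_def dest: in_set_takeD in_set_dropD)
    ultimately show ?thesis by (metis (no_types, lifting) SigmaI case_prod_conv image_eqI)
  qed
  then show ?thesis by (auto simp: words_def)
qed

lemma inj_on_append: "inj_on (\<lambda>(s, u). u @ s) (words D b \<times> words D a)"
  by (auto simp: inj_on_def words_def)

lemma sum_words_append:
  "(\<Sum>w\<in>words D (a + b). g w) = (\<Sum>s\<in>words D b. \<Sum>u\<in>words D a. g (u @ s))"
  unfolding words_append
  by (subst sum.reindex[OF inj_on_append]) (simp add: sum.cartesian_product case_prod_unfold)

lemma sum_words_Suc:
  "(\<Sum>w\<in>words D (Suc n). g w) = (\<Sum>d\<in>D. \<Sum>w\<in>words D n. g (d # w))"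
  unfolding words_Suc
  by (subst sum.reindex) (auto simp: inj_on_def sum.cartesian_product case_prod_unfold)

lemma sig_append: "sig K v (u @ w) = sig K v u + real K ^ length u * sig K v w"
  by (induction u) (auto simp: algebra_simps)

lemma abs_sig_le:
  assumes "K \<ge> 1" "\<And>d. d \<in> D \<Longrightarrow> \<bar>v d\<bar> \<le> 2 * (real K - 1)" "w \<in> words D n"
  shows "\<bar>sig K v w\<bar> \<le> 2 * (real K ^ n - 1)"
  using assms(3)
proof (induction w arbitrary: n)
  case (Cons d w)
  then obtain n' where n: "n = Suc n'" by (auto simp: words_def)
  have "\<bar>sig K v w\<bar> \<le> 2 * (real K ^ n' - 1)" using Cons n by auto
  then have "real K * \<bar>sig K v w\<bar> \<le> real K * (2 * (real K ^ n' - 1))"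
    by (intro mult_left_mono) auto
  moreover have "\<bar>v d\<bar> \<le> 2 * (real K - 1)" using Cons n assms(2) by auto
  moreover have "\<bar>sig K v (d # w)\<bar> \<le> \<bar>v d\<bar> + real K * \<bar>sig K v w\<bar>"
    by (simp add: abs_triangle_ineq[THEN order_trans] abs_mult)
  ultimately show ?case unfolding n by (simp add: algebra_simps)
qed (auto simp: words_def)

text \<open>The left side is an autocorrelation of the cell occupation numbers, and
  \<open>2 * x * y <= x^2 + y^2\<close> shows that an autocorrelation is largest at lag 0.\<close>

lemma card_same_cell_shift:
  fixes c :: "'a \<Rightarrow> int"
  assumes "finite W"
  shows "card {(w, w') \<in> W \<times> W. c w - c w' = r} \<le> card {(w, w') \<in> W \<times> W. c w = c w'}"
proof -
  define N where "N i = real (card {w \<in> W. c w = i})" for i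
  define I where "I = c ` W"
  have fI: "finite I" using assms by (simp add: I_def)
  have eq: "real (card {(w, w') \<in> W \<times> W. c w - c w' = r}) = (\<Sum>i\<in>I. N i * N (i - r))" for r
  proof -
    have "{(w, w') \<in> W \<times> W. c w - c w' = r} =
        (\<Union>i\<in>I. {w \<in> W. c w = i} \<times> {w \<in> W. c w = i - r})"
      by (auto simp: I_def)
    also have "card \<dots> = (\<Sum>i\<in>I. card ({w \<in> W. c w = i} \<times> {w \<in> W. c w = i - r}))"
      using assms fI by (intro card_UN_disjoint) auto
    finally show ?thesis by (simp add: N_def card_cartesian_product)
  qed
  have "(\<Sum>i\<in>I. N i * N (i - r)) \<le> (\<Sum>i\<in>I. ((N i)\<^sup>2 + (N (i - r))\<^sup>2) / 2)"
  proof (rule sum_mono)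
    fix i show "N i * N (i - r) \<le> ((N i)\<^sup>2 + (N (i - r))\<^sup>2) / 2"
      using sum_squares_bound[of "N i" "N (i - r)"] by simp
  qed
  also have "\<dots> = ((\<Sum>i\<in>I. (N i)\<^sup>2) + (\<Sum>i\<in>I. (N (i - r))\<^sup>2)) / 2"
    by (simp add: sum.distrib sum_divide_distrib[symmetric])
  also have "(\<Sum>i\<in>I. (N (i - r))\<^sup>2) = (\<Sum>i\<in>(\<lambda>i. i - r) ` I. (N i)\<^sup>2)"
    by (subst sum.reindex) (auto simp: inj_on_def)
  also have "\<dots> \<le> (\<Sum>i\<in>I. (N i)\<^sup>2)"
  proof -
    have "N i = 0" if "i \<notin> I" for i
    proof -
      have "{w \<in> W. c w = i} = {}" using that by (auto simp: I_def)
      then show ?thesis unfolding N_def by (simp only: card.empty)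
    qed
    then have "(\<Sum>i\<in>(\<lambda>i. i - r) ` I. (N i)\<^sup>2) = (\<Sum>i\<in>(\<lambda>i. i - r) ` I \<inter> I. (N i)\<^sup>2)"
      using fI by (intro sum.mono_neutral_right) auto
    also have "\<dots> \<le> (\<Sum>i\<in>I. (N i)\<^sup>2)" using fI by (intro sum_mono2) auto
    finally show ?thesis .
  qed
  finally have "(\<Sum>i\<in>I. N i * N (i - r)) \<le> (\<Sum>i\<in>I. N i * N (i - 0))"
    by (simp add: power2_eq_square)
  then show ?thesis using eq[of r] eq[of 0] by (simp add: case_prod_unfold)
qed

text \<open>In cells of width \<open>\<rho>\<close> the shifted condition leaves four possible
  differences of cell indices, none more frequent than the difference 0; and two points of one cell
  are within \<open>\<rho>\<close>.\<close>

lemma card_pairs_shift: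
  fixes s :: "'a \<Rightarrow> real"
  assumes "finite W" "\<rho> > 0"
  shows "card {(w, w') \<in> W \<times> W. \<bar>s w - s w' - \<tau>\<bar> \<le> \<rho>}
    \<le> 4 * card {(w, w') \<in> W \<times> W. \<bar>s w - s w'\<bar> \<le> \<rho>}"
proof -
  define c where "c w = \<lfloor>s w / \<rho>\<rfloor>" for w
  define r0 where "r0 = \<lfloor>\<tau> / \<rho>\<rfloor>"
  define P where "P r = {(w, w') \<in> W \<times> W. c w - c w' = r}" for r
  have "{(w, w') \<in> W \<times> W. \<bar>s w - s w' - \<tau>\<bar> \<le> \<rho>} \<subseteq> (\<Union>r\<in>{r0-1..r0+2}. P r)"
  proof clarsimp
    fix w w' assume w: "w \<in> W" "w' \<in> W" and "\<bar>s w - s w' - \<tau>\<bar> \<le> \<rho>"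
    then have "\<bar>(s w - s w' - \<tau>) / \<rho>\<bar> \<le> 1" using assms(2) by simp
    then have "\<bar>s w / \<rho> - s w' / \<rho> - \<tau> / \<rho>\<bar> \<le> 1" by (simp add: diff_divide_distrib)
    then have "c w - c w' \<in> {r0-1..r0+2}"
      unfolding c_def r0_def atLeastAtMost_iff by linarith
    then show "\<exists>r\<in>{r0-1..r0+2}. (w, w') \<in> P r" using w by (auto simp: P_def)
  qed
  then have "card {(w, w') \<in> W \<times> W. \<bar>s w - s w' - \<tau>\<bar> \<le> \<rho>} \<le> card (\<Union>r\<in>{r0-1..r0+2}. P r)"
    using assms by (intro card_mono finite_UN_I) (auto simp: P_def intro: finite_subset[of _ "W \<times> W"])
  also have "\<dots> \<le> (\<Sum>r\<in>{r0-1..r0+2}. card (P r))" by (rule card_UN_le) simp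
  also have "\<dots> \<le> (\<Sum>r\<in>{r0-1..r0+2}. card {(w, w') \<in> W \<times> W. c w = c w'})"
    unfolding P_def by (intro sum_mono card_same_cell_shift assms)
  also have "\<dots> = 4 * card {(w, w') \<in> W \<times> W. c w = c w'}" by simp
  also have "card {(w, w') \<in> W \<times> W. c w = c w'} \<le> card {(w, w') \<in> W \<times> W. \<bar>s w - s w'\<bar> \<le> \<rho>}"
  proof (rule card_mono)
    show "finite {(w, w') \<in> W \<times> W. \<bar>s w - s w'\<bar> \<le> \<rho>}"
      using assms by (auto intro: finite_subset[of _ "W \<times> W"])
    have "\<bar>s w - s w'\<bar> \<le> \<rho>" if "c w = c w'" for w w'
    proof -
      have "\<bar>s w / \<rho> - s w' / \<rho>\<bar> \<le> 1" using that unfolding c_def by linarith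
      then have "\<bar>(s w - s w') / \<rho>\<bar> \<le> 1" by (simp add: diff_divide_distrib)
      then show ?thesis using assms(2) by simp
    qed
    then show "{(w, w') \<in> W \<times> W. c w = c w'} \<subseteq> {(w, w') \<in> W \<times> W. \<bar>s w - s w'\<bar> \<le> \<rho>}" by auto
  qed
  finally show ?thesis by simp
qed

text \<open>Equality of \<open>card D\<close> with the scaling ratio is the critical case of
  similarity dimension 1: the \<open>K^n\<close> words of length \<open>n\<close> spread over a
  range of length at most \<open>4 * K^n\<close>.\<close>

locale digits =
  fixes K :: nat and D :: "'d set" and v :: "'d \<Rightarrow> real"
  assumes finite_D [simp, intro]: "finite D" and card_D: "card D = K" and K_ge: "K \<ge> 2"
    and v_le: "d \<in> D \<Longrightarrow> \<bar>v d\<bar> \<le> 2 * (real K - 1)"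
begin

abbreviation "\<sigma> \<equiv> sig K v"
abbreviation "En \<equiv> energy K D v"
abbreviation "St \<equiv> stack K D v"

lemma K_pos [simp]: "K > 0" "real K > 0" using K_ge by auto

lemma sig_le: "w \<in> words D n \<Longrightarrow> \<bar>\<sigma> w\<bar> \<le> 2 * (real K ^ n - 1)"
  using abs_sig_le[of K D v w n] v_le K_ge by auto

section \<open>Crowded words\<close>

definition nbr :: "'d list \<Rightarrow> nat" where
  "nbr w = card {w' \<in> words D (length w). \<bar>\<sigma> w - \<sigma> w'\<bar> \<le> 4}"

lemma sum_nbr: "(\<Sum>w\<in>words D n. nbr w) = En n"
proof -
  have "near_pairs K D v n = Sigma (words D n) (\<lambda>w. {w' \<in> words D (length w). \<bar>\<sigma> w - \<sigma> w'\<bar> \<le> 4})"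
    by (auto simp: near_pairs_def words_def)
  then show ?thesis unfolding energy_def nbr_def by simp
qed

text \<open>Since nearness passes to parents, the neighbours of a child are children of neighbours
  of its parent.\<close>

lemma nbr_Cons_le:
  assumes "d \<in> D" "w \<in> words D n"
  shows "nbr (d # w) \<le> K * nbr w"
proof -
  have lw: "length w = n" using assms by (auto simp: words_def)
  have "{w' \<in> words D (Suc n). \<bar>\<sigma> (d # w) - \<sigma> w'\<bar> \<le> 4} \<subseteq>
     (\<lambda>(d, w). d # w) ` (D \<times> {w' \<in> words D n. \<bar>\<sigma> w - \<sigma> w'\<bar> \<le> 4})"
  proof
    fix w' assume "w' \<in> {w' \<in> words D (Suc n). \<bar>\<sigma> (d # w) - \<sigma> w'\<bar> \<le> 4}"
    then obtain d' u where w': "w' = d' # u" "d' \<in> D" "u \<in> words D n"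
      and near: "\<bar>\<sigma> (d # w) - \<sigma> w'\<bar> \<le> 4" by (auto simp: words_Suc)
    have "real K * \<bar>\<sigma> w - \<sigma> u\<bar> = \<bar>(\<sigma> (d # w) - \<sigma> w') - v d + v d'\<bar>"
      by (simp add: w' abs_mult[symmetric] algebra_simps flip: abs_mult_pos)
         (metis (no_types, opaque_lifting) abs_mult abs_of_nat right_diff_distrib)
    also have "\<dots> \<le> 4 + 2 * (real K - 1) + 2 * (real K - 1)"
      using near v_le[OF assms(1)] v_le[OF w'(2)] by linarith
    also have "\<dots> = real K * 4" by simp
    finally have "\<bar>\<sigma> w - \<sigma> u\<bar> \<le> 4" by (simp only: mult_le_cancel_left_pos[OF K_pos(2)])
    then show "w' \<in> (\<lambda>(d, w). d # w) ` (D \<times> {w' \<in> words D n. \<bar>\<sigma> w - \<sigma> w'\<bar> \<le> 4})"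
      using w' by auto
  qed
  then have "nbr (d # w) \<le> card ((\<lambda>(d, w). d # w) ` (D \<times> {w' \<in> words D n. \<bar>\<sigma> w - \<sigma> w'\<bar> \<le> 4}))"
    unfolding nbr_def using lw by (auto intro!: card_mono)
  also have "\<dots> \<le> card (D \<times> {w' \<in> words D n. \<bar>\<sigma> w - \<sigma> w'\<bar> \<le> 4})"
    by (rule card_image_le) auto
  finally show ?thesis unfolding nbr_def using lw by (simp add: card_cartesian_product card_D)
qed

text \<open>Tails are coarser cylinders, so crowdedness passes to every extension of a word;
  \<open>first_crowded\<close> is the corresponding stopping time.\<close>

primrec crowded :: "real \<Rightarrow> 'd list \<Rightarrow> bool" where
  "crowded L [] \<longleftrightarrow> L \<le> real (nbr [])"
| "crowded L (d # w) \<longleftrightarrow> L \<le> real (nbr (d # w)) \<or> crowded L w"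

definition first_crowded :: "real \<Rightarrow> 'd list \<Rightarrow> bool" where
  "first_crowded L w \<longleftrightarrow> L \<le> real (nbr w) \<and> (w \<noteq> [] \<longrightarrow> \<not> crowded L (tl w))"

definition ncr :: "real \<Rightarrow> nat \<Rightarrow> nat" where
  "ncr L n = card {w \<in> words D n. crowded L w}"

lemma not_crowded_nbr: "\<not> crowded L w \<Longrightarrow> real (nbr w) < L"
  by (cases w) auto

text \<open>The parent is not crowded, so it has fewer than \<open>L\<close> neighbours, each with
  \<open>K\<close> children. This cap prevents a few words from carrying the whole energy.\<close>

lemma nbr_first_crowded:
  assumes "w \<in> words D n" "first_crowded L w" "L \<ge> 1"
  shows "real (nbr w) \<le> real K * L"
proof (cases w)
  case Nil
  have "nbr [] = card {[] :: 'd list}" unfolding nbr_def by (rule arg_cong[where f = card]) auto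
  then have "nbr [] = 1" by simp
  moreover have "1 * 1 \<le> real K * L" using assms(3) K_ge by (intro mult_mono) auto
  ultimately show ?thesis using Nil by simp
next
  case (Cons d u)
  then have "u \<in> words D (length u)" "d \<in> D" using assms(1) by (auto simp: words_def)
  then have "real (nbr w) \<le> real (K * nbr u)"
    unfolding Cons of_nat_le_iff by (rule nbr_Cons_le[rotated])
  also have "\<dots> \<le> real K * L"
    using not_crowded_nbr[of L u] assms(2) Cons by (auto simp: first_crowded_def intro!: mult_left_mono)
  finally show ?thesis .
qed

lemma crowded_imp_first:
  "crowded L w \<Longrightarrow> \<exists>j\<le>length w. first_crowded L (drop (length w - j) w)"
proof (induction w)
  case Nil then show ?case by (auto simp: first_crowded_def)
next
  case (Cons d w)
  show ?case
  proof (cases "crowded L w")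
    case True
    then obtain j where "j \<le> length w" "first_crowded L (drop (length w - j) w)"
      using Cons by auto
    then show ?thesis by (intro exI[of _ j]) (auto simp: Suc_diff_le)
  next
    case False
    then show ?thesis using Cons by (intro exI[of _ "Suc (length w)"]) (auto simp: first_crowded_def)
  qed
qed

lemma ncr_Suc:
  "ncr L (Suc n) = K * ncr L n + card {w \<in> words D (Suc n). first_crowded L w}"
proof -
  have "{w \<in> words D (Suc n). crowded L w} =
     (\<lambda>(d, w). d # w) ` (D \<times> {w \<in> words D n. crowded L w})
      \<union> {w \<in> words D (Suc n). first_crowded L w}"
    by (auto simp: words_Suc first_crowded_def)
  moreover have "((\<lambda>(d, w). d # w) ` (D \<times> {w \<in> words D n. crowded L w}))
      \<inter> {w \<in> words D (Suc n). first_crowded L w} = {}"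
    by (auto simp: first_crowded_def)
  moreover have "card ((\<lambda>(d, w). d # w) ` (D \<times> {w \<in> words D n. crowded L w})) = K * ncr L n"
    by (subst card_image) (auto simp: inj_on_def card_cartesian_product card_D ncr_def)
  ultimately show ?thesis unfolding ncr_def by (simp add: card_Un_disjoint)
qed

text \<open>Crowded words are sorted by their unique first crowded ancestor; one of length
  \<open>j\<close> has \<open>K ^ (n - j)\<close> descendants.\<close>

lemma sum_first_crowded:
  "(\<Sum>j\<le>n. card {w \<in> words D j. first_crowded L w} * K ^ (n - j)) = ncr L n"
proof (induction n)
  case 0
  have "{w \<in> words D 0. first_crowded L w} = {w \<in> words D 0. crowded L w}"
    by (auto simp: first_crowded_def)
  then show ?case by (simp add: ncr_def)
next
  case (Suc n)
  have "(\<Sum>j\<le>n. card {w \<in> words D j. first_crowded L w} * K ^ (Suc n - j)) = K * ncr L n"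
    unfolding Suc[symmetric] sum_distrib_left
    by (intro sum.cong) (auto simp: Suc_diff_le)
  then show ?case by (simp add: ncr_Suc)
qed

lemma ncr_mono: "ncr L n * K ^ m \<le> ncr L (n + m)"
proof (induction m)
  case (Suc m)
  have "ncr L n * K ^ Suc m \<le> K * ncr L (n + m)" using mult_le_mono2[OF Suc, of K] by (simp add: algebra_simps)
  then show ?case by (simp add: ncr_Suc trans_le_add1)
qed auto

lemma ncr_le: "ncr L n \<le> K ^ n"
  unfolding ncr_def by (rule order_trans[OF card_mono[of "words D n"]]) (auto simp: card_words card_D)

text \<open>Self-similarity: a neighbour of \<open>u @ w\<close> has the form \<open>u' @ w'\<close>
  with \<open>w'\<close> near \<open>w\<close>. For fixed \<open>w'\<close> the pairs
  \<open>(u, u')\<close> are near up to a translation, which \<open>card_pairs_shift\<close> removes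
  at the cost of a factor 4.\<close>

lemma sum_nbr_extend:
  assumes "w \<in> words D j"
  shows "(\<Sum>u\<in>words D m. nbr (u @ w)) \<le> nbr w * (4 * En m)"
proof -
  define N where "N = {w' \<in> words D j. \<bar>\<sigma> w - \<sigma> w'\<bar> \<le> 4}"
  have lw: "length w = j" using assms by (auto simp: words_def)
  have cN: "card N = nbr w" using lw by (simp add: N_def nbr_def)
  have fN: "finite N" by (simp add: N_def)
  define P where "P w' = {(u, u') \<in> words D m \<times> words D m.
     \<bar>\<sigma> u - \<sigma> u' - real K ^ m * (\<sigma> w' - \<sigma> w)\<bar> \<le> 4}" for w'
  have fP: "finite (P w')" for w'
    by (rule finite_subset[of _ "words D m \<times> words D m"]) (auto simp: P_def)
  define M where "M u = {w' \<in> words D (m + j). \<bar>\<sigma> (u @ w) - \<sigma> w'\<bar> \<le> 4}" for u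
  have "(\<Sum>u\<in>words D m. nbr (u @ w)) = (\<Sum>u\<in>words D m. card (M u))"
    by (intro sum.cong refl) (auto simp: nbr_def M_def words_def lw)
  also have "\<dots> = card (Sigma (words D m) M)"
    by (subst card_SigmaI) (auto simp: M_def)
  also have "\<dots> \<le> card ((\<lambda>(w', u, u'). (u, u' @ w')) ` Sigma N P)"
  proof (rule card_mono)
    show "finite ((\<lambda>(w', u, u'). (u, u' @ w')) ` Sigma N P)" using fN fP by auto
    show "Sigma (words D m) M \<subseteq> (\<lambda>(w', u, u'). (u, u' @ w')) ` Sigma N P"
    proof clarify
      fix u y assume u: "u \<in> words D m" and "y \<in> M u"
      then have y: "y \<in> words D (m + j)" and ny: "\<bar>\<sigma> (u @ w) - \<sigma> y\<bar> \<le> 4" by (auto simp: M_def)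
      then obtain w' u' where y': "y = u' @ w'" "u' \<in> words D m" "w' \<in> words D j"
        by (auto simp: words_append)
      have l: "length u = m" "length u' = m" using u y' by (auto simp: words_def)
      have eq: "\<sigma> (u @ w) - \<sigma> y = \<sigma> u - \<sigma> u' - real K ^ m * (\<sigma> w' - \<sigma> w)"
        by (simp add: y' sig_append l algebra_simps)
      have "real K ^ m * \<bar>\<sigma> w - \<sigma> w'\<bar> = \<bar>real K ^ m * (\<sigma> w - \<sigma> w')\<bar>" by (simp add: abs_mult)
      also have "\<dots> = \<bar>(\<sigma> (u @ w) - \<sigma> y) - \<sigma> u + \<sigma> u'\<bar>" by (simp add: eq algebra_simps)
      also have "\<dots> \<le> 4 + 2 * (real K ^ m - 1) + 2 * (real K ^ m - 1)"
        using ny sig_le[OF u] sig_le[OF y'(2)] by linarith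
      also have "\<dots> = real K ^ m * 4" by simp
      finally have "\<bar>\<sigma> w - \<sigma> w'\<bar> \<le> 4"
        by (subst (asm) mult_le_cancel_left_pos) auto
      then have "(w', u, u') \<in> Sigma N P" using y' u ny eq by (auto simp: N_def P_def)
      then show "(u, y) \<in> (\<lambda>(w', u, u'). (u, u' @ w')) ` Sigma N P"
        using y' by (metis (no_types, lifting) image_eqI case_prod_conv)
    qed
  qed
  also have "\<dots> \<le> card (Sigma N P)" by (rule card_image_le) (use fN fP in auto)
  also have "\<dots> = (\<Sum>w'\<in>N. card (P w'))" using fN fP by (subst card_SigmaI) auto
  also have "\<dots> \<le> (\<Sum>w'\<in>N. 4 * En m)"
    unfolding P_def energy_def near_pairs_def by (intro sum_mono card_pairs_shift) auto
  finally show ?thesis by (simp add: cN)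
qed

text \<open>Let \<open>h\<close> maximise the normalised energy, with maximum \<open>e\<close>. At
  level \<open>h\<close> an uncrowded word contributes less than \<open>L\<close>, and the
  descendants of a first crowded word of length \<open>j\<close> contribute at most
  \<open>4 * K * L * e * K ^ (h - j)\<close>, by maximality of \<open>e\<close>. As
  \<open>e > 2 * L\<close>, the uncrowded words supply less than half of \<open>e * K ^ h\<close>;
  then \<open>e\<close> cancels.\<close>

lemma crowded_fraction:
  assumes L: "L \<ge> 1" and k: "k \<le> n" and big: "real (En k) > 2 * L * real K ^ k"
  shows "real (ncr L n) \<ge> real K ^ n / (8 * real K * L)"
proof -
  define e where "e = Max ((\<lambda>j. real (En j) / real K ^ j) ` {..n})"
  have "e \<in> (\<lambda>j. real (En j) / real K ^ j) ` {..n}" unfolding e_def by (rule Max_in) auto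
  then obtain h where h: "h \<le> n" "e = real (En h) / real K ^ h" by auto
  have le_e: "real (En j) \<le> e * real K ^ j" if "j \<le> n" for j
  proof -
    have "real (En j) / real K ^ j \<le> e" unfolding e_def using that by (intro Max_ge) auto
    then show ?thesis by (simp add: divide_le_eq)
  qed
  have "2 * L * real K ^ k < e * real K ^ k" using big le_e[OF k] by linarith
  then have e2: "e > 2 * L" by simp
  have "real (En h) = (\<Sum>w\<in>words D h. real (nbr w))" by (simp flip: sum_nbr)
  also have "\<dots> \<le> (\<Sum>w\<in>words D h. L + (\<Sum>j\<le>h. if first_crowded L (drop (h - j) w) then real (nbr w) else 0))"
  proof (rule sum_mono)
    fix w assume w: "w \<in> words D h"
    have lw: "length w = h" using w by (auto simp: words_def)
    show "real (nbr w) \<le> L + (\<Sum>j\<le>h. if first_crowded L (drop (h - j) w) then real (nbr w) else 0)"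
    proof (cases "crowded L w")
      case True
      then obtain j where j: "j \<le> h" "first_crowded L (drop (h - j) w)"
        using crowded_imp_first lw by blast
      then have "real (nbr w) = (if first_crowded L (drop (h - j) w) then real (nbr w) else 0)" by simp
      also have "\<dots> \<le> (\<Sum>j\<le>h. if first_crowded L (drop (h - j) w) then real (nbr w) else 0)"
        using j by (intro member_le_sum) auto
      finally show ?thesis using L by linarith
    next
      case False
      have "(\<Sum>j\<le>h. if first_crowded L (drop (h - j) w) then real (nbr w) else 0) \<ge> 0"
        by (intro sum_nonneg) auto
      then show ?thesis using not_crowded_nbr[OF False] by linarith
    qed
  qed
  also have "\<dots> = L * real K ^ h + (\<Sum>j\<le>h. \<Sum>w\<in>words D h. if first_crowded L (drop (h - j) w) then real (nbr w) else 0)"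
    by (simp add: sum.distrib card_words card_D) (rule sum.swap)
  also have "(\<Sum>j\<le>h. \<Sum>w\<in>words D h. if first_crowded L (drop (h - j) w) then real (nbr w) else 0)
     \<le> (\<Sum>j\<le>h. real (card {w \<in> words D j. first_crowded L w}) * (real K * L * (4 * (e * real K ^ (h - j)))))"
  proof (rule sum_mono)
    fix j assume j: "j \<in> {..h}"
    have "(\<Sum>w\<in>words D h. if first_crowded L (drop (h - j) w) then real (nbr w) else 0)
      = (\<Sum>w\<in>words D ((h - j) + j). if first_crowded L (drop (h - j) w) then real (nbr w) else 0)"
      using j by simp
    also have "\<dots> = (\<Sum>s\<in>words D j. \<Sum>u\<in>words D (h - j). if first_crowded L s then real (nbr (u @ s)) else 0)"
      unfolding sum_words_append by (intro sum.cong refl) (auto simp: words_def)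
    also have "\<dots> = (\<Sum>s\<in>words D j. if first_crowded L s then real (\<Sum>u\<in>words D (h - j). nbr (u @ s)) else 0)"
      by (intro sum.cong refl) auto
    also have "\<dots> \<le> (\<Sum>s\<in>words D j. if first_crowded L s then real K * L * (4 * (e * real K ^ (h - j))) else 0)"
    proof (rule sum_mono)
      fix s assume s: "s \<in> words D j"
      have "real (\<Sum>u\<in>words D (h - j). nbr (u @ s)) \<le> real K * L * (4 * (e * real K ^ (h - j)))"
        if fc: "first_crowded L s"
      proof -
        have "real (\<Sum>u\<in>words D (h - j). nbr (u @ s)) \<le> real (nbr s * (4 * En (h - j)))"
          using sum_nbr_extend[OF s, of "h - j"] by (simp only: of_nat_le_iff)
        also have "\<dots> = real (nbr s) * (4 * real (En (h - j)))" by simp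
        also have "\<dots> \<le> real K * L * (4 * (e * real K ^ (h - j)))"
          using nbr_first_crowded[OF s fc L] le_e[of "h - j"] h L by (intro mult_mono) auto
        finally show ?thesis .
      qed
      then show "(if first_crowded L s then real (\<Sum>u\<in>words D (h - j). nbr (u @ s)) else 0)
        \<le> (if first_crowded L s then real K * L * (4 * (e * real K ^ (h - j))) else 0)" by auto
    qed
    also have "\<dots> = real (card {w \<in> words D j. first_crowded L w}) * (real K * L * (4 * (e * real K ^ (h - j))))"
      by (simp add: sum.If_cases Int_def conj_commute)
    finally show "(\<Sum>w\<in>words D h. if first_crowded L (drop (h - j) w) then real (nbr w) else 0)
      \<le> real (card {w \<in> words D j. first_crowded L w}) * (real K * L * (4 * (e * real K ^ (h - j))))" .
  qed
  also have "\<dots> = 4 * real K * L * e * real (ncr L h)"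
    unfolding sum_first_crowded[symmetric] by (simp add: sum_distrib_left algebra_simps)
  finally have ineq: "real (En h) \<le> L * real K ^ h + 4 * real K * L * e * real (ncr L h)" by simp
  have eh: "real (En h) = e * real K ^ h" using h by simp
  have "(e / 2) * real K ^ h \<le> (e - L) * real K ^ h" using e2 by (intro mult_right_mono) auto
  also have "\<dots> \<le> 4 * real K * L * e * real (ncr L h)" using ineq eh by (simp add: algebra_simps)
  finally have "e * real K ^ h \<le> e * (8 * real K * L * real (ncr L h))" by (simp add: algebra_simps)
  moreover have "e > 0" using e2 L by linarith
  ultimately have "real K ^ h \<le> 8 * real K * L * real (ncr L h)" by (simp only: mult_le_cancel_left_pos)
  \<comment> \<open>The fraction of crowded words does not decrease with the length, so the bound at
    level \<open>h\<close> passes to level \<open>n\<close>.\<close>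
  then have "real K ^ h * real K ^ (n - h) \<le> 8 * real K * L * real (ncr L h) * real K ^ (n - h)"
    by (intro mult_right_mono) auto
  also have "\<dots> = 8 * real K * L * real (ncr L h * K ^ (n - h))" by simp
  also have "\<dots> \<le> 8 * real K * L * real (ncr L n)"
    using ncr_mono[of L h "n - h"] h L by (intro mult_left_mono) (auto simp del: of_nat_mult)
  finally have "real K ^ n \<le> 8 * real K * L * real (ncr L n)" using h by (simp flip: power_add)
  then show ?thesis using L by (simp add: divide_le_eq algebra_simps)
qed


section \<open>Tall stacks and the measure of the cover\<close>

definition tall :: "real \<Rightarrow> nat \<Rightarrow> real set" where
  "tall L N = {x. \<exists>j\<le>N. L \<le> real (St j x)}"

text \<open>The interval of a word lies in the intervals of its ancestors, so \<open>y\<close> is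
  within 2 of a crowded ancestor and within 6 of the neighbours of that ancestor.\<close>

lemma crowded_imp_tall:
  assumes "w \<in> words D n" "crowded L w" "\<bar>real K ^ n * y - \<sigma> w\<bar> \<le> 2"
  shows "y \<in> tall L n"
  using assms
proof (induction w arbitrary: n)
  case Nil
  then have n: "n = 0" by (auto simp: words_def)
  have "real (nbr []) \<le> real (St 0 y)"
    unfolding nbr_def stack_def of_nat_le_iff using Nil by (intro card_mono) (auto simp: n)
  then show ?case using Nil n by (auto simp: tall_def)
next
  case (Cons d w)
  then obtain n' where n: "n = Suc n'" by (auto simp: words_def)
  have w: "d \<in> D" "w \<in> words D n'" using Cons n by auto
  show ?case
  proof (cases "crowded L w")
    case True
    have "real K * \<bar>real K ^ n' * y - \<sigma> w\<bar> = \<bar>real K * (real K ^ n' * y - \<sigma> w)\<bar>" by (simp add: abs_mult)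
    also have "\<dots> = \<bar>(real K ^ n * y - \<sigma> (d # w)) + v d\<bar>" by (simp add: n algebra_simps)
    also have "\<dots> \<le> real K * 2" using Cons.prems(3) v_le[OF w(1)] by (simp add: algebra_simps)
    finally have "\<bar>real K ^ n' * y - \<sigma> w\<bar> \<le> 2" by (simp only: mult_le_cancel_left_pos[OF K_pos(2)])
    then have "y \<in> tall L n'" using Cons.IH[OF w(2) True] by simp
    then show ?thesis unfolding tall_def n by (auto intro: le_SucI)
  next
    case False
    then have "L \<le> real (nbr (d # w))" using Cons by auto
    also have "\<dots> \<le> real (St n y)"
      unfolding nbr_def stack_def of_nat_le_iff 
      by (rule card_mono, simp, use Cons.prems in \<open>auto simp: words_def\<close>)
    finally show ?thesis by (auto simp: tall_def)
  qed
qed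

text \<open>Zooming in on the cylinder of \<open>w\<close>: appending \<open>w\<close> turns each
  word counted at the rescaled point into one counted over \<open>x\<close>.\<close>

lemma stack_append_le:
  assumes "w \<in> words D n"
  shows "St j (real K ^ n * x - \<sigma> w) \<le> St (j + n) x"
proof -
  have "finite {u \<in> words D (j + n). \<bar>real K ^ (j + n) * x - \<sigma> u\<bar> \<le> 6}" by simp
  then have "card ((\<lambda>u. u @ w) ` {u \<in> words D j. \<bar>real K ^ j * (real K ^ n * x - \<sigma> w) - \<sigma> u\<bar> \<le> 6})
    \<le> card {u \<in> words D (j + n). \<bar>real K ^ (j + n) * x - \<sigma> u\<bar> \<le> 6}"
    by (rule card_mono) (use assms in \<open>auto simp: words_def sig_append power_add algebra_simps\<close>)
  moreover have "inj_on (\<lambda>u. u @ w) A" for A by (auto simp: inj_on_def)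
  ultimately show ?thesis by (simp add: stack_def card_image)
qed

text \<open>If the interval of a word keeps a point outside \<open>tall\<close>, none of its
  \<open>J\<close> blocks of \<open>n\<close> digits is crowded: a crowded block, seen after zooming
  in on the preceding cylinder, would put a tall stack over that point. The blocks are chosen
  independently, so the counts multiply.\<close>

lemma card_light_words:
  "real (card {w \<in> words D (J * n). \<exists>x. x \<notin> tall L (J * n) \<and> \<bar>real K ^ (J * n) * x - \<sigma> w\<bar> \<le> 2})
    \<le> (real K ^ n - real (ncr L n)) ^ J"
proof (induction J)
  case 0
  have "card {w \<in> words D 0. \<exists>x. x \<notin> tall L 0 \<and> \<bar>real K ^ 0 * x - \<sigma> w\<bar> \<le> 2} \<le> card (words D 0)"
    by (intro card_mono) auto
  then show ?case by simp
next
  case (Suc J)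
  define W where "W J = {w \<in> words D (J * n). \<exists>x. x \<notin> tall L (J * n) \<and> \<bar>real K ^ (J * n) * x - \<sigma> w\<bar> \<le> 2}" for J
  define V where "V = {w \<in> words D n. \<not> crowded L w}"
  have fin: "finite (W J)" "finite V" for J by (auto simp: W_def V_def)
  have cV: "real (card V) = real K ^ n - real (ncr L n)"
  proof -
    have "V = words D n - {w \<in> words D n. crowded L w}" by (auto simp: V_def)
    then have "card V = card (words D n) - card {w \<in> words D n. crowded L w}"
      by (simp add: card_Diff_subset)
    then show ?thesis using ncr_le[of L n] by (simp add: card_words card_D ncr_def)
  qed
  have "W (Suc J) \<subseteq> (\<lambda>(u, w). u @ w) ` (V \<times> W J)"
  proof
    fix y assume "y \<in> W (Suc J)"
    then have y: "y \<in> words D (n + J * n)"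
      and "\<exists>x. x \<notin> tall L (n + J * n) \<and> \<bar>real K ^ (n + J * n) * x - \<sigma> y\<bar> \<le> 2" by (auto simp: W_def)
    then obtain x where x: "x \<notin> tall L (n + J * n)" "\<bar>real K ^ (n + J * n) * x - \<sigma> y\<bar> \<le> 2" by auto
    obtain u w where uw: "y = u @ w" "u \<in> words D n" "w \<in> words D (J * n)"
      using y by (auto simp: words_append)
    have lu: "length u = n" using uw by (auto simp: words_def)
    have x1: "x \<notin> tall L (J * n)" using x(1) by (auto simp: tall_def)
    define x' where "x' = real K ^ (J * n) * x - \<sigma> w"
    have x2: "\<bar>real K ^ n * x' - \<sigma> u\<bar> \<le> 2"
      using x(2) by (simp add: x'_def uw sig_append lu power_add algebra_simps)
    have "x' \<notin> tall L n"
    proof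
      assume "x' \<in> tall L n"
      then obtain j where j: "j \<le> n" "L \<le> real (St j x')" by (auto simp: tall_def)
      note j(2)
      also have "real (St j x') \<le> real (St (j + J * n) x)"
        unfolding x'_def using stack_append_le[OF uw(3)] by simp
      finally show False using x(1) j(1) by (auto simp: tall_def)
    qed
    then have "u \<in> V" using crowded_imp_tall[OF uw(2) _ x2] uw(2) by (auto simp: V_def)
    moreover have "w \<in> W J"
    proof -
      have "real K ^ n * \<bar>real K ^ (J * n) * x - \<sigma> w\<bar> = \<bar>(real K ^ n * x' - \<sigma> u) + \<sigma> u\<bar>"
        by (simp add: x'_def abs_mult)
      also have "\<dots> \<le> 2 + 2 * (real K ^ n - 1)" using x2 sig_le[OF uw(2)] by linarith
      also have "\<dots> = real K ^ n * 2" by simp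
      finally have "\<bar>real K ^ (J * n) * x - \<sigma> w\<bar> \<le> 2" by (subst (asm) mult_le_cancel_left_pos) auto
      then show ?thesis using x1 uw(3) by (auto simp: W_def)
    qed
    ultimately show "y \<in> (\<lambda>(u, w). u @ w) ` (V \<times> W J)" using uw by auto
  qed
  then have "card (W (Suc J)) \<le> card ((\<lambda>(u, w). u @ w) ` (V \<times> W J))"
    by (intro card_mono) (auto simp: fin)
  also have "\<dots> \<le> card (V \<times> W J)" by (rule card_image_le) (auto simp: fin)
  finally have "real (card (W (Suc J))) \<le> real (card V) * real (card (W J))"
    by (simp add: card_cartesian_product flip: of_nat_mult)
  also have "\<dots> \<le> real (card V) * (real K ^ n - real (ncr L n)) ^ J"
    using Suc by (intro mult_left_mono) (auto simp: W_def)
  finally show ?case by (simp add: cV W_def)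
qed

lemma stack_borel [measurable]: "(\<lambda>x. real (St j x)) \<in> borel_measurable borel"
proof -
  have "real (St j x) = (\<Sum>w\<in>words D j. indicator {x. \<bar>real K ^ j * x - \<sigma> w\<bar> \<le> 6} x)" for x
    by (simp add: stack_def indicator_def sum.If_cases Int_def)
  then show ?thesis by simp
qed

lemma tall_borel [measurable, simp]: "tall L N \<in> sets borel"
proof -
  have "tall L N = (\<Union>j\<in>{..N}. {x. L \<le> real (St j x)})" by (auto simp: tall_def)
  then show ?thesis by simp
qed

text \<open>A point lying on \<open>L\<close> intervals of level \<open>j\<close> sees mass \<open>L K\<^sup>-\<^sup>j\<close> within distance \<open>8 K\<^sup>-\<^sup>j\<close>,
  so this is the weak-type bound for the maximal function of the projected Cantor measure.\<close>

lemma emeasure_tall: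
  assumes "L > 0"
  shows "emeasure lborel (tall L N) \<le> ennreal (80 / L)"
proof -
  define j where "j x = (SOME j. j \<le> N \<and> L \<le> real (St j x))" for x
  have j: "j x \<le> N \<and> L \<le> real (St (j x) x)" if "x \<in> tall L N" for x
    unfolding j_def by (rule someI_ex) (use that in \<open>auto simp: tall_def\<close>)
  \<comment> \<open>Words of level \<open>j x\<close> counted at \<open>x\<close> are within 6 units
    and their extensions move by at most 2 more, hence 8. The fivefold balls have length
    \<open>10 * r x\<close>, and the radii will add up to at most \<open>8 / L\<close>.\<close>
  define r where "r x = 8 / real K ^ j x" for x
  have r_pos: "r x > 0" for x by (simp add: r_def)
  have r_le: "r x \<le> 8" for x
  proof -
    have "real K ^ j x \<ge> 1" using K_ge by (intro one_le_power) auto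
    then show ?thesis unfolding r_def by (simp add: divide_le_eq)
  qed
  have self_cover: "tall L N \<subseteq> (\<Union>i\<in>tall L N. cball i (r i))"
  proof
    fix x assume "x \<in> tall L N"
    then show "x \<in> (\<Union>i\<in>tall L N. cball i (r i))"
      using r_pos[of x] by (intro UN_I[of x]) auto
  qed
  obtain C where C: "countable C" "C \<subseteq> tall L N"
    "pairwise (\<lambda>i k. disjnt (cball i (r i)) (cball k (r k))) C"
    "tall L N \<subseteq> (\<Union>i\<in>C. cball i (5 * r i))"
    by (rule Vitali_covering_lemma_cballs[OF self_cover, of 8]) (simp_all only: r_pos r_le simp_thms)
  define M where "M x = {w \<in> words D N. \<sigma> w / real K ^ N \<in> cball x (r x)}" for x
  have fM: "finite (M x)" for x by (auto simp: M_def)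
  have cM: "L * real K ^ N / real K ^ j x \<le> real (card (M x))" if x: "x \<in> tall L N" for x
  proof -
    have jx: "j x \<le> N" "L \<le> real (St (j x) x)" using j[OF x] by auto
    define S where "S = {w \<in> words D (j x). \<bar>real K ^ j x * x - \<sigma> w\<bar> \<le> 6}"
    have "(\<lambda>(s, u). u @ s) ` (S \<times> words D (N - j x)) \<subseteq> M x"
    proof clarify
      fix s u assume s: "s \<in> S" and u: "u \<in> words D (N - j x)"
      have lu: "length u = N - j x" using u by (auto simp: words_def)
      have mem: "u @ s \<in> words D N"
        using s u jx(1) by (auto simp: words_def S_def)
      have N: "real K ^ N = real K ^ (N - j x) * real K ^ j x" using jx(1) by (simp flip: power_add)
      have "\<bar>real K ^ N * x - \<sigma> (u @ s)\<bar> = \<bar>real K ^ (N - j x) * (real K ^ j x * x - \<sigma> s) - \<sigma> u\<bar>"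
        by (simp add: sig_append lu N algebra_simps)
      also have "\<dots> \<le> real K ^ (N - j x) * \<bar>real K ^ j x * x - \<sigma> s\<bar> + \<bar>\<sigma> u\<bar>"
        by (rule order_trans[OF abs_triangle_ineq4]) (simp add: abs_mult)
      also have "\<dots> \<le> real K ^ (N - j x) * 6 + 2 * (real K ^ (N - j x) - 1)"
        using s sig_le[OF u] by (intro add_mono mult_left_mono) (auto simp: S_def)
      also have "\<dots> \<le> real K ^ (N - j x) * 8" by simp
      finally have "\<bar>real K ^ N * x - \<sigma> (u @ s)\<bar> / real K ^ N \<le> real K ^ (N - j x) * 8 / real K ^ N"
        by (intro divide_right_mono) auto
      also have "\<bar>real K ^ N * x - \<sigma> (u @ s)\<bar> / real K ^ N = \<bar>x - \<sigma> (u @ s) / real K ^ N\<bar>"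
      proof -
        have "x - \<sigma> (u @ s) / real K ^ N = (real K ^ N * x - \<sigma> (u @ s)) / real K ^ N"
          by (simp add: diff_divide_distrib)
        then show ?thesis by (simp only: abs_divide) simp
      qed
      also have "real K ^ (N - j x) * 8 / real K ^ N = r x"
        unfolding N r_def by (rule mult_divide_mult_cancel_left) simp
      finally show "u @ s \<in> M x" using mem by (auto simp: M_def dist_real_def)
    qed
    then have "card ((\<lambda>(s, u). u @ s) ` (S \<times> words D (N - j x))) \<le> card (M x)"
      by (intro card_mono fM)
    moreover have "card ((\<lambda>(s, u). u @ s) ` (S \<times> words D (N - j x))) = card S * K ^ (N - j x)"
      by (subst card_image[OF inj_on_subset[OF inj_on_append]])
         (auto simp: S_def card_cartesian_product card_words card_D)
    ultimately have "real (card S) * real K ^ (N - j x) \<le> real (card (M x))"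
      by (simp flip: of_nat_power of_nat_mult)
    moreover have "L * real K ^ (N - j x) \<le> real (card S) * real K ^ (N - j x)"
      using jx by (intro mult_right_mono) (auto simp: S_def stack_def)
    moreover have "real K ^ (N - j x) = real K ^ N / real K ^ j x" using jx(1) by (simp add: power_diff)
    ultimately show ?thesis by simp
  qed
  have disM: "M x \<inter> M y = {}" if "x \<in> C" "y \<in> C" "x \<noteq> y" for x y
    using C(3) that unfolding pairwise_def disjnt_def M_def by blast
  have "card (\<Union>x\<in>F. M x) = (\<Sum>x\<in>F. card (M x))" if "finite F" "F \<subseteq> C" for F
    by (rule card_UN_disjoint[OF that(1)]) (use that(2) disM fM in blast)+
  moreover have "card (\<Union>x\<in>F. M x) \<le> card (words D N)" for F
    by (rule card_mono) (auto simp: M_def)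
  ultimately have sumM: "(\<Sum>x\<in>F. card (M x)) \<le> K ^ N" if "finite F" "F \<subseteq> C" for F
    using that by (metis card_words card_D finite_D)
  have sumr: "(\<Sum>x\<in>F. r x) \<le> 8 / L" if F: "finite F" "F \<subseteq> C" for F
  proof -
    have "(\<Sum>x\<in>F. r x) * (L * real K ^ N) = (\<Sum>x\<in>F. 8 * (L * real K ^ N / real K ^ j x))"
      by (simp add: r_def sum_distrib_right)
    also have "\<dots> \<le> (\<Sum>x\<in>F. 8 * real (card (M x)))"
      using F C(2) by (intro sum_mono mult_left_mono cM) auto
    also have "\<dots> = 8 * real (\<Sum>x\<in>F. card (M x))" by (simp add: sum_distrib_left)
    also have "\<dots> \<le> 8 * real (K ^ N)" using sumM[OF F] by (intro mult_left_mono) (auto simp only: of_nat_le_iff)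
    finally have "(\<Sum>x\<in>F. r x) * L * real K ^ N \<le> 8 * real K ^ N" by (simp add: algebra_simps)
    then have "(\<Sum>x\<in>F. r x) * L \<le> 8" by (subst (asm) mult_le_cancel_right_pos) auto
    then show ?thesis using assms by (simp add: le_divide_eq)
  qed
  \<comment> \<open>The selected balls are disjoint and each contains at least one of the
    \<open>K ^ N\<close> rescaled words.\<close>
  have "finite C"
  proof (rule ccontr)
    assume inf: "infinite C"
    obtain F where F: "finite F" "F \<subseteq> C" "card F = K ^ N + 1"
      using infinite_arbitrarily_large[OF inf] by blast
    have "K ^ N + 1 = (\<Sum>x\<in>F. 1)" using F by simp
    also have "\<dots> \<le> (\<Sum>x\<in>F. card (M x))"
    proof (rule sum_mono)
      fix x assume "x \<in> F"
      then have "x \<in> tall L N" using F C by auto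
      then have "0 < real (card (M x))" using cM[of x] assms
        by (intro less_le_trans[OF _ cM]) auto
      then show "1 \<le> card (M x)" by simp
    qed
    also have "\<dots> \<le> K ^ N" by (rule sumM[OF F(1,2)])
    finally show False by simp
  qed
  have "emeasure lborel (tall L N) \<le> emeasure lborel (\<Union>x\<in>C. cball x (5 * r x))"
    by (rule emeasure_mono[OF C(4)]) (use \<open>finite C\<close> in auto)
  also have "\<dots> \<le> (\<Sum>x\<in>C. emeasure lborel (cball x (5 * r x)))"
    by (rule emeasure_subadditive_finite) (use \<open>finite C\<close> in auto)
  also have "\<dots> = (\<Sum>x\<in>C. ennreal (10 * r x))"
    using r_pos by (intro sum.cong refl) (simp add: cball_eq_atLeastAtMost less_imp_le)
  also have "\<dots> = ennreal (\<Sum>x\<in>C. 10 * r x)"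
    using r_pos by (intro sum_ennreal) (auto intro!: less_imp_le)
  also have "(\<Sum>x\<in>C. 10 * r x) \<le> 80 / L"
    using sumr[OF \<open>finite C\<close> order_refl] by (simp add: sum_distrib_left[symmetric])
  finally show ?thesis by (simp add: ennreal_leI)
qed

lemma cover_borel [measurable]: "cover K D v n \<in> sets borel"
proof -
  have "cover K D v n = (\<Union>w\<in>words D n. {x. \<bar>real K ^ n * x - \<sigma> w\<bar> \<le> 2})" by (auto simp: cover_def)
  moreover have "{x. \<bar>real K ^ n * x - \<sigma> w\<bar> \<le> 2} \<in> sets borel" for w by measurable
  ultimately show ?thesis by auto
qed

text \<open>What lies outside \<open>tall\<close> is covered by the intervals of the light words,
  each of length \<open>4 / K ^ (J * n)\<close>.\<close>

lemma emeasure_cover: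
  assumes L: "L \<ge> 1" and k: "k \<le> n" and big: "real (En k) > 2 * L * real K ^ k"
  shows "emeasure lborel (cover K D v (J * n)) 
    \<le> ennreal (80 / L) + ennreal (4 * (1 - 1 / (8 * real K * L)) ^ J)"
proof -
  define N where "N = J * n"
  define W where "W = {w \<in> words D N. \<exists>x. x \<notin> tall L N \<and> \<bar>real K ^ N * x - \<sigma> w\<bar> \<le> 2}"
  define I where "I w = {(\<sigma> w - 2) / real K ^ N .. (\<sigma> w + 2) / real K ^ N}" for w
  have fW: "finite W" by (auto simp: W_def)
  have "x \<in> I w" if "\<bar>real K ^ N * x - \<sigma> w\<bar> \<le> 2" for x w
    using that by (auto simp: I_def divide_le_eq le_divide_eq abs_le_iff algebra_simps)
  then have sub: "cover K D v N \<subseteq> tall L N \<union> (\<Union>w\<in>W. I w)"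
    by (auto simp: cover_def W_def)
  have mI: "(\<Union>w\<in>W. I w) \<in> sets lborel"
    by (rule sets.finite_UN[OF fW]) (simp add: I_def)
  have "emeasure lborel (cover K D v N) \<le> emeasure lborel (tall L N \<union> (\<Union>w\<in>W. I w))"
    by (rule emeasure_mono[OF sub sets.Un[OF _ mI]]) simp
  also have "\<dots> \<le> emeasure lborel (tall L N) + emeasure lborel (\<Union>w\<in>W. I w)"
    by (rule emeasure_subadditive[OF _ mI]) simp
  also have "\<dots> \<le> ennreal (80 / L) + (\<Sum>w\<in>W. emeasure lborel (I w))"
    using L fW by (intro add_mono emeasure_tall emeasure_subadditive_finite) (auto simp: I_def)
  also have "(\<Sum>w\<in>W. emeasure lborel (I w)) = (\<Sum>w\<in>W. ennreal (4 / real K ^ N))"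
    by (intro sum.cong refl) (simp add: I_def divide_right_mono diff_divide_distrib[symmetric])
  also have "\<dots> = ennreal (real (card W) * (4 / real K ^ N))"
    by (subst sum_ennreal) auto
  also have "\<dots> \<le> ennreal (4 * (1 - 1 / (8 * real K * L)) ^ J)"
  proof (rule ennreal_leI)
    have "real (card W) \<le> (real K ^ n - real (ncr L n)) ^ J"
      unfolding W_def N_def by (rule card_light_words)
    also have "\<dots> \<le> (real K ^ n * (1 - 1 / (8 * real K * L))) ^ J"
    proof (rule power_mono)
      show "real K ^ n - real (ncr L n) \<le> real K ^ n * (1 - 1 / (8 * real K * L))"
        using crowded_fraction[OF L k big] by (simp add: algebra_simps)
      show "0 \<le> real K ^ n - real (ncr L n)" using ncr_le[of L n] by (simp flip: of_nat_power)
    qed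
    also have "\<dots> = real K ^ N * (1 - 1 / (8 * real K * L)) ^ J"
      by (simp add: N_def power_mult_distrib power_mult mult.commute[of J])
    finally show "real (card W) * (4 / real K ^ N) \<le> 4 * (1 - 1 / (8 * real K * L)) ^ J"
      by (simp add: field_simps)
  qed
  finally show ?thesis unfolding N_def by (simp add: add_left_mono)
qed

lemma cover_Suc_subset: "cover K D v (Suc n) \<subseteq> cover K D v n"
proof
  fix x assume "x \<in> cover K D v (Suc n)"
  then obtain d w where w: "d \<in> D" "w \<in> words D n" "\<bar>real K ^ Suc n * x - \<sigma> (d # w)\<bar> \<le> 2"
    by (auto simp: cover_def words_Suc)
  have "real K * \<bar>real K ^ n * x - \<sigma> w\<bar> = \<bar>real K * (real K ^ n * x - \<sigma> w)\<bar>" by (simp add: abs_mult)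
  also have "\<dots> = \<bar>(real K ^ Suc n * x - \<sigma> (d # w)) + v d\<bar>" by (simp add: algebra_simps)
  also have "\<dots> \<le> real K * 2" using w(3) v_le[OF w(1)] by (simp add: algebra_simps)
  finally have "\<bar>real K ^ n * x - \<sigma> w\<bar> \<le> 2" by (simp only: mult_le_cancel_left_pos[OF K_pos(2)])
  then show "x \<in> cover K D v n" using w(2) by (auto simp: cover_def)
qed

lemma cover_antimono: "m \<le> n \<Longrightarrow> cover K D v n \<subseteq> cover K D v m"
  by (induction n rule: dec_induct) (use cover_Suc_subset in blast)+

lemma emeasure_cover_le: "emeasure lborel (cover K D v n) \<le> 8"
proof -
  have "cover K D v n \<subseteq> {-4..4}"
  proof
    fix x assume "x \<in> cover K D v n"
    then obtain w where w: "w \<in> words D n" "\<bar>real K ^ n * x - \<sigma> w\<bar> \<le> 2" by (auto simp: cover_def)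
    have K1: "1 \<le> real K ^ n" using K_ge by (intro one_le_power) auto
    have "real K ^ n * \<bar>x\<bar> = \<bar>real K ^ n * x\<bar>" by (simp add: abs_mult)
    also have "\<dots> \<le> \<bar>real K ^ n * x - \<sigma> w\<bar> + \<bar>\<sigma> w\<bar>"
      using abs_triangle_ineq[of "real K ^ n * x - \<sigma> w" "\<sigma> w"] by simp
    also have "\<dots> \<le> 2 + 2 * (real K ^ n - 1)" by (intro add_mono w(2) sig_le[OF w(1)])
    also have "\<dots> \<le> real K ^ n * 4" using K1 by simp
    finally have "\<bar>x\<bar> \<le> 4" by (subst (asm) mult_le_cancel_left_pos) auto
    then show "x \<in> {-4..4}" by (simp add: abs_le_iff)
  qed
  then have "emeasure lborel (cover K D v n) \<le> emeasure lborel {-4..4::real}" by (rule emeasure_mono) simp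
  then show ?thesis by simp
qed

text \<open>The size of \<open>J\<close> is chosen so that
  \<open>(1 - 1 / (8 * K * L)) ^ J <= exp (- L) <= 1 / L\<close>; then
  \<open>84 = 80 + 4\<close>.\<close>

lemma emeasure_cover_stacked:
  assumes L: "L \<ge> 1" and k: "k \<le> n" and big: "real (En k) > 2 * L * real K ^ k"
    and J: "real J \<ge> 8 * real K * L\<^sup>2" and N: "N \<ge> J * n"
  shows "emeasure lborel (cover K D v N) \<le> ennreal (84 / L)"
proof -
  define x where "x = 1 / (8 * real K * L)"
  have KL: "8 * real K * L \<ge> 1" using K_ge L mult_mono[of 1 "8 * real K" 1 L] by simp
  have x: "0 \<le> x" "x \<le> 1"
    using KL unfolding x_def by (intro divide_nonneg_pos, simp, linarith, subst divide_le_eq_1_pos, linarith+)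
  have "(1 - x) ^ J \<le> exp (- x) ^ J" using x exp_ge_add_one_self[of "- x"] by (intro power_mono) auto
  also have "\<dots> = exp (- (real J * x))" by (simp add: exp_of_nat_mult[symmetric])
  also have "\<dots> \<le> exp (- L)"
  proof -
    have "8 * real K * L\<^sup>2 * x = L" using L K_ge by (simp add: x_def power2_eq_square)
    then have "L \<le> real J * x" using mult_right_mono[OF J x(1)] by simp
    then show ?thesis by simp
  qed
  also have "\<dots> \<le> 1 / L"
  proof -
    have "L \<le> exp L" using exp_ge_add_one_self[of L] by linarith
    then show ?thesis using L by (simp add: exp_minus field_simps)
  qed
  finally have xJ: "(1 - x) ^ J \<le> 1 / L" .
  have "emeasure lborel (cover K D v N) \<le> emeasure lborel (cover K D v (J * n))"
    by (rule emeasure_mono[OF cover_antimono[OF N]]) simp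
  also have "\<dots> \<le> ennreal (80 / L) + ennreal (4 * (1 - 1 / (8 * real K * L)) ^ J)"
    by (rule emeasure_cover[OF L k big])
  also have "\<dots> \<le> ennreal (80 / L) + ennreal (4 * (1 / L))"
    using xJ by (intro add_left_mono ennreal_leI mult_left_mono) (auto simp: x_def)
  also have "\<dots> = ennreal (84 / L)" using L by (subst ennreal_plus[symmetric]) auto
  finally show ?thesis .
qed

end

section \<open>Orbits near the zeros of a digit polynomial\<close>

definition dint :: "real \<Rightarrow> real" where
  "dint x = \<bar>x - of_int (round x)\<bar>"

lemma dint_le: "dint x \<le> \<bar>x - of_int j\<bar>"
  unfolding dint_def by (rule round_diff_minimal)

lemma dint_nonneg [simp]: "0 \<le> dint x"
  by (simp add: dint_def)

lemma dint_le_half: "dint x \<le> 1 / 2"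
  unfolding dint_def using of_int_round_abs_le[of x] by (simp add: abs_minus_commute)

lemma dint_le_1: "dint x \<le> 1"
  using dint_le_half[of x] by linarith

lemma dint_le_abs: "dint x \<le> \<bar>x\<bar>"
  using dint_le[of x 0] by simp

lemma dint_add: "dint (x + y) \<le> dint x + dint y"
  using dint_le[of "x + y" "round x + round y"] unfolding dint_def by simp

lemma dint_minus [simp]: "dint (- x) = dint x"
proof -
  have "dint (- x) \<le> dint x" for x
    using dint_le[of "- x" "- round x"] unfolding dint_def[of x] by simp
  from this[of x] this[of "- x"] show ?thesis by simp
qed

lemma dint_diff: "dint (x - y) \<le> dint x + dint y"
  using dint_add[of x "- y"] by simp

lemma dint_add_int [simp]: "dint (x + of_int j) = dint x"
proof -
  have le: "dint (x + of_int j) \<le> dint x" for x j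
    using dint_le[of "x + of_int j" "round x + j"] unfolding dint_def[of x] by simp
  from le[of x j] le[of "x + of_int j" "- j"] show ?thesis by simp
qed

lemma dint_mult_nat: "dint (real n * x) \<le> real n * dint x"
proof -
  have "dint (real n * x) \<le> \<bar>real n * x - of_int (int n * round x)\<bar>" by (rule dint_le)
  also have "\<dots> = real n * dint x" by (simp add: dint_def abs_mult flip: right_diff_distrib)
  finally show ?thesis .
qed

lemma dint_mult_power: "dint (real K ^ n * x) \<le> real K ^ n * dint x"
  using dint_mult_nat[of "K ^ n" x] by simp

lemma dint_eq_0_iff: "dint x = 0 \<longleftrightarrow> x \<in> \<int>"
proof
  assume "dint x = 0"
  then have "x = of_int (round x)" by (simp add: dint_def)
  then show "x \<in> \<int>" by (metis Ints_of_int)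
next
  assume "x \<in> \<int>"
  then obtain j where "x = of_int j" by (auto elim: Ints_cases)
  then show "dint x = 0" using dint_le[of x j] by (simp add: antisym)
qed

lemma dint_eq_abs: "\<bar>x\<bar> \<le> 1 / 2 \<Longrightarrow> dint x = \<bar>x\<bar>"
proof -
  assume x: "\<bar>x\<bar> \<le> 1 / 2"
  have "\<bar>x\<bar> \<le> \<bar>x - of_int (round x)\<bar>"
  proof (cases "round x = 0")
    case False
    then have "\<bar>real_of_int (round x)\<bar> \<ge> 1" by linarith
    then show ?thesis using x by linarith
  qed simp
  then show ?thesis using dint_le_abs[of x] by (simp add: dint_def)
qed

lemma dint_expand:
  assumes "dint x \<le> 1 / (2 * real K)" "K > 0"
  shows "dint (real K * x) = real K * dint x"
proof -
  define u where "u = x - of_int (round x)"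
  have u: "\<bar>u\<bar> = dint x" by (simp add: u_def dint_def)
  have "\<bar>real K * u\<bar> \<le> 1 / 2" using assms u by (simp add: abs_mult field_simps)
  then have "dint (real K * u) = real K * dint x" using u by (simp add: dint_eq_abs abs_mult)
  moreover have "real K * x = real K * u + of_int (int K * round x)"
    by (simp add: u_def algebra_simps)
  ultimately show ?thesis by (simp only: dint_add_int)
qed

text \<open>Up to \<open>pi / 3\<close> the function \<open>sin y - y / 2\<close> increases because
  \<open>cos y >= 1 / 2\<close>; beyond that, \<open>sin y >= 1 / 2\<close> is already
  enough.\<close>

lemma two_sin_ge:
  assumes "0 \<le> u" "u \<le> 1 / 2"
  shows "u \<le> 2 * sin (pi * u)"
proof (cases "pi * u \<le> pi / 3")
  case True
  have "(\<lambda>y. sin y - y / 2) 0 \<le> (\<lambda>y. sin y - y / 2) (pi * u)"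
  proof (rule DERIV_nonneg_imp_nondecreasing[where f = "\<lambda>y. sin y - y / 2"])
    show "0 \<le> pi * u" using assms by simp
    fix y assume y: "0 \<le> y" "y \<le> pi * u"
    have "y \<le> pi / 3" using y(2) True by (rule order_trans)
    then have "cos (pi / 3) \<le> cos y" using y(1) by (intro cos_monotone_0_pi_le) auto
    then have "0 \<le> cos y - 1 / 2" by (simp add: cos_60)
    moreover have "((\<lambda>y. sin y - y / 2) has_real_derivative (cos y - 1 / 2)) (at y)"
      by (auto intro!: derivative_eq_intros)
    ultimately show "\<exists>d. ((\<lambda>y. sin y - y / 2) has_real_derivative d) (at y) \<and> 0 \<le> d" by blast
  qed
  then have "pi * u \<le> 2 * sin (pi * u)" by simp
  moreover have "1 * u \<le> pi * u" using assms pi_gt3 by (intro mult_right_mono) auto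
  ultimately show ?thesis by simp
next
  case False
  have "sin (pi / 6) \<le> sin (pi * u)"
    using False assms by (intro sin_monotone_2pi_le) (auto simp: field_simps)
  then show ?thesis using assms by (simp add: sin_30)
qed

text \<open>The right side is a chord of the unit circle, of length
  \<open>2 * sin (pi * dint (x - y))\<close>.\<close>

lemma dint_le_norm_cis_diff: "dint (x - y) \<le> norm (cis (2 * pi * x) - cis (2 * pi * y))"
proof -
  define u where "u = x - y - of_int (round (x - y))"
  have u: "\<bar>u\<bar> = dint (x - y)" "\<bar>u\<bar> \<le> 1 / 2" using dint_le_half[of "x - y"] by (simp_all add: u_def dint_def)
  have "2 * pi * x = (2 * pi * y + 2 * pi * u) + 2 * pi * of_int (round (x - y))"
    by (simp add: u_def algebra_simps)
  then have "cis (2 * pi * x) = cis (2 * pi * y) * cis (2 * pi * u)"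
    by (simp only: cis_mult[symmetric]) (simp add: cis_multiple_2pi)
  then have "norm (cis (2 * pi * x) - cis (2 * pi * y)) = norm (cis (2 * pi * y) * (cis (2 * pi * u) - 1))"
    by (simp add: algebra_simps)
  also have "\<dots> = norm (cis (2 * pi * u) - 1)" by (simp add: norm_mult)
  also have "\<dots> = 2 * sin (pi * \<bar>u\<bar>)"
  proof -
    have s: "sin (pi * \<bar>u\<bar>) \<ge> 0" using two_sin_ge[of "\<bar>u\<bar>"] u(2) by auto
    have "(norm (cis (2 * pi * u) - 1))\<^sup>2 = (cos (2 * pi * u) - 1)\<^sup>2 + (sin (2 * pi * u))\<^sup>2"
      by (simp add: cmod_power2)
    also have "\<dots> = 2 - 2 * cos (2 * (pi * \<bar>u\<bar>))"
    proof -
      have "cos (2 * (pi * \<bar>u\<bar>)) = cos (2 * pi * u)" by (cases "u \<ge> 0") (auto simp: mult.assoc)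
      moreover have "(cos (2 * pi * u))\<^sup>2 + (sin (2 * pi * u))\<^sup>2 = 1" by simp
      ultimately show ?thesis by (simp add: power2_diff)
    qed
    also have "\<dots> = (2 * sin (pi * \<bar>u\<bar>))\<^sup>2" by (simp only: cos_double_sin) (simp add: power2_eq_square)
    finally show ?thesis using s by (metis norm_ge_zero mult_nonneg_nonneg power2_eq_iff_nonneg zero_le_numeral)
  qed
  finally show ?thesis using two_sin_ge[of "\<bar>u\<bar>"] u by simp
qed

text \<open>In the factorisation of \<open>p\<close>, roots off the unit circle keep a fixed
  distance from it and go into \<open>c\<close>, while roots on it give chords. The degree serves as
  a common exponent: overestimating a multiplicity is harmless because \<open>dint\<close> is at
  most 1.\<close>

lemma norm_poly_cis_ge:
  fixes p :: "complex poly"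
  assumes "p \<noteq> 0"
  shows "\<exists>c>0. \<exists>Z d. finite Z \<and> (\<forall>z\<in>Z. poly p (cis (2 * pi * z)) = 0 \<and> \<bar>z\<bar> \<le> 1) \<and>
     (\<forall>x. c * (\<Prod>z\<in>Z. dint (x - z)) ^ d \<le> norm (poly p (cis (2 * pi * x))))"
proof -
  define R where "R = {r. poly p r = 0}"
  define R1 where "R1 = {r \<in> R. norm r = 1}"
  define a where "a r = Arg r / (2 * pi)" for r
  define d where "d = degree p"
  have fR: "finite R" using assms by (simp add: R_def poly_roots_finite)
  have fR1: "finite R1" using fR by (simp add: R1_def)
  have cisa: "cis (2 * pi * a r) = r" if "r \<in> R1" for r
    using that cis_Arg[of r] by (force simp: a_def R1_def sgn_eq)
  have inja: "inj_on a R1" by (metis cisa inj_onI)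
  define b where "b r = (if r \<in> R1 then 1 else \<bar>1 - norm r\<bar> ^ order r p)" for r
  have b_pos: "b r > 0" if "r \<in> R" for r using that by (auto simp: b_def R1_def)
  define c where "c = norm (lead_coeff p) * (\<Prod>r\<in>R. b r)"
  have c_pos: "c > 0" unfolding c_def using assms b_pos by (intro mult_pos_pos prod_pos) auto
  have main: "c * (\<Prod>r\<in>R1. dint (x - a r)) ^ d \<le> norm (poly p (cis (2 * pi * x)))" for x
  proof -
    define w where "w = cis (2 * pi * x)"
    have "poly p w = poly (smult (lead_coeff p) (\<Prod>r\<in>R. [:-r, 1:] ^ order r p)) w"
      unfolding R_def by (simp only: complex_poly_decompose)
    also have "\<dots> = lead_coeff p * (\<Prod>r\<in>R. (w - r) ^ order r p)"
      by (simp add: poly_prod)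
    finally have pw: "norm (poly p w) = norm (lead_coeff p) * (\<Prod>r\<in>R. norm (w - r) ^ order r p)"
      by (simp add: norm_mult prod_norm[symmetric] norm_power)
    have "(\<Prod>r\<in>R. b r * (if r \<in> R1 then dint (x - a r) ^ d else 1)) \<le> (\<Prod>r\<in>R. norm (w - r) ^ order r p)"
    proof (rule prod_mono, rule conjI)
      fix r assume r: "r \<in> R"
      show "0 \<le> b r * (if r \<in> R1 then dint (x - a r) ^ d else 1)"
        using b_pos[OF r] by auto
      show "b r * (if r \<in> R1 then dint (x - a r) ^ d else 1) \<le> norm (w - r) ^ order r p"
      proof (cases "r \<in> R1")
        case True
        have "dint (x - a r) ^ d \<le> dint (x - a r) ^ order r p"
          using order_degree[OF assms, of r] dint_le_1 by (intro power_decreasing) (auto simp: d_def)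
        also have "\<dots> \<le> norm (w - r) ^ order r p"
          using dint_le_norm_cis_diff[of x "a r"] cisa[OF True] by (intro power_mono) (auto simp: w_def)
        finally show ?thesis using True by (simp add: b_def)
      next
        case False
        have "\<bar>1 - norm r\<bar> \<le> norm (w - r)"
          using norm_triangle_ineq3[of w r] by (simp add: w_def)
        then show ?thesis using False by (auto simp: b_def intro!: power_mono)
      qed
    qed
    also have "(\<Prod>r\<in>R. b r * (if r \<in> R1 then dint (x - a r) ^ d else 1))
       = (\<Prod>r\<in>R. b r) * (\<Prod>r\<in>R1. dint (x - a r)) ^ d"
    proof -
      have "(\<Prod>r\<in>R. if r \<in> R1 then dint (x - a r) ^ d else 1) = (\<Prod>r\<in>R1. dint (x - a r) ^ d)"
        using fR by (subst prod.inter_restrict[symmetric]) (auto simp: R1_def intro!: prod.cong)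
      then show ?thesis by (simp add: prod.distrib prod_power_distrib)
    qed
    finally have "c * (\<Prod>r\<in>R1. dint (x - a r)) ^ d \<le> norm (poly p w)"
      unfolding pw c_def mult.assoc by (intro mult_left_mono) auto
    then show ?thesis by (simp add: w_def)
  qed
  show ?thesis
  proof (intro exI[of _ c] conjI c_pos exI[of _ "a ` R1"] exI[of _ d] ballI allI)
    show "finite (a ` R1)" using fR1 by simp
    fix z assume "z \<in> a ` R1"
    then obtain r where r: "r \<in> R1" "z = a r" by auto
    then show "poly p (cis (2 * pi * z)) = 0" using cisa[of r] by (auto simp: R1_def R_def)
    have "\<bar>Arg r\<bar> \<le> pi" using Arg_bounded[of r] by auto
    then show "\<bar>z\<bar> \<le> 1" using r by (simp add: a_def divide_le_eq)
  next
    fix x show "c * (\<Prod>z\<in>a ` R1. dint (x - z)) ^ d \<le> norm (poly p (cis (2 * pi * x)))"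
      using main[of x] by (simp add: prod.reindex[OF inja])
  qed
qed

text \<open>After a visit to distance \<open>\<tau>\<close> from \<open>z\<close> the orbit of \<open>x\<close> shadows that of \<open>z\<close>, which never returns
  to \<open>z\<close>, for about \<open>log\<^sub>K (1/\<tau>)\<close> steps. So the small factor \<open>\<tau>\<close> is paid for by these steps.\<close>

lemma prod_dint_orbit_ge:
  fixes \<kappa> \<eta> z x :: real
  assumes K: "K \<ge> 1" and \<kappa>: "0 < \<kappa>" "\<kappa> \<le> 1" and \<eta>: "0 < \<eta>" "\<eta> \<le> 1"
    and sep: "\<And>r. r \<ge> 1 \<Longrightarrow> dint (real K ^ r * z - z) \<ge> 2 * \<kappa>"
    and away: "\<And>k. k < m \<Longrightarrow> dint (real K ^ k * x - z) \<ge> \<eta>"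
  shows "(\<Prod>k<m. dint (real K ^ k * x - z)) \<ge> (\<kappa> / real K) ^ m * \<eta>"
  using away
proof (induction m arbitrary: x rule: less_induct)
  case (less m)
  have K1: "real K \<ge> 1" using K by simp
  have \<kappa>K: "0 < \<kappa> / real K" "\<kappa> / real K \<le> \<kappa>" "\<kappa> / real K \<le> 1"
    using \<kappa> K1 by (auto simp: divide_le_eq mult_le_cancel_left1 intro: order_trans[of \<kappa> 1])
  show ?case
  proof (cases "m = 0")
    case True then show ?thesis using \<eta> by simp
  next
    case False
    define \<tau> where "\<tau> = dint (x - z)"
    have \<tau>\<eta>: "\<tau> \<ge> \<eta>" using less.prems[of 0] False by (simp add: \<tau>_def)
    \<comment> \<open>While \<open>K ^ r * \<tau> <= \<kappa>\<close> the orbit of \<open>x\<close>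
      is within \<open>\<kappa>\<close> of the orbit of \<open>z\<close>, which is
      \<open>2 * \<kappa>\<close> away from \<open>z\<close>.\<close>
    have near: "dint (real K ^ r * x - z) \<ge> \<kappa>" if "r \<ge> 1" "real K ^ r * \<tau> \<le> \<kappa>" for r
    proof -
      have "2 * \<kappa> \<le> dint (real K ^ r * z - z)" by (rule sep[OF that(1)])
      also have "real K ^ r * z - z = (real K ^ r * x - z) - real K ^ r * (x - z)" by (simp add: algebra_simps)
      also have "dint \<dots> \<le> dint (real K ^ r * x - z) + dint (real K ^ r * (x - z))" by (rule dint_diff)
      also have "dint (real K ^ r * (x - z)) \<le> real K ^ r * \<tau>" unfolding \<tau>_def by (rule dint_mult_power)
      finally show ?thesis using that(2) by linarith
    qed
    have block: "(\<Prod>k<g. dint (real K ^ k * x - z)) \<ge> \<tau> * \<kappa> ^ (g - 1)"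
      if g: "g \<ge> 1" "\<And>r. 1 \<le> r \<Longrightarrow> r < g \<Longrightarrow> real K ^ r * \<tau> \<le> \<kappa>" for g
    proof -
      obtain g' where g': "g = Suc g'" using g(1) by (cases g) auto
      have "(\<Prod>k<g'. \<kappa>) \<le> (\<Prod>k<g'. dint (real K ^ Suc k * x - z))"
      proof (rule prod_mono, rule conjI)
        fix i assume "i \<in> {..<g'}"
        then show "\<kappa> \<le> dint (real K ^ Suc i * x - z)"
          using g(2)[of "Suc i"] g' by (intro near) auto
      qed (use \<kappa> in auto)
      then have "\<tau> * \<kappa> ^ g' \<le> \<tau> * (\<Prod>k<g'. dint (real K ^ Suc k * x - z))"
        using \<tau>\<eta> \<eta> by (intro mult_left_mono) auto
      then show ?thesis unfolding g' prod.lessThan_Suc_shift by (simp add: \<tau>_def)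
    qed
    show ?thesis
    proof (cases "\<exists>h. 1 \<le> h \<and> h \<le> m \<and> real K ^ h * \<tau> > \<kappa>")
      case True
      \<comment> \<open>Shadowing ends at time \<open>h\<close>. The factors before it are at least
        \<open>\<tau> * \<kappa> ^ (h - 1)\<close>, and \<open>K ^ h * \<tau> > \<kappa>\<close>
        bounds this below by \<open>(\<kappa> / K) ^ h\<close>. The induction restarts at
        \<open>K ^ h * x\<close>.\<close>
      define h where "h = (LEAST h. 1 \<le> h \<and> h \<le> m \<and> real K ^ h * \<tau> > \<kappa>)"
      have h: "1 \<le> h" "h \<le> m" "real K ^ h * \<tau> > \<kappa>"
        using LeastI_ex[OF True] unfolding h_def by auto
      have hmin: "real K ^ r * \<tau> \<le> \<kappa>" if "1 \<le> r" "r < h" for r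
        using not_less_Least[of r "\<lambda>h. 1 \<le> h \<and> h \<le> m \<and> real K ^ h * \<tau> > \<kappa>"] that h(2)
        unfolding h_def[symmetric] by auto
      have "(\<kappa> / real K) ^ h \<le> \<tau> * \<kappa> ^ (h - 1)"
      proof -
        have "(\<kappa> / real K) ^ h = \<kappa> ^ (h - 1) * \<kappa> / real K ^ h"
          using h(1) by (cases h) (auto simp: power_divide)
        also have "\<dots> \<le> \<kappa> ^ (h - 1) * (real K ^ h * \<tau>) / real K ^ h"
          using h(3) \<kappa> by (intro divide_right_mono mult_left_mono) auto
        also have "\<dots> = \<tau> * \<kappa> ^ (h - 1)" using K1 by simp
        finally show ?thesis .
      qed
      also have "\<dots> \<le> (\<Prod>k<h. dint (real K ^ k * x - z))" by (rule block[OF h(1) hmin])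
      finally have 1: "(\<kappa> / real K) ^ h \<le> (\<Prod>k<h. dint (real K ^ k * x - z))" .
      have 2: "(\<kappa> / real K) ^ (m - h) * \<eta> \<le> (\<Prod>k<m - h. dint (real K ^ k * (real K ^ h * x) - z))"
      proof (rule less.IH)
        show "m - h < m" using h False by simp
        fix k assume "k < m - h"
        then show "\<eta> \<le> dint (real K ^ k * (real K ^ h * x) - z)"
          using less.prems[of "k + h"] by (simp add: power_add mult.assoc)
      qed
      have "(\<kappa> / real K) ^ m * \<eta> = (\<kappa> / real K) ^ h * ((\<kappa> / real K) ^ (m - h) * \<eta>)"
        using h(2) by (simp flip: power_add add: mult.assoc[symmetric])
      also have "\<dots> \<le> (\<Prod>k<h. dint (real K ^ k * x - z)) * (\<Prod>k<m - h. dint (real K ^ k * (real K ^ h * x) - z))"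
        using 1 2 \<kappa>K \<eta> by (intro mult_mono prod_nonneg) auto
      also have "(\<Prod>k<m - h. dint (real K ^ k * (real K ^ h * x) - z)) = (\<Prod>k\<in>{h..<m}. dint (real K ^ k * x - z))"
      proof -
        have "(\<Prod>k\<in>{0 + h..<(m - h) + h}. dint (real K ^ k * x - z)) = (\<Prod>k\<in>{0..<m - h}. dint (real K ^ (k + h) * x - z))"
          by (rule prod.shift_bounds_nat_ivl)
        then show ?thesis using h(2) by (simp add: power_add mult.assoc atLeast0LessThan)
      qed
      also have "(\<Prod>k<h. dint (real K ^ k * x - z)) * (\<Prod>k\<in>{h..<m}. dint (real K ^ k * x - z)) = (\<Prod>k<m. dint (real K ^ k * x - z))"
        using prod.atLeastLessThan_concat[of 0 h m "\<lambda>k. dint (real K ^ k * x - z)"] h(2)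
        by (simp add: atLeast0LessThan)
      finally show ?thesis .
    next
      \<comment> \<open>Shadowing outlasts the product. Only in this last block is
        \<open>\<tau>\<close> bounded by \<open>\<eta>\<close>, so \<open>\<eta>\<close> enters the
        bound once, for every \<open>m\<close>.\<close>
      case none: False
      have "(\<kappa> / real K) ^ m * \<eta> \<le> \<kappa> ^ (m - 1) * \<tau>"
      proof (rule mult_mono)
        have "(\<kappa> / real K) ^ m \<le> \<kappa> ^ m" using \<kappa>K by (intro power_mono) auto
        also have "\<dots> \<le> \<kappa> ^ (m - 1)" using \<kappa> by (intro power_decreasing) auto
        finally show "(\<kappa> / real K) ^ m \<le> \<kappa> ^ (m - 1)" .
      qed (use \<tau>\<eta> \<eta> \<kappa> in auto)
      also have "\<dots> \<le> (\<Prod>k<m. dint (real K ^ k * x - z))"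
        using block[of m] none False by (auto simp: not_less mult.commute)
      finally show ?thesis .
    qed
  qed
qed

text \<open>Multiplying \<open>K ^ r * z - z\<close> by \<open>K ^ i\<close> gives an integer, so
  its distance to the integers is 0 or at least \<open>1 / K ^ i\<close>. In the first case
  multiplication by \<open>K ^ r\<close> fixes \<open>z\<close> modulo 1, hence \<open>z\<close>
  agrees modulo 1 with \<open>K ^ (r * i) * z\<close>, an integer.\<close>

lemma power_of_base_separated:
  assumes z: "z \<notin> \<int>" and i: "real K ^ i * z \<in> \<int>" and K: "K \<ge> 1"
  shows "\<exists>\<kappa>>0. \<kappa> \<le> 1 \<and> (\<forall>r\<ge>1. dint (real K ^ r * z - z) \<ge> 2 * \<kappa>)"
proof -
  have ge: "1 / real K ^ i \<le> dint (real K ^ r * z - z)" if "r \<ge> 1" for r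
  proof -
    define y where "y = real K ^ r * z - z"
    have "real K ^ i * y = real K ^ r * (real K ^ i * z) - real K ^ i * z"
      by (simp add: y_def algebra_simps)
    also have "\<dots> \<in> \<int>" by (intro Ints_diff Ints_mult[OF _ i] i) auto
    finally have iy: "real K ^ i * y \<in> \<int>" .
    have "y \<notin> \<int>"
    proof
      assume y: "y \<in> \<int>"
      have "real K ^ (r * n) * z - z \<in> \<int>" for n
      proof (induction n)
        case (Suc n)
        have "real K ^ (r * Suc n) * z - z = real K ^ r * (real K ^ (r * n) * z - z) + y"
          by (simp add: y_def power_add algebra_simps)
        then show ?case using Suc y by (simp only:) (intro Ints_add Ints_mult, auto)
      qed auto
      then have "real K ^ (r * i) * z - z \<in> \<int>" .
      moreover have "real K ^ (r * i) * z = real K ^ (r * i - i) * (real K ^ i * z)"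
        using that by (simp flip: power_add mult.assoc)
      moreover have "real K ^ (r * i - i) * (real K ^ i * z) \<in> \<int>" by (intro Ints_mult[OF _ i]) auto
      ultimately show False using z by (metis Ints_diff diff_diff_eq2 add_diff_cancel_left')
    qed
    then have "y - of_int (round y) \<noteq> 0" by (metis Ints_of_int eq_iff_diff_eq_0)
    moreover have "real K ^ i * (y - of_int (round y)) \<in> \<int>"
      using iy by (simp add: right_diff_distrib)
    ultimately have "\<bar>real K ^ i * (y - of_int (round y))\<bar> \<ge> 1"
      using K by (intro Ints_nonzero_abs_ge1) auto
    then have "real K ^ i * dint y \<ge> 1" by (simp add: abs_mult dint_def)
    then show ?thesis using K by (simp add: y_def divide_le_eq mult.commute)
  qed
  have "1 \<le> real K ^ i" using K by (intro one_le_power) auto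
  then have "1 \<le> 2 * real K ^ i" by linarith
  then show ?thesis using ge K by (intro exI[of _ "1 / (2 * real K ^ i)"]) (auto simp: divide_le_eq)
qed

text \<open>A distance below \<open>1 / (2 * K)\<close> is multiplied by exactly \<open>K\<close> in
  the next step, which cannot continue forever from a positive value.\<close>

lemma expanding_orbit_infinite:
  assumes K: "K \<ge> 2" and z: "\<And>i. real K ^ i * z \<notin> \<int>"
  shows "infinite {q. dint (real K ^ q * z) \<ge> 1 / (2 * real K)}"
proof
  assume "finite {q. dint (real K ^ q * z) \<ge> 1 / (2 * real K)}"
  then obtain q0 where q0: "dint (real K ^ q * z) < 1 / (2 * real K)" if "q \<ge> q0" for q
    by (metis (mono_tags, lifting) finite_nat_set_iff_bounded linorder_not_less mem_Collect_eq)
  have "dint (real K ^ (q0 + s) * z) = real K ^ s * dint (real K ^ q0 * z)" for s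
  proof (induction s)
    case (Suc s)
    have "dint (real K * (real K ^ (q0 + s) * z)) = real K * dint (real K ^ (q0 + s) * z)"
      using q0[of "q0 + s"] K by (intro dint_expand) auto
    then show ?case using Suc by (simp add: mult.assoc)
  qed simp
  moreover have pos: "dint (real K ^ q0 * z) > 0"
    using z[of q0] dint_eq_0_iff[of "real K ^ q0 * z"] dint_nonneg[of "real K ^ q0 * z"] by linarith
  moreover obtain s where "1 / dint (real K ^ q0 * z) < real K ^ s"
    using real_arch_pow[of "real K"] K by auto
  ultimately have "1 < dint (real K ^ (q0 + s) * z)" by (simp add: divide_less_eq)
  then show False using dint_le_1[of "real K ^ (q0 + s) * z"] by linarith
qed

text \<open>The \<open>card U * card Q\<close> sums of an uncovered \<open>k\<close> and some
  \<open>q\<close> fall into \<open>2 * h\<close> positions, so one position covers at least the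
  fraction \<open>card Q / (2 * h)\<close> of what is left.\<close>

lemma greedy_cover:
  fixes U Q :: "nat set"
  assumes h: "h > 0" and Q: "Q \<subseteq> {..<h}"
  shows "\<exists>P \<subseteq> {..<2 * h}. card P \<le> s \<and>
    real (card {k \<in> {..<h}. \<forall>q\<in>Q. k + q \<notin> P}) \<le> real h * (1 - real (card Q) / (2 * real h)) ^ s"
proof (induction s)
  case 0
  have "card {k \<in> {..<h}. \<forall>q\<in>Q. k + q \<notin> {}} \<le> card {..<h}" by (intro card_mono) auto
  then show ?case by (intro exI[of _ "{}"]) auto
next
  case (Suc s)
  then obtain P where P: "P \<subseteq> {..<2 * h}" "card P \<le> s"
    "real (card {k \<in> {..<h}. \<forall>q\<in>Q. k + q \<notin> P}) \<le> real h * (1 - real (card Q) / (2 * real h)) ^ s"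
    by auto
  define U where "U = {k \<in> {..<h}. \<forall>q\<in>Q. k + q \<notin> P}"
  have fU: "finite U" by (simp add: U_def)
  have fQ: "finite Q" using Q finite_subset by blast
  define V where "V p = {k \<in> U. \<exists>q\<in>Q. k + q = p}" for p
  have "card U * card Q = card (U \<times> Q)" by (simp add: card_cartesian_product)
  also have "\<dots> = card ((\<lambda>(k, q). (k + q, k)) ` (U \<times> Q))"
    by (subst card_image) (auto simp: inj_on_def)
  also have "\<dots> \<le> card (Sigma {..<2 * h} V)"
    using fU Q by (intro card_mono) (fastforce simp: V_def U_def)+
  also have "\<dots> = (\<Sum>p<2 * h. card (V p))"
    using fU by (subst card_SigmaI) (auto simp: V_def)
  finally have tot: "real (card U) * real (card Q) \<le> (\<Sum>p<2 * h. real (card (V p)))"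
    by (simp flip: of_nat_mult of_nat_sum)
  have "\<exists>p<2 * h. real (card U) * real (card Q) / (2 * real h) \<le> real (card (V p))"
  proof (rule ccontr)
    assume "\<not> ?thesis"
    then have "(\<Sum>p<2 * h. real (card (V p))) < (\<Sum>p<2 * h. real (card U) * real (card Q) / (2 * real h))"
      using h by (intro sum_strict_mono) (auto simp: not_le lessThan_empty_iff)
    also have "\<dots> = real (card U) * real (card Q)" using h by simp
    finally show False using tot by simp
  qed
  then obtain p where p: "p < 2 * h" "real (card U) * real (card Q) / (2 * real h) \<le> real (card (V p))" by auto
  have "{k \<in> {..<h}. \<forall>q\<in>Q. k + q \<notin> insert p P} = U - V p" by (auto simp: U_def V_def)
  then have "real (card {k \<in> {..<h}. \<forall>q\<in>Q. k + q \<notin> insert p P}) = real (card U) - real (card (V p))"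
    using fU by (simp add: card_Diff_subset V_def card_mono of_nat_diff)
  also have "\<dots> \<le> real (card U) * (1 - real (card Q) / (2 * real h))"
    using p(2) by (simp add: algebra_simps)
  also have "\<dots> \<le> (real h * (1 - real (card Q) / (2 * real h)) ^ s) * (1 - real (card Q) / (2 * real h))"
  proof (rule mult_right_mono)
    show "real (card U) \<le> real h * (1 - real (card Q) / (2 * real h)) ^ s" using P(3) by (simp add: U_def)
    have "card Q \<le> card {..<h}" using Q by (intro card_mono) auto
    then show "0 \<le> 1 - real (card Q) / (2 * real h)" using h by (simp add: divide_le_eq)
  qed
  finally have "real (card {k \<in> {..<h}. \<forall>q\<in>Q. k + q \<notin> insert p P})
     \<le> real h * (1 - real (card Q) / (2 * real h)) ^ Suc s" by (simp add: mult_ac)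
  moreover have "card (insert p P) \<le> Suc s"
    using P(1,2) card_insert_le_m1[of "Suc s" P p] by simp
  ultimately show ?case using P(1) p(1) by (intro exI[of _ "insert p P"]) auto
qed

text \<open>Half of the budget \<open>\<delta> * h\<close> goes to \<open>s\<close> greedy choices,
  where \<open>s >= \<delta> * h / 4\<close>. With
  \<open>r >= 8 * ln (2 / \<delta>) / \<delta>\<close> shifts these leave at most
  \<open>\<delta> * h / 2\<close> positions uncovered, and the other half of the budget gives each
  of them its own point \<open>k + q1\<close>.\<close>

lemma sparse_block_cover:
  fixes Q :: "nat set"
  assumes inf: "infinite Q" and \<delta>: "\<delta> > 0"
  shows "\<exists>h>0. \<exists>P. finite P \<and> real (card P) \<le> \<delta> * real h \<and> (\<forall>k<h. \<exists>q\<in>Q. q < h \<and> k + q \<in> P)"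
proof -
  obtain r :: nat where r: "8 * ln (2 / \<delta>) / \<delta> \<le> real r" using real_arch_simple by blast
  obtain F where F: "finite F" "F \<subseteq> Q" "card F = r"
    using infinite_arbitrarily_large[OF inf] by blast
  obtain h0 where h0: "F \<subseteq> {..<h0}" using F(1) by (metis finite_nat_iff_bounded)
  obtain h1 :: nat where h1: "4 / \<delta> \<le> real h1" using real_arch_simple by blast
  define h where "h = h0 + h1 + 1"
  have h_pos: "h > 0" by (simp add: h_def)
  have h4: "4 \<le> \<delta> * real h"
  proof -
    have "4 / \<delta> \<le> real h" using h1 by (simp add: h_def)
    then show ?thesis using \<delta> by (simp add: divide_le_eq mult.commute)
  qed
  have Fh: "F \<subseteq> {..<h}" using h0 by (auto simp: h_def)
  define s where "s = nat \<lfloor>\<delta> * real h / 2\<rfloor>"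
  have s1: "real s \<le> \<delta> * real h / 2" using h4 unfolding s_def by linarith
  have s2: "\<delta> * real h / 4 \<le> real s" using h4 unfolding s_def by linarith
  obtain P where P: "P \<subseteq> {..<2 * h}" "card P \<le> s"
    "real (card {k \<in> {..<h}. \<forall>q\<in>F. k + q \<notin> P}) \<le> real h * (1 - real (card F) / (2 * real h)) ^ s"
    using greedy_cover[OF h_pos Fh, of s] by auto
  define U where "U = {k \<in> {..<h}. \<forall>q\<in>F. k + q \<notin> P}"
  have ch: "card F \<le> h" using card_mono[OF _ Fh] by simp
  have "(1 - real (card F) / (2 * real h)) ^ s \<le> exp (- (real (card F) / (2 * real h))) ^ s"
    using ch h_pos by (intro power_mono) (auto simp: divide_le_eq intro: order_trans[OF _ exp_ge_add_one_self])
  also have "\<dots> = exp (- (real s * (real r / (2 * real h))))"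
    by (simp add: F(3) exp_of_nat_mult[symmetric])
  also have "\<dots> \<le> exp (- (\<delta> * real h / 4 * (real r / (2 * real h))))"
    unfolding exp_le_cancel_iff neg_le_iff_le by (intro mult_right_mono s2) auto
  also have "\<delta> * real h / 4 * (real r / (2 * real h)) = \<delta> * real r / 8" using h_pos by simp
  also have "exp (- (\<delta> * real r / 8)) \<le> exp (- ln (2 / \<delta>))"
    using r \<delta> by (simp add: divide_le_eq mult.commute)
  also have "\<dots> = \<delta> / 2" using \<delta> by (simp add: exp_minus)
  finally have "real h * (1 - real (card F) / (2 * real h)) ^ s \<le> real h * (\<delta> / 2)"
    by (intro mult_left_mono) auto
  then have cU: "real (card U) \<le> real h * (\<delta> / 2)" using P(3) by (simp add: U_def)
  have "F \<noteq> {} \<or> \<delta> \<ge> 1"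
  proof (cases "\<delta> \<ge> 1")
    case False
    then have "0 < 8 * ln (2 / \<delta>) / \<delta>" using \<delta> by (intro divide_pos_pos mult_pos_pos ln_gt_zero) auto
    then have "r > 0" using r by linarith
    then show ?thesis using F(3) by auto
  qed simp
  obtain q0 where q0: "q0 \<in> Q" using inf by (metis finite.emptyI ex_in_conv)
  define q1 where "q1 = (if F = {} then q0 else (SOME q. q \<in> F))"
  have q1: "q1 \<in> Q" unfolding q1_def using F(2) q0 some_in_eq by auto
  show ?thesis
  proof (cases "F = {}")
    case False
    then have q1F: "q1 \<in> F" by (simp add: q1_def some_in_eq)
    define P' where "P' = P \<union> (\<lambda>k. k + q1) ` U"
    have fin: "finite P" "finite U" using P(1) finite_subset by (auto simp: U_def)
    have "card P' \<le> card P + card U"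
      unfolding P'_def using card_Un_le[of P "(\<lambda>k. k + q1) ` U"] card_image_le[OF fin(2), of "\<lambda>k. k + q1"] by linarith
    then have "real (card P') \<le> real s + real h * (\<delta> / 2)" using P(2) cU by linarith
    also have "\<dots> \<le> \<delta> * real h" using s1 by (simp add: algebra_simps)
    finally have "real (card P') \<le> \<delta> * real h" .
    moreover have "\<exists>q\<in>Q. q < h \<and> k + q \<in> P'" if kh: "k < h" for k
    proof (cases "k \<in> U")
      case True then show ?thesis using q1 q1F Fh by (auto simp: P'_def intro!: bexI[of _ q1])
    next
      case False
      then obtain q where "q \<in> F" "k + q \<in> P" using kh False by (auto simp: U_def)
      then show ?thesis using F(2) Fh by (auto simp: P'_def intro!: bexI[of _ q])
    qed
    moreover have "finite P'" using fin by (simp add: P'_def)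
    ultimately show ?thesis using h_pos by blast
  next
    \<comment> \<open>No shift was selected, which happens only for \<open>\<delta> >= 1\<close>;
      then one point for every \<open>k\<close> is within the budget.\<close>
    case True
    then have d1: "\<delta> \<ge> 1" using \<open>F \<noteq> {} \<or> \<delta> \<ge> 1\<close> by simp
    have "real (card ((\<lambda>k. k + q0) ` {..<q0 + 1})) \<le> \<delta> * real (q0 + 1)"
      using d1 mult_right_mono[OF d1, of "real (q0 + 1)"] by (simp add: card_image)
    then show ?thesis using q0
      by (intro exI[of _ "q0 + 1"] conjI exI[of _ "(\<lambda>k. k + q0) ` {..<q0 + 1}"]) auto
  qed
qed

text \<open>The pattern of one block is repeated with period \<open>h\<close>. That
  \<open>q < h\<close> holds with \<open>h\<close> independent of \<open>m\<close> bounds the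
  expansion \<open>K ^ q\<close> in \<open>avoid_orbit_point\<close>.\<close>

lemma sparse_cover:
  fixes Q :: "nat set"
  assumes inf: "infinite Q" and \<delta>: "\<delta> > 0"
  shows "\<exists>h C. C \<ge> 0 \<and> (\<forall>m. \<exists>P. finite P \<and> real (card P) \<le> \<delta> * real m + C \<and> (\<forall>k<m. \<exists>q\<in>Q. q < h \<and> k + q \<in> P))"
proof -
  obtain h P0 where h: "h > 0" "finite P0" "real (card P0) \<le> \<delta> * real h"
    "\<forall>k<h. \<exists>q\<in>Q. q < h \<and> k + q \<in> P0"
    using sparse_block_cover[OF assms] by blast
  show ?thesis
  proof (intro exI[of _ h] exI[of _ "\<delta> * real h"] conjI allI)
    fix m
    define P where "P = (\<lambda>(j, p). j * h + p) ` ({..m div h} \<times> P0)"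
    have "card P \<le> card ({..m div h} \<times> P0)" unfolding P_def by (rule card_image_le) (use h in auto)
    also have "\<dots> = (m div h + 1) * card P0" by (simp add: card_cartesian_product)
    finally have "real (card P) \<le> real ((m div h + 1) * card P0)" by (simp only: of_nat_le_iff)
    also have "\<dots> = real (m div h + 1) * real (card P0)" by (simp only: of_nat_mult)
    finally have "real (card P) \<le> real (m div h + 1) * real (card P0)" .
    also have "\<dots> \<le> real (m div h + 1) * (\<delta> * real h)" using h by (intro mult_left_mono) auto
    also have "\<dots> = \<delta> * real (m div h * h) + \<delta> * real h" by (simp add: algebra_simps)
    also have "\<dots> \<le> \<delta> * real m + \<delta> * real h"
      using \<delta> by (intro add_mono mult_left_mono) (auto simp only: of_nat_le_iff div_times_less_eq_dividend)
    finally have "real (card P) \<le> \<delta> * real m + \<delta> * real h" .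
    moreover have "\<exists>q\<in>Q. q < h \<and> k + q \<in> P" if "k < m" for k
    proof -
      obtain q where q: "q \<in> Q" "q < h" "k mod h + q \<in> P0" using h by (meson mod_less_divisor)
      have "k + q = k div h * h + (k mod h + q)" by (simp add: add.assoc[symmetric])
      moreover have "k div h \<le> m div h" using that by (intro div_le_mono) auto
      ultimately have "k + q \<in> P" unfolding P_def using q by (auto intro!: rev_image_eqI[of "(k div h, k mod h + q)"])
      then show ?thesis using q by blast
    qed
    moreover have "finite P" using h by (simp add: P_def)
    ultimately show "\<exists>P. finite P \<and> real (card P) \<le> \<delta> * real m + \<delta> * real h \<and> (\<forall>k<m. \<exists>q\<in>Q. q < h \<and> k + q \<in> P)" by blast
  qed (use \<delta> in auto)
qed

text \<open>If \<open>K ^ k * y\<close> were very close to \<open>z\<close>, then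
  \<open>K ^ (k + q) * y\<close> would be close to \<open>K ^ q * z\<close>, which for suitable
  \<open>q\<close> is at least \<open>1 / (2 * K)\<close> from the integers. A constraint at the
  single position \<open>k + q\<close> rules this out, and infinitely many admissible
  \<open>q\<close> let many \<open>k\<close> share one position.\<close>

lemma avoid_orbit_point:
  assumes K: "K \<ge> 2" and z: "\<And>i. real K ^ i * z \<notin> \<int>" and \<delta>: "\<delta> > 0"
  shows "\<exists>c>0. \<exists>C\<ge>0. \<forall>m. \<exists>P. finite P \<and> real (card P) \<le> \<delta> * real m + C \<and>
    (\<forall>y. (\<forall>p\<in>P. dint (real K ^ p * y) \<le> 1 / (16 * real K)) \<longrightarrow> (\<forall>k<m. dint (real K ^ k * y - z) \<ge> c))"
proof -
  obtain h C where hC: "C \<ge> 0" "\<forall>m. \<exists>P. finite P \<and> real (card P) \<le> \<delta> * real m + C \<and>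
     (\<forall>k<m. \<exists>q\<in>{q. dint (real K ^ q * z) \<ge> 1 / (2 * real K)}. q < h \<and> k + q \<in> P)"
    using sparse_cover[OF expanding_orbit_infinite[OF K z] \<delta>] by blast
  \<comment> \<open>The gap \<open>1 / (2 * K) - 1 / (16 * K)\<close> is at least
    \<open>1 / (4 * K)\<close>; dividing by the largest expansion carries it back to time
    \<open>k\<close>.\<close>
  define c where "c = 1 / (4 * real K) / real K ^ h"
  have c_pos: "c > 0" using K by (simp add: c_def)
  have key: "dint (real K ^ k * y - z) \<ge> c"
    if q: "dint (real K ^ q * z) \<ge> 1 / (2 * real K)" "q < h"
      and p: "dint (real K ^ (k + q) * y) \<le> 1 / (16 * real K)" for k q y
  proof -
    have "real K ^ q * z = real K ^ (k + q) * y - real K ^ q * (real K ^ k * y - z)"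
      by (simp add: power_add algebra_simps)
    then have "1 / (2 * real K) \<le> dint (real K ^ (k + q) * y) + dint (real K ^ q * (real K ^ k * y - z))"
      using q(1) dint_diff[of "real K ^ (k + q) * y" "real K ^ q * (real K ^ k * y - z)"] by simp
    also have "\<dots> \<le> 1 / (16 * real K) + real K ^ q * dint (real K ^ k * y - z)"
      by (intro add_mono p dint_mult_power)
    also have "\<dots> \<le> 1 / (16 * real K) + real K ^ h * dint (real K ^ k * y - z)"
      using q(2) K by (intro add_left_mono mult_right_mono power_increasing) auto
    finally have "1 / (2 * real K) - 1 / (16 * real K) \<le> real K ^ h * dint (real K ^ k * y - z)" by linarith
    moreover have "1 / (4 * real K) \<le> 1 / (2 * real K) - 1 / (16 * real K)" using K by (simp add: field_simps)
    ultimately have "1 / (4 * real K) \<le> real K ^ h * dint (real K ^ k * y - z)" by linarith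
    then have "1 / (4 * real K) / real K ^ h \<le> dint (real K ^ k * y - z)"
      using K by (subst pos_divide_le_eq) (auto simp: mult.commute)
    then show ?thesis by (simp only: c_def)
  qed
  have "\<exists>P. finite P \<and> real (card P) \<le> \<delta> * real m + C \<and>
    (\<forall>y. (\<forall>p\<in>P. dint (real K ^ p * y) \<le> 1 / (16 * real K)) \<longrightarrow> (\<forall>k<m. dint (real K ^ k * y - z) \<ge> c))" for m
  proof -
    obtain P where P: "finite P" "real (card P) \<le> \<delta> * real m + C"
     "\<forall>k<m. \<exists>q\<in>{q. dint (real K ^ q * z) \<ge> 1 / (2 * real K)}. q < h \<and> k + q \<in> P" using hC by blast
    show ?thesis
    proof (intro exI[of _ P] conjI P(1,2) allI impI)
      fix y k assume "\<forall>p\<in>P. dint (real K ^ p * y) \<le> 1 / (16 * real K)" "k < m"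
      then show "c \<le> dint (real K ^ k * y - z)" using P(3) key by blast
    qed
  qed
  then show ?thesis using c_pos hC(1) by blast
qed

section \<open>Products of digit polynomials along an orbit\<close>

definition charsum :: "nat set \<Rightarrow> real \<Rightarrow> complex" where
  "charsum A x = (\<Sum>a\<in>A. cis (2 * pi * (real a * x)))"

text \<open>At integers the sum equals \<open>card A\<close>, so no zero is an integer;
  \<open>power_of_base_separated\<close> relies on this.\<close>

lemma norm_charsum_ge:
  assumes A: "finite A" "A \<noteq> {}"
  shows "\<exists>c>0. \<exists>Z d. finite Z \<and> Z \<inter> \<int> = {} \<and> (\<forall>z\<in>Z. \<bar>z\<bar> \<le> 1) \<and>
     (\<forall>x. c * (\<Prod>z\<in>Z. dint (x - z)) ^ d \<le> norm (charsum A x))"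
proof -
  define p :: "complex poly" where "p = (\<Sum>a\<in>A. monom 1 a)"
  have pc: "poly p (cis (2 * pi * x)) = charsum A x" for x
  proof -
    have "poly p (cis (2 * pi * x)) = (\<Sum>a\<in>A. cis (2 * pi * x) ^ a)"
      by (simp add: p_def poly_sum poly_monom)
    also have "\<dots> = charsum A x"
      unfolding charsum_def by (intro sum.cong refl) (simp add: Complex.DeMoivre mult_ac)
    finally show ?thesis .
  qed
  have c0: "charsum A (of_int j) = of_nat (card A)" for j
  proof -
    have "cis (2 * pi * (real a * of_int j)) = 1" for a
      using cis_multiple_2pi[of "real_of_int (int a * j)"] by simp
    then show ?thesis by (simp add: charsum_def)
  qed
  then have "p \<noteq> 0" using pc[of 0] c0[of 0] A by auto
  then obtain c Z d where cZ: "c > 0" "finite Z"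
    "\<forall>z\<in>Z. poly p (cis (2 * pi * z)) = 0 \<and> \<bar>z\<bar> \<le> 1"
    "\<forall>x. c * (\<Prod>z\<in>Z. dint (x - z)) ^ d \<le> norm (poly p (cis (2 * pi * x)))"
    using norm_poly_cis_ge by blast
  have "Z \<inter> \<int> = {}"
  proof (rule ccontr)
    assume "Z \<inter> \<int> \<noteq> {}"
    then obtain j where "of_int j \<in> Z" by (auto elim!: Ints_cases)
    then show False using cZ(3) pc c0 A by auto
  qed
  then show ?thesis using cZ unfolding pc by blast
qed

text \<open>The zeros in \<open>\<int>[1/K]\<close> cannot be avoided by prescribing digits, but the orbit of a point close
  to one of them stays away from all of them for a long time. All other zeros are avoided
  altogether by constraining a sparse set \<open>P\<close> of digits.\<close>

lemma charsum_orbit_lower_bound: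
  assumes A: "finite A" "A \<noteq> {}" and K: "K \<ge> 2" and \<delta>: "\<delta> > 0"
  shows "\<exists>Z c d C. finite Z \<and> (\<forall>z\<in>Z. \<bar>z\<bar> \<le> 1) \<and> 0 < c \<and> c \<le> 1 \<and> 0 \<le> C \<and>
    (\<forall>m. \<exists>P. finite P \<and> real (card P) \<le> \<delta> * real m + C \<and>
      (\<forall>y \<eta>. 0 < \<eta> \<longrightarrow> \<eta> \<le> 1 \<longrightarrow> (\<forall>p\<in>P. dint (real K ^ p * y) \<le> 1 / (16 * real K)) \<longrightarrow>
        (\<forall>k<m. \<forall>z\<in>Z. dint (real K ^ k * y - z) \<ge> \<eta>) \<longrightarrow>
        (\<Prod>k<m. norm (charsum A (real K ^ k * y))) \<ge> c ^ m * \<eta> ^ d))"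
proof -
  obtain c0 Z0 d0 where Z0: "c0 > 0" "finite Z0" "Z0 \<inter> \<int> = {}" "\<forall>z\<in>Z0. \<bar>z\<bar> \<le> 1"
     "\<forall>x. c0 * (\<Prod>z\<in>Z0. dint (x - z)) ^ d0 \<le> norm (charsum A x)"
    using norm_charsum_ge[OF A] by blast
  define G where "G = {z \<in> Z0. \<exists>i. real K ^ i * z \<in> \<int>}"
  define B where "B = Z0 - G"
  have fGB: "finite G" "finite B" using Z0(2) by (auto simp: G_def B_def)
  have GB: "Z0 = G \<union> B" "G \<inter> B = {}" by (auto simp: G_def B_def)
  have "\<forall>z\<in>G. \<exists>\<kappa>>0. \<kappa> \<le> 1 \<and> (\<forall>r\<ge>1. dint (real K ^ r * z - z) \<ge> 2 * \<kappa>)"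
    using power_of_base_separated K Z0(3) by (fastforce simp: G_def)
  then obtain \<kappa> where \<kappa>: "\<And>z. z \<in> G \<Longrightarrow> 0 < \<kappa> z \<and> \<kappa> z \<le> 1 \<and> (\<forall>r\<ge>1. dint (real K ^ r * z - z) \<ge> 2 * \<kappa> z)"
    by metis
  \<comment> \<open>The density budget is shared equally among the points of
    \<open>B\<close>.\<close>
  define \<delta>' where "\<delta>' = \<delta> / (real (card B) + 1)"
  have \<delta>': "\<delta>' > 0" using \<delta> by (simp add: \<delta>'_def add_nonneg_pos)
  have "\<forall>z\<in>B. \<exists>cC. fst cC > 0 \<and> snd cC \<ge> 0 \<and> (\<forall>m. \<exists>P. finite P \<and> real (card P) \<le> \<delta>' * real m + snd cC \<and>
    (\<forall>y. (\<forall>p\<in>P. dint (real K ^ p * y) \<le> 1 / (16 * real K)) \<longrightarrow> (\<forall>k<m. dint (real K ^ k * y - z) \<ge> fst cC)))"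
  proof
    fix z assume "z \<in> B"
    then have "\<And>i. real K ^ i * z \<notin> \<int>" by (auto simp: B_def G_def)
    from avoid_orbit_point[OF K this \<delta>'] show "\<exists>cC. fst cC > 0 \<and> snd cC \<ge> 0 \<and> (\<forall>m. \<exists>P. finite P \<and> real (card P) \<le> \<delta>' * real m + snd cC \<and>
    (\<forall>y. (\<forall>p\<in>P. dint (real K ^ p * y) \<le> 1 / (16 * real K)) \<longrightarrow> (\<forall>k<m. dint (real K ^ k * y - z) \<ge> fst cC)))"
      by (metis fst_conv snd_conv)
  qed
  then obtain cC where cC: "\<And>z. z \<in> B \<Longrightarrow> fst (cC z) > 0 \<and> snd (cC z) \<ge> 0 \<and> (\<forall>m. \<exists>P. finite P \<and> real (card P) \<le> \<delta>' * real m + snd (cC z) \<and>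
    (\<forall>y. (\<forall>p\<in>P. dint (real K ^ p * y) \<le> 1 / (16 * real K)) \<longrightarrow> (\<forall>k<m. dint (real K ^ k * y - z) \<ge> fst (cC z))))"
    by metis
  define b where "b z = min 1 (fst (cC z))" for z
  define c1 where "c1 = min 1 c0 * ((\<Prod>z\<in>B. b z) * (\<Prod>z\<in>G. \<kappa> z / real K)) ^ d0"
  define C where "C = (\<Sum>z\<in>B. snd (cC z))"
  have bpos: "0 < b z" "b z \<le> 1" if "z \<in> B" for z using cC[OF that] by (auto simp: b_def)
  have \<kappa>K: "0 < \<kappa> z / real K" "\<kappa> z / real K \<le> 1" if "z \<in> G" for z
    using \<kappa>[OF that] K by (auto simp: divide_le_eq)
  have c1: "0 < c1" "c1 \<le> 1"
  proof -
    show "0 < c1" unfolding c1_def using bpos \<kappa>K Z0(1)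
      by (intro mult_pos_pos zero_less_power prod_pos) auto
    have "(\<Prod>z\<in>B. b z) * (\<Prod>z\<in>G. \<kappa> z / real K) \<le> 1"
      using bpos \<kappa>K by (intro mult_le_one prod_le_1 prod_nonneg) (auto simp: less_imp_le)
    moreover have "(\<Prod>z\<in>B. b z) * (\<Prod>z\<in>G. \<kappa> z / real K) \<ge> 0"
      using bpos \<kappa>K by (intro mult_nonneg_nonneg prod_nonneg) (auto simp: less_imp_le)
    ultimately have "((\<Prod>z\<in>B. b z) * (\<Prod>z\<in>G. \<kappa> z / real K)) ^ d0 \<le> 1"
      "((\<Prod>z\<in>B. b z) * (\<Prod>z\<in>G. \<kappa> z / real K)) ^ d0 \<ge> 0"
      by (auto intro: power_le_one)
    then show "c1 \<le> 1" unfolding c1_def using Z0(1) by (intro mult_le_one) auto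
  qed
  have C0: "C \<ge> 0" unfolding C_def using cC by (intro sum_nonneg) auto
  have "\<exists>P. finite P \<and> real (card P) \<le> \<delta> * real m + C \<and>
      (\<forall>y \<eta>. 0 < \<eta> \<longrightarrow> \<eta> \<le> 1 \<longrightarrow> (\<forall>p\<in>P. dint (real K ^ p * y) \<le> 1 / (16 * real K)) \<longrightarrow>
        (\<forall>k<m. \<forall>z\<in>G. dint (real K ^ k * y - z) \<ge> \<eta>) \<longrightarrow>
        (\<Prod>k<m. norm (charsum A (real K ^ k * y))) \<ge> c1 ^ m * \<eta> ^ (card G * d0))" for m
  proof -
    have "\<forall>z\<in>B. \<exists>P. finite P \<and> real (card P) \<le> \<delta>' * real m + snd (cC z) \<and>
      (\<forall>y. (\<forall>p\<in>P. dint (real K ^ p * y) \<le> 1 / (16 * real K)) \<longrightarrow> (\<forall>k<m. dint (real K ^ k * y - z) \<ge> fst (cC z)))"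
      using cC by blast
    then obtain PP where PP: "\<And>z. z \<in> B \<Longrightarrow> finite (PP z) \<and> real (card (PP z)) \<le> \<delta>' * real m + snd (cC z) \<and>
      (\<forall>y. (\<forall>p\<in>PP z. dint (real K ^ p * y) \<le> 1 / (16 * real K)) \<longrightarrow> (\<forall>k<m. dint (real K ^ k * y - z) \<ge> fst (cC z)))"
      by metis
    define P where "P = (\<Union>z\<in>B. PP z)"
    have "card P \<le> (\<Sum>z\<in>B. card (PP z))" unfolding P_def by (rule card_UN_le[OF fGB(2)])
    then have "real (card P) \<le> (\<Sum>z\<in>B. real (card (PP z)))" by (simp flip: of_nat_sum)
    also have "\<dots> \<le> (\<Sum>z\<in>B. \<delta>' * real m + snd (cC z))" using PP by (intro sum_mono) auto
    also have "\<dots> = real (card B) * \<delta>' * real m + C" by (simp add: sum.distrib C_def)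
    also have "real (card B) * \<delta>' \<le> \<delta>"
      using \<delta> by (simp add: \<delta>'_def field_simps)
    finally have cP: "real (card P) \<le> \<delta> * real m + C" by (simp add: mult_right_mono)
    have "c1 ^ m * \<eta> ^ (card G * d0) \<le> (\<Prod>k<m. norm (charsum A (real K ^ k * y)))"
      if \<eta>: "0 < \<eta>" "\<eta> \<le> 1" and y: "\<forall>p\<in>P. dint (real K ^ p * y) \<le> 1 / (16 * real K)"
        and away: "\<forall>k<m. \<forall>z\<in>G. dint (real K ^ k * y - z) \<ge> \<eta>" for y \<eta>
    proof -
      have good: "(\<kappa> z / real K) ^ m * \<eta> \<le> (\<Prod>k<m. dint (real K ^ k * y - z))" if "z \<in> G" for z
        using \<kappa>[OF that] K \<eta> away that by (intro prod_dint_orbit_ge) auto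
      have bad: "b z ^ m \<le> (\<Prod>k<m. dint (real K ^ k * y - z))" if "z \<in> B" for z
      proof -
        have "(\<Prod>k<m. b z) \<le> (\<Prod>k<m. dint (real K ^ k * y - z))"
        proof (rule prod_mono, rule conjI)
          fix k assume "k \<in> {..<m}"
          then have "fst (cC z) \<le> dint (real K ^ k * y - z)" using PP[OF that] y that by (auto simp: P_def)
          then show "b z \<le> dint (real K ^ k * y - z)" by (simp add: b_def)
        qed (use bpos[OF that] in auto)
        then show ?thesis by simp
      qed
      \<comment> \<open>Each zero in \<open>G\<close> costs \<open>\<eta>\<close> once for the whole
        orbit, so the exponent of \<open>\<eta>\<close> does not depend on \<open>m\<close>.\<close>
      have "c1 ^ m * \<eta> ^ (card G * d0) =
         min 1 c0 ^ m * ((\<Prod>z\<in>B. b z ^ m) * (\<Prod>z\<in>G. (\<kappa> z / real K) ^ m * \<eta>)) ^ d0"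
        by (simp add: c1_def prod.distrib power_mult_distrib prod_power_distrib power_mult[symmetric] mult_ac)
      also have "\<dots> \<le> c0 ^ m * ((\<Prod>z\<in>B. \<Prod>k<m. dint (real K ^ k * y - z)) * (\<Prod>z\<in>G. \<Prod>k<m. dint (real K ^ k * y - z))) ^ d0"
        using Z0(1) bpos \<kappa>K \<eta> good bad
        by (intro mult_mono power_mono prod_mono mult_nonneg_nonneg prod_nonneg zero_le_power conjI) (auto simp: less_imp_le)
      also have "(\<Prod>z\<in>B. \<Prod>k<m. dint (real K ^ k * y - z)) * (\<Prod>z\<in>G. \<Prod>k<m. dint (real K ^ k * y - z))
          = (\<Prod>z\<in>Z0. \<Prod>k<m. dint (real K ^ k * y - z))"
        unfolding GB(1) using fGB GB(2) by (subst prod.union_disjoint) auto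
      also have "\<dots> = (\<Prod>k<m. \<Prod>z\<in>Z0. dint (real K ^ k * y - z))" by (rule prod.swap)
      also have "c0 ^ m * (\<Prod>k<m. \<Prod>z\<in>Z0. dint (real K ^ k * y - z)) ^ d0
         = (\<Prod>k<m. c0 * (\<Prod>z\<in>Z0. dint (real K ^ k * y - z)) ^ d0)"
        by (simp add: prod.distrib prod_power_distrib)
      also have "\<dots> \<le> (\<Prod>k<m. norm (charsum A (real K ^ k * y)))"
        using Z0(1,5) by (intro prod_mono conjI) (auto intro!: mult_nonneg_nonneg zero_le_power prod_nonneg)
      finally show ?thesis .
    qed
    moreover have "finite P" using PP fGB by (auto simp: P_def)
    ultimately show ?thesis using cP by blast
  qed
  then show ?thesis
    by (intro exI[of _ G] exI[of _ c1] exI[of _ "card G * d0"] exI[of _ C])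
       (use fGB c1 C0 Z0(4) in \<open>auto simp: G_def\<close>)
qed

section \<open>Exponential sums over digit words\<close>

definition expsum :: "nat \<Rightarrow> 'd set \<Rightarrow> ('d \<Rightarrow> real) \<Rightarrow> nat \<Rightarrow> real \<Rightarrow> complex" where
  "expsum K D v n \<xi> = (\<Sum>w\<in>words D n. cis (2 * pi * (sig K v w * \<xi>)))"

text \<open>Digits are chosen independently, so the sum is a Riesz product; removing the head digit,
  the lowest one, rescales the frequency by \<open>K\<close>.\<close>

lemma expsum_prod:
  "expsum K D v n \<xi> = (\<Prod>k<n. \<Sum>d\<in>D. cis (2 * pi * (v d * (real K ^ k * \<xi>))))"
proof (induction n arbitrary: \<xi>)
  case (Suc n)
  have "expsum K D v (Suc n) \<xi> = (\<Sum>d\<in>D. \<Sum>w\<in>words D n. cis (2 * pi * (v d * \<xi>)) * cis (2 * pi * (sig K v w * (real K * \<xi>))))"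
    unfolding expsum_def sum_words_Suc
    by (intro sum.cong refl) (simp add: cis_mult algebra_simps)
  also have "\<dots> = (\<Sum>d\<in>D. cis (2 * pi * (v d * \<xi>))) * expsum K D v n (real K * \<xi>)"
    unfolding expsum_def by (simp add: sum_product)
  also have "\<dots> = (\<Prod>k<Suc n. \<Sum>d\<in>D. cis (2 * pi * (v d * (real K ^ k * \<xi>))))"
    unfolding Suc prod.lessThan_Suc_shift by (simp add: mult_ac)
  finally show ?case .
qed (simp add: expsum_def)

lemma expsum_add:
  "expsum K D v (m + n) \<xi> = expsum K D v m \<xi> * expsum K D v n (real K ^ m * \<xi>)"
proof -
  have "(\<Prod>k<m + n. f k) = (\<Prod>k<m. f k) * (\<Prod>k<n. f (m + k))" for f :: "nat \<Rightarrow> complex"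
  proof (induction n)
    case (Suc n) then show ?case by (simp add: mult.assoc)
  qed simp
  then show ?thesis unfolding expsum_prod by (simp add: power_add mult_ac)
qed

lemma expsum_nat_prod: "expsum K A real n \<xi> = (\<Prod>k<n. charsum A (real K ^ k * \<xi>))"
  by (simp add: expsum_prod charsum_def)

lemma expsum_Times:
  "expsum K (A \<times> B) (\<lambda>(a, b). real a + t * real b) n \<xi> = expsum K A real n \<xi> * expsum K B real n (t * \<xi>)"
proof -
  have "(\<Sum>d\<in>A \<times> B. cis (2 * pi * ((case d of (a, b) \<Rightarrow> real a + t * real b) * x)))
     = (\<Sum>a\<in>A. cis (2 * pi * (real a * x))) * (\<Sum>b\<in>B. cis (2 * pi * (real b * (t * x))))" for x
    unfolding sum_product sum.cartesian_product
    by (intro sum.cong refl) (auto simp: cis_mult algebra_simps)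
  then show ?thesis unfolding expsum_prod prod.distrib[symmetric]
    by (intro prod.cong refl) (simp only: mult.left_commute[of t])
qed

lemma norm_expsum_le:
  assumes "finite D"
  shows "norm (expsum K D v n \<xi>) \<le> real (card D) ^ n"
proof -
  have "norm (expsum K D v n \<xi>) \<le> (\<Sum>w\<in>words D n. norm (cis (2 * pi * (sig K v w * \<xi>))))"
    unfolding expsum_def by (rule norm_sum)
  also have "\<dots> = real (card D ^ n)" using assms by (simp add: card_words)
  finally show ?thesis by simp
qed

lemma continuous_on_expsum [continuous_intros]:
  "continuous_on S f \<Longrightarrow> continuous_on S (\<lambda>x. expsum K D v n (f x))"
  unfolding expsum_def cis_conv_exp by (intro continuous_intros)

lemma borel_measurable_expsum [measurable]: "expsum K D v n \<in> borel_measurable borel"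
  by (intro borel_measurable_continuous_onI continuous_intros)

lemma norm_sum_cis_sq:
  fixes s :: "'a \<Rightarrow> real"
  shows "(norm (\<Sum>w\<in>W. cis (2 * pi * (s w * x))))\<^sup>2 = (\<Sum>w\<in>W. \<Sum>w'\<in>W. cos (2 * pi * (s w - s w') * x))"
proof -
  have "(norm (\<Sum>w\<in>W. cis (2 * pi * (s w * x))))\<^sup>2
     = (\<Sum>w\<in>W. cos (2 * pi * (s w * x)))\<^sup>2 + (\<Sum>w\<in>W. sin (2 * pi * (s w * x)))\<^sup>2"
    by (simp add: cmod_power2 Re_sum Im_sum)
  also have "\<dots> = (\<Sum>w\<in>W. \<Sum>w'\<in>W. cos (2 * pi * (s w * x)) * cos (2 * pi * (s w' * x))
      + sin (2 * pi * (s w * x)) * sin (2 * pi * (s w' * x)))"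
    by (simp add: power2_eq_square sum_product sum.distrib)
  also have "\<dots> = (\<Sum>w\<in>W. \<Sum>w'\<in>W. cos (2 * pi * (s w - s w') * x))"
  proof (intro sum.cong refl)
    fix w w'
    have "2 * pi * (s w - s w') * x = 2 * pi * (s w * x) - 2 * pi * (s w' * x)" by (simp add: algebra_simps)
    then show "cos (2 * pi * (s w * x)) * cos (2 * pi * (s w' * x)) + sin (2 * pi * (s w * x)) * sin (2 * pi * (s w' * x))
      = cos (2 * pi * (s w - s w') * x)" by (simp only: cos_diff)
  qed
  finally show ?thesis .
qed

text \<open>All \<open>sig\<close> values are at most \<open>2 * K ^ n\<close> in size, so every
  phase is below \<open>pi / 3\<close> and each term has real part at least \<open>1 / 2\<close>:
  there is no cancellation.\<close>

lemma norm_expsum_ge: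
  assumes D: "finite D" "card D = K" and K: "K \<ge> 1"
    and v: "\<And>d. d \<in> D \<Longrightarrow> \<bar>v d\<bar> \<le> 2 * (real K - 1)" and \<xi>: "real K ^ n * \<bar>\<xi>\<bar> \<le> 1 / 32"
  shows "norm (expsum K D v n \<xi>) \<ge> real K ^ n / 2"
proof -
  have "real K ^ n / 2 = (\<Sum>w\<in>words D n. 1 / 2)" using D by (simp add: card_words)
  also have "\<dots> \<le> (\<Sum>w\<in>words D n. cos (2 * pi * (sig K v w * \<xi>)))"
  proof (rule sum_mono)
    fix w assume w: "w \<in> words D n"
    have "\<bar>sig K v w\<bar> \<le> 2 * real K ^ n" using abs_sig_le[of K D v w n] K v w by simp
    then have "\<bar>sig K v w * \<xi>\<bar> \<le> 2 * real K ^ n * \<bar>\<xi>\<bar>" by (simp add: abs_mult mult_right_mono)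
    then have "\<bar>sig K v w * \<xi>\<bar> \<le> 1 / 16" using \<xi> by simp
    then have "2 * pi * \<bar>sig K v w * \<xi>\<bar> \<le> 2 * pi * (1 / 16)" by (intro mult_left_mono) auto
    then have "\<bar>2 * pi * (sig K v w * \<xi>)\<bar> \<le> pi / 3" by (simp add: abs_mult)
    then have "cos (pi / 3) \<le> cos \<bar>2 * pi * (sig K v w * \<xi>)\<bar>" by (intro cos_monotone_0_pi_le) auto
    then show "1 / 2 \<le> cos (2 * pi * (sig K v w * \<xi>))" by (simp add: cos_60)
  qed
  also have "\<dots> = Re (expsum K D v n \<xi>)" by (simp add: expsum_def Re_sum)
  also have "\<dots> \<le> norm (expsum K D v n \<xi>)" by (rule complex_Re_le_cmod)
  finally show ?thesis .
qed

section \<open>Energy bounds the low-frequency L2 norm\<close>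

lemma integral_fejer:
  fixes a :: real
  assumes "a \<noteq> 0"
  shows "(\<integral>x. (1 - x) * cos (a * x) * indicator {0..1} x \<partial>lborel) = (1 - cos a) / a\<^sup>2"
proof -
  have "(\<integral>x. (1 - x) * cos (a * x) * indicator {0..1} x \<partial>lborel)
     = ((1 - 1) * sin (a * 1) / a - cos (a * 1) / a\<^sup>2) - ((1 - 0) * sin (a * 0) / a - cos (a * 0) / a\<^sup>2)"
  proof (rule integral_FTC_Icc_real[where F = "\<lambda>x. (1 - x) * sin (a * x) / a - cos (a * x) / a\<^sup>2"])
    fix x :: real
    show "((\<lambda>x. (1 - x) * sin (a * x) / a - cos (a * x) / a\<^sup>2) has_real_derivative (1 - x) * cos (a * x)) (at x)"
      using assms by (auto intro!: derivative_eq_intros simp: field_simps power2_eq_square)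
    show "isCont (\<lambda>x. (1 - x) * cos (a * x)) x" by (intro continuous_intros)
  qed simp
  then show ?thesis by (simp add: diff_divide_distrib)
qed

text \<open>The weight \<open>1 - x\<close> improves the decay in \<open>\<delta>\<close> from order
  1, as for a sharp cutoff, to order 2, which is summable over cells. The cell width 8 is twice the
  threshold 4 of \<open>near_pairs\<close>: a cell lies within 4 of its centre.\<close>

lemma integral_fejer_le:
  fixes \<delta> :: real
  shows "(\<integral>x. (1 - x) * cos (2 * pi * \<delta> * x) * indicator {0..1} x \<partial>lborel)
    \<le> (if round (\<delta> / 8) = 0 then 1 else 1 / (real_of_int (round (\<delta> / 8)))\<^sup>2)"
proof (cases "round (\<delta> / 8) = 0")
  case True
  have "(\<integral>x. (1 - x) * cos (2 * pi * \<delta> * x) * indicator {0..1} x \<partial>lborel) \<le> (\<integral>x. indicator {0..1::real} x \<partial>lborel)"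
  proof (rule integral_mono)
    show "integrable lborel (\<lambda>x. (1 - x) * cos (2 * pi * \<delta> * x) * indicator {0..1} x)"
      using borel_integrable_atLeastAtMost'[of 0 1 "\<lambda>x. (1 - x) * cos (2 * pi * \<delta> * x)"]
      by (simp add: set_integrable_def mult.commute continuous_intros)
    fix x :: real
    have "(1 - x) * cos (2 * pi * \<delta> * x) \<le> 1 * 1" if "0 \<le> x" "x \<le> 1"
    proof -
      have "(1 - x) * cos (2 * pi * \<delta> * x) \<le> (1 - x) * 1" using that by (intro mult_left_mono) auto
      then show ?thesis using that by simp
    qed
    then show "(1 - x) * cos (2 * pi * \<delta> * x) * indicator {0..1} x \<le> indicator {0..1} x"
      by (auto simp: indicator_def)
  qed auto
  then show ?thesis using True by simp
next
  case False
  define r where "r = round (\<delta> / 8)"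
  have r1: "\<bar>real_of_int r\<bar> \<ge> 1" using False by (simp add: r_def)
  have "\<bar>\<delta> / 8 - real_of_int r\<bar> \<le> 1 / 2" using of_int_round_abs_le[of "\<delta> / 8"] by (simp add: r_def abs_minus_commute)
  then have d: "\<bar>\<delta>\<bar> \<ge> \<bar>real_of_int r\<bar>" using r1 by linarith
  then have d0: "\<delta> \<noteq> 0" using r1 by auto
  have "(\<integral>x. (1 - x) * cos (2 * pi * \<delta> * x) * indicator {0..1} x \<partial>lborel) = (1 - cos (2 * pi * \<delta>)) / (2 * pi * \<delta>)\<^sup>2"
    by (rule integral_fejer) (use d0 in auto)
  also have "\<dots> \<le> 2 / (2 * pi * \<delta>)\<^sup>2"
    using cos_ge_minus_one[of "2 * pi * \<delta>"] by (intro divide_right_mono) auto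
  also have "\<dots> \<le> 1 / (real_of_int r)\<^sup>2"
  proof -
    have "(real_of_int r)\<^sup>2 \<le> \<delta>\<^sup>2" using d by (metis abs_le_square_iff)
    moreover have "1 \<le> 2 * pi\<^sup>2"
    proof -
      have "1 * 1 \<le> pi * pi" using pi_gt3 by (intro mult_mono) auto
      then show ?thesis by (simp add: power2_eq_square)
    qed
    ultimately have "1 * (real_of_int r)\<^sup>2 \<le> (2 * pi\<^sup>2) * \<delta>\<^sup>2" by (intro mult_mono) auto
    then show ?thesis using r1 d0 by (simp add: field_simps power_mult_distrib)
  qed
  finally show ?thesis using False by (simp add: r_def)
qed

lemma sum_inverse_squares_int_le:
  assumes "finite R"
  shows "(\<Sum>r\<in>R. if r = (0::int) then 1 else 1 / (real_of_int r)\<^sup>2) \<le> 5"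
proof -
  have nat: "(\<Sum>r=1..n. 1 / (real r)\<^sup>2) \<le> 2 - 1 / real n" if "n \<ge> 1" for n :: nat
    using that
  proof (induction n rule: dec_induct)
    case (step n)
    have "1 / (real (Suc n))\<^sup>2 \<le> 1 / real n - 1 / real (Suc n)"
    proof -
      have "1 / (real (Suc n))\<^sup>2 \<le> 1 / (real n * real (Suc n))"
        using step by (intro divide_left_mono) (auto simp: power2_eq_square intro!: mult_right_mono)
      also have "\<dots> = 1 / real n - 1 / real (Suc n)" using step by (simp add: field_simps)
      finally show ?thesis .
    qed
    then show ?case using step by simp
  qed simp
  define n where "n = nat (Max (insert 1 (abs ` R)))"
  have n1: "n \<ge> 1" and Rn: "R \<subseteq> {-int n..int n}"
  proof -
    have M1: "Max (insert 1 (abs ` R)) \<ge> 1" using assms by (intro Max_ge) auto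
    then show "n \<ge> 1" by (simp add: n_def)
    show "R \<subseteq> {-int n..int n}"
    proof
      fix r assume "r \<in> R"
      then have "\<bar>r\<bar> \<le> Max (insert 1 (abs ` R))" using assms by (intro Max_ge) auto
      then show "r \<in> {-int n..int n}" using M1 by (simp add: n_def abs_le_iff)
    qed
  qed
  define g where "g r = (if r = (0::int) then 1 else 1 / (real_of_int r)\<^sup>2)" for r
  have "sum g R \<le> sum g {-int n..int n}" using Rn by (intro sum_mono2) (auto simp: g_def)
  also have "{-int n..int n} = {0} \<union> int ` {1..n} \<union> (\<lambda>k. - int k) ` {1..n}"
  proof (intro equalityI subsetI)
    fix r assume r: "r \<in> {-int n..int n}"
    consider "r = 0" | "r > 0" | "r < 0" by linarith
    then show "r \<in> {0} \<union> int ` {1..n} \<union> (\<lambda>k. - int k) ` {1..n}"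
    proof cases
      case 2 then show ?thesis using r by (auto intro!: image_eqI[of _ _ "nat r"])
    next
      case 3 then show ?thesis using r by (auto intro!: image_eqI[of _ _ "nat (- r)"])
    qed simp
  qed auto
  also have "sum g \<dots> = g 0 + (\<Sum>k=1..n. g (int k)) + (\<Sum>k=1..n. g (- int k))"
  proof -
    have "sum g ({0} \<union> int ` {1..n} \<union> (\<lambda>k. - int k) ` {1..n})
      = sum g ({0} \<union> int ` {1..n}) + sum g ((\<lambda>k. - int k) ` {1..n})"
      by (rule sum.union_disjoint) auto
    also have "sum g ({0} \<union> int ` {1..n}) = sum g {0} + sum g (int ` {1..n})"
      by (rule sum.union_disjoint) auto
    finally show ?thesis by (simp add: sum.reindex inj_on_def)
  qed
  also have "(\<Sum>k=1..n. g (int k)) = (\<Sum>k=1..n. 1 / (real k)\<^sup>2)" by (intro sum.cong) (auto simp: g_def)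
  also have "(\<Sum>k=1..n. g (- int k)) = (\<Sum>k=1..n. 1 / (real k)\<^sup>2)" by (intro sum.cong) (auto simp: g_def)
  also have "g 0 + (\<Sum>k=1..n. 1 / (real k)\<^sup>2) + (\<Sum>k=1..n. 1 / (real k)\<^sup>2) \<le> 5"
  proof -
    have "0 \<le> 1 / real n" by simp
    then have "(\<Sum>k=1..n. 1 / (real k)\<^sup>2) \<le> 2" using nat[OF n1] by linarith
    then show ?thesis by (simp add: g_def)
  qed
  finally show ?thesis by (simp add: g_def)
qed

text \<open>The constant is \<open>40 = 2 * 4 * 5\<close>. The Fejer weight is at least
  \<open>1 / 2\<close> on the interval of integration, each cell of differences holds at most 4
  times the number of near pairs by \<open>card_pairs_shift\<close>, and the cell weights add up to
  at most 5.\<close>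

lemma nn_integral_norm_sum_cis_half:
  fixes s :: "'a \<Rightarrow> real"
  assumes W: "finite W"
  shows "(\<integral>\<^sup>+x. ennreal ((norm (\<Sum>w\<in>W. cis (2 * pi * (s w * x))))\<^sup>2) * indicator {0..1/2} x \<partial>lborel)
    \<le> ennreal (40 * real (card {(w, w') \<in> W \<times> W. \<bar>s w - s w'\<bar> \<le> 4}))"
proof -
  define F where "F x = (norm (\<Sum>w\<in>W. cis (2 * pi * (s w * x))))\<^sup>2" for x
  define I where "I p x = (1 - x) * cos (2 * pi * (s (fst p) - s (snd p)) * x) * indicator {0..1} x" for p and x :: real
  define e where "e = real (card {(w, w') \<in> W \<times> W. \<bar>s w - s w'\<bar> \<le> 4})"
  have intI: "integrable lborel (I p)" for p
    using borel_integrable_atLeastAtMost'[of 0 1 "\<lambda>x. (1 - x) * cos (2 * pi * (s (fst p) - s (snd p)) * x)"]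
    by (simp add: set_integrable_def mult.commute continuous_intros I_def[abs_def])
  have FI: "(1 - x) * F x * indicator {0..1} x = (\<Sum>p\<in>W \<times> W. I p x)" for x
    unfolding F_def norm_sum_cis_sq sum.cartesian_product I_def sum_distrib_left sum_distrib_right
    by (intro sum.cong refl) auto
  have nn: "0 \<le> (\<Sum>p\<in>W \<times> W. I p x)" for x
    unfolding FI[symmetric] by (auto simp: indicator_def F_def)
  have "(\<integral>\<^sup>+x. ennreal (F x) * indicator {0..1/2} x \<partial>lborel) \<le> (\<integral>\<^sup>+x. 2 * ennreal (\<Sum>p\<in>W \<times> W. I p x) \<partial>lborel)"
  proof (rule nn_integral_mono)
    fix x :: real
    have "F x \<le> 2 * ((1 - x) * F x)" if "0 \<le> x" "x \<le> 1 / 2"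
    proof -
      have "1 * F x \<le> (2 * (1 - x)) * F x" using that by (intro mult_right_mono) (auto simp: F_def)
      then show ?thesis by (simp only: mult.assoc mult_1_left)
    qed
    then have "ennreal (F x) * indicator {0..1/2} x \<le> ennreal (2 * ((1 - x) * F x * indicator {0..1} x))"
      by (auto simp: indicator_def intro!: ennreal_leI)
    also have "\<dots> = 2 * ennreal (\<Sum>p\<in>W \<times> W. I p x)"
      unfolding FI using nn by (subst ennreal_mult) auto
    finally show "ennreal (F x) * indicator {0..1/2} x \<le> 2 * ennreal (\<Sum>p\<in>W \<times> W. I p x)" .
  qed
  also have "\<dots> = 2 * (\<integral>\<^sup>+x. ennreal (\<Sum>p\<in>W \<times> W. I p x) \<partial>lborel)"
    using intI by (intro nn_integral_cmult) (auto intro!: borel_measurable_sum borel_measurable_integrable simp: measurable_compose[OF _ measurable_ennreal])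
  also have "(\<integral>\<^sup>+x. ennreal (\<Sum>p\<in>W \<times> W. I p x) \<partial>lborel) = ennreal (\<integral>x. (\<Sum>p\<in>W \<times> W. I p x) \<partial>lborel)"
    using nn intI by (intro nn_integral_eq_integral) auto
  also have "(\<integral>x. (\<Sum>p\<in>W \<times> W. I p x) \<partial>lborel) = (\<Sum>p\<in>W \<times> W. \<integral>x. I p x \<partial>lborel)"
    using intI by (intro Bochner_Integration.integral_sum) auto
  also have "(\<Sum>p\<in>W \<times> W. \<integral>x. I p x \<partial>lborel) \<le> 20 * e"
  proof -
    define r where "r p = round ((s (fst p) - s (snd p)) / 8)" for p
    define g where "g i = (if i = (0::int) then 1 else 1 / (real_of_int i)\<^sup>2)" for i
    have g0: "g i \<ge> 0" for i by (simp add: g_def)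
    have "(\<Sum>p\<in>W \<times> W. \<integral>x. I p x \<partial>lborel) \<le> (\<Sum>p\<in>W \<times> W. g (r p))"
      unfolding I_def g_def r_def by (intro sum_mono integral_fejer_le)
    also have "\<dots> = (\<Sum>i\<in>r ` (W \<times> W). \<Sum>p\<in>{p \<in> W \<times> W. r p = i}. g (r p))"
      using W by (intro sum.image_gen) auto
    also have "\<dots> = (\<Sum>i\<in>r ` (W \<times> W). real (card {p \<in> W \<times> W. r p = i}) * g i)"
      by (intro sum.cong refl) simp
    also have "\<dots> \<le> (\<Sum>i\<in>r ` (W \<times> W). (4 * e) * g i)"
    proof (intro sum_mono mult_right_mono g0)
      fix i
      have "card {p \<in> W \<times> W. r p = i} \<le> card {(w, w') \<in> W \<times> W. \<bar>s w - s w' - 8 * real_of_int i\<bar> \<le> 4}"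
      proof (rule card_mono)
        show "finite {(w, w') \<in> W \<times> W. \<bar>s w - s w' - 8 * real_of_int i\<bar> \<le> 4}"
          using W by (auto intro: finite_subset[of _ "W \<times> W"])
        have "\<bar>s w - s w' - 8 * real_of_int (round ((s w - s w') / 8))\<bar> \<le> 4" for w w'
        proof -
          have "\<bar>d - 8 * i\<bar> \<le> 4" if "\<bar>i - d / 8\<bar> \<le> 1 / 2" for i d :: real using that by linarith
          then show ?thesis using of_int_round_abs_le by blast
        qed
        then show "{p \<in> W \<times> W. r p = i} \<subseteq> {(w, w') \<in> W \<times> W. \<bar>s w - s w' - 8 * real_of_int i\<bar> \<le> 4}"
          by (auto simp: r_def)
      qed
      also have "\<dots> \<le> 4 * card {(w, w') \<in> W \<times> W. \<bar>s w - s w'\<bar> \<le> 4}"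
        using W by (intro card_pairs_shift) auto
      finally have "real (card {p \<in> W \<times> W. r p = i}) \<le> real (4 * card {(w, w') \<in> W \<times> W. \<bar>s w - s w'\<bar> \<le> 4})"
        by (rule of_nat_mono)
      then show "real (card {p \<in> W \<times> W. r p = i}) \<le> 4 * e"
        by (simp only: e_def of_nat_mult of_nat_numeral)
    qed
    also have "\<dots> = (4 * e) * (\<Sum>i\<in>r ` (W \<times> W). g i)" by (simp add: sum_distrib_left)
    also have "\<dots> \<le> (4 * e) * 5"
      unfolding g_def using W by (intro mult_left_mono sum_inverse_squares_int_le) (auto simp: e_def)
    finally show ?thesis by simp
  qed
  finally have "(\<integral>\<^sup>+x. ennreal (F x) * indicator {0..1/2} x \<partial>lborel) \<le> 2 * ennreal (20 * e)"
    by (simp add: mult_left_mono ennreal_leI)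
  also have "\<dots> = ennreal (40 * e)" by (simp add: e_def ennreal_mult'[symmetric] flip: ennreal_numeral)
  finally show ?thesis by (simp add: F_def e_def)
qed

lemma nn_integral_reflect:
  fixes f :: "real \<Rightarrow> ennreal"
  assumes [measurable]: "f \<in> borel_measurable borel"
  shows "(\<integral>\<^sup>+x. f (- x) \<partial>lborel) = (\<integral>\<^sup>+x. f x \<partial>lborel)"
  using nn_integral_real_affine[of f "-1" 0] by simp

lemma nn_integral_norm_expsum_le:
  assumes D: "finite D"
  shows "(\<integral>\<^sup>+\<xi>. ennreal ((norm (expsum K D v n \<xi>))\<^sup>2) * indicator {-1/2..1/2} \<xi> \<partial>lborel)
    \<le> ennreal (80 * real (energy K D v n))"
proof -
  define G where "G \<xi> = ennreal ((norm (expsum K D v n \<xi>))\<^sup>2)" for \<xi>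
  have [measurable]: "G \<in> borel_measurable borel" unfolding G_def by measurable
  have half: "(\<integral>\<^sup>+\<xi>. G \<xi> * indicator {0..1/2} \<xi> \<partial>lborel) \<le> ennreal (40 * real (energy K D v n))"
    unfolding G_def expsum_def energy_def near_pairs_def
    using D by (intro nn_integral_norm_sum_cis_half) auto
  have even: "G (- \<xi>) = G \<xi>" for \<xi>
  proof -
    have "norm (expsum K D v n (- \<xi>)) = norm (cnj (expsum K D v n \<xi>))"
      unfolding expsum_def by (simp add: cis_cnj)
    then show ?thesis by (simp add: G_def)
  qed
  have "(\<integral>\<^sup>+\<xi>. G \<xi> * indicator {-1/2..1/2} \<xi> \<partial>lborel)
    \<le> (\<integral>\<^sup>+\<xi>. G \<xi> * indicator {0..1/2} \<xi> + G (- \<xi>) * indicator {0..1/2} (- \<xi>) \<partial>lborel)"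
    by (rule nn_integral_mono) (auto simp: indicator_def even)
  also have "\<dots> = (\<integral>\<^sup>+\<xi>. G \<xi> * indicator {0..1/2} \<xi> \<partial>lborel) + (\<integral>\<^sup>+\<xi>. G (- \<xi>) * indicator {0..1/2} (- \<xi>) \<partial>lborel)"
    by (rule nn_integral_add) measurable
  also have "(\<integral>\<^sup>+\<xi>. G (- \<xi>) * indicator {0..1/2} (- \<xi>) \<partial>lborel) = (\<integral>\<^sup>+\<xi>. G \<xi> * indicator {0..1/2} \<xi> \<partial>lborel)"
    by (rule nn_integral_reflect) measurable
  also have "(\<integral>\<^sup>+\<xi>. G \<xi> * indicator {0..1/2} \<xi> \<partial>lborel) + (\<integral>\<^sup>+\<xi>. G \<xi> * indicator {0..1/2} \<xi> \<partial>lborel)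
     \<le> ennreal (40 * real (energy K D v n)) + ennreal (40 * real (energy K D v n))"
    by (intro add_mono half)
  also have "\<dots> = ennreal (80 * real (energy K D v n))" by (subst ennreal_plus[symmetric]) auto
  finally show ?thesis by (simp add: G_def)
qed

text \<open>Positive definiteness: expanding the square, every pair of frequencies contributes
  \<open>|\<integral>\<^sub>\<Gamma> e(x(s\<^sub>w - s\<^sub>w\<^sub>')) dx|\<^sup>2\<close>; only the diagonal is kept.\<close>

lemma nn_integral_diff_norm_sum_cis_ge:
  fixes s :: "'a \<Rightarrow> real"
  assumes W: "finite W" and M: "finite_measure M" "sets M = sets (restrict_space lborel \<Gamma>)" "space M = \<Gamma>"
    and \<Gamma>: "\<Gamma> \<in> sets borel"
  shows "ennreal (real (card W) * (measure M (space M))\<^sup>2)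
    \<le> (\<integral>\<^sup>+y. \<integral>\<^sup>+x. ennreal ((norm (\<Sum>w\<in>W. cis (2 * pi * (s w * (x - y)))))\<^sup>2) \<partial>M \<partial>M)"
proof -
  interpret finite_measure M by fact
  have meas: "f \<in> borel_measurable M" if "f \<in> borel_measurable borel" for f :: "real \<Rightarrow> real"
  proof -
    have "f \<in> borel_measurable (restrict_space lborel \<Gamma>)" using that by (intro measurable_restrict_space1) simp
    then show ?thesis by (simp cong: measurable_cong_sets add: measurable_cong_sets[OF M(2) refl])
  qed
  define d where "d p = 2 * pi * (s (fst p) - s (snd p))" for p
  define C where "C p = (\<integral>x. cos (d p * x) \<partial>M)" for p
  define S where "S p = (\<integral>x. sin (d p * x) \<partial>M)" for p
  have ic: "integrable M (\<lambda>x. cos (a * x))" and isn: "integrable M (\<lambda>x. sin (a * x))" for a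
    by (rule integrable_const_bound[where B = 1]; auto intro!: meas)+
  have F: "(norm (\<Sum>w\<in>W. cis (2 * pi * (s w * (x - y)))))\<^sup>2
     = (\<Sum>p\<in>W \<times> W. cos (d p * x) * cos (d p * y) + sin (d p * x) * sin (d p * y))" for x y
    unfolding norm_sum_cis_sq sum.cartesian_product
    by (intro sum.cong refl, clarify)
       (simp only: d_def fst_conv snd_conv cos_diff[symmetric] right_diff_distrib[symmetric])
  have inner: "(\<integral>\<^sup>+x. ennreal ((norm (\<Sum>w\<in>W. cis (2 * pi * (s w * (x - y)))))\<^sup>2) \<partial>M)
     = ennreal (\<Sum>p\<in>W \<times> W. C p * cos (d p * y) + S p * sin (d p * y))" for y
  proof -
    have int: "integrable M (\<lambda>x. \<Sum>p\<in>W \<times> W. cos (d p * x) * cos (d p * y) + sin (d p * x) * sin (d p * y))"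
      using ic isn by (intro Bochner_Integration.integrable_sum Bochner_Integration.integrable_add integrable_mult_left) auto
    have "(\<integral>\<^sup>+x. ennreal ((norm (\<Sum>w\<in>W. cis (2 * pi * (s w * (x - y)))))\<^sup>2) \<partial>M)
      = ennreal (\<integral>x. (\<Sum>p\<in>W \<times> W. cos (d p * x) * cos (d p * y) + sin (d p * x) * sin (d p * y)) \<partial>M)"
      using int unfolding F[symmetric] by (intro nn_integral_eq_integral) auto
    also have "(\<integral>x. (\<Sum>p\<in>W \<times> W. cos (d p * x) * cos (d p * y) + sin (d p * x) * sin (d p * y)) \<partial>M)
      = (\<Sum>p\<in>W \<times> W. C p * cos (d p * y) + S p * sin (d p * y))"
      using ic isn by (simp add: C_def S_def)
    finally show ?thesis .
  qed
  have nonneg: "0 \<le> (\<Sum>p\<in>W \<times> W. C p * cos (d p * y) + S p * sin (d p * y))" for y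
  proof -
    have "(\<Sum>p\<in>W \<times> W. C p * cos (d p * y) + S p * sin (d p * y))
      = (\<integral>x. (\<Sum>p\<in>W \<times> W. cos (d p * x) * cos (d p * y) + sin (d p * x) * sin (d p * y)) \<partial>M)"
      using ic isn by (simp add: C_def S_def)
    also have "\<dots> \<ge> 0" unfolding F[symmetric] by (intro Bochner_Integration.integral_nonneg) auto
    finally show ?thesis .
  qed
  have "(\<integral>\<^sup>+y. \<integral>\<^sup>+x. ennreal ((norm (\<Sum>w\<in>W. cis (2 * pi * (s w * (x - y)))))\<^sup>2) \<partial>M \<partial>M)
     = ennreal (\<integral>y. (\<Sum>p\<in>W \<times> W. C p * cos (d p * y) + S p * sin (d p * y)) \<partial>M)"
    unfolding inner using nonneg ic isn
    by (intro nn_integral_eq_integral Bochner_Integration.integrable_sum Bochner_Integration.integrable_add integrable_mult_right) auto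
  also have "(\<integral>y. (\<Sum>p\<in>W \<times> W. C p * cos (d p * y) + S p * sin (d p * y)) \<partial>M) = (\<Sum>p\<in>W \<times> W. (C p)\<^sup>2 + (S p)\<^sup>2)"
    using ic isn by (simp add: C_def[symmetric] S_def[symmetric] power2_eq_square)
  finally have eq: "(\<integral>\<^sup>+y. \<integral>\<^sup>+x. ennreal ((norm (\<Sum>w\<in>W. cis (2 * pi * (s w * (x - y)))))\<^sup>2) \<partial>M \<partial>M)
     = ennreal (\<Sum>p\<in>W \<times> W. (C p)\<^sup>2 + (S p)\<^sup>2)" .
  have "real (card W) * (measure M (space M))\<^sup>2 = (\<Sum>w\<in>W. (C (w, w))\<^sup>2 + (S (w, w))\<^sup>2)"
    by (simp add: C_def S_def d_def)
  also have "\<dots> = (\<Sum>p\<in>(\<lambda>w. (w, w)) ` W. (C p)\<^sup>2 + (S p)\<^sup>2)"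
    by (subst sum.reindex) (auto simp: inj_on_def)
  also have "\<dots> \<le> (\<Sum>p\<in>W \<times> W. (C p)\<^sup>2 + (S p)\<^sup>2)"
    using W by (intro sum_mono2) auto
  finally show ?thesis unfolding eq by (rule ennreal_leI)
qed

text \<open>For each fixed \<open>y\<close> the differences \<open>x - y\<close> run through a
  translate of \<open>\<Gamma>\<close> inside \<open>{-c..c}\<close>; the integration over
  \<open>y\<close> then gives the measure of \<open>\<Gamma>\<close>.\<close>

lemma nn_integral_diff_le:
  fixes f :: "real \<Rightarrow> ennreal"
  assumes f [measurable]: "f \<in> borel_measurable borel" and G [measurable]: "\<Gamma> \<in> sets borel" and "\<Gamma> \<subseteq> {0..c}"
  shows "(\<integral>\<^sup>+y. (\<integral>\<^sup>+x. f (x - y) * indicator \<Gamma> x \<partial>lborel) * indicator \<Gamma> y \<partial>lborel)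
    \<le> emeasure lborel \<Gamma> * (\<integral>\<^sup>+u. f u * indicator {-c..c} u \<partial>lborel)"
proof -
  have "(\<integral>\<^sup>+x. f (x - y) * indicator \<Gamma> x \<partial>lborel) * indicator \<Gamma> y
    \<le> (\<integral>\<^sup>+u. f u * indicator {-c..c} u \<partial>lborel) * indicator \<Gamma> y" for y
  proof (cases "y \<in> \<Gamma>")
    case True
    have "(\<integral>\<^sup>+x. f (x - y) * indicator \<Gamma> x \<partial>lborel) \<le> (\<integral>\<^sup>+x. f (- y + 1 * x) * indicator {-c..c} (- y + 1 * x) \<partial>lborel)"
    proof (rule nn_integral_mono)
      fix x show "f (x - y) * indicator \<Gamma> x \<le> f (- y + 1 * x) * indicator {-c..c} (- y + 1 * x)"
      proof (cases "x \<in> \<Gamma>")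
        case x: True
        have "x \<in> {0..c}" "y \<in> {0..c}" using x True assms(3) by blast+
        then have "- y + 1 * x \<in> {-c..c}" by auto
        then show ?thesis using x by simp
      qed simp
    qed
    also have "\<dots> = (\<integral>\<^sup>+u. f u * indicator {-c..c} u \<partial>lborel)"
      using nn_integral_real_affine[of "\<lambda>u. f u * indicator {-c..c} u" 1 "- y"] by simp
    finally show ?thesis by (intro mult_right_mono) auto
  qed simp
  then have "(\<integral>\<^sup>+y. (\<integral>\<^sup>+x. f (x - y) * indicator \<Gamma> x \<partial>lborel) * indicator \<Gamma> y \<partial>lborel)
    \<le> (\<integral>\<^sup>+y. (\<integral>\<^sup>+u. f u * indicator {-c..c} u \<partial>lborel) * indicator \<Gamma> y \<partial>lborel)"
    by (intro nn_integral_mono)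
  also have "\<dots> = (\<integral>\<^sup>+u. f u * indicator {-c..c} u \<partial>lborel) * emeasure lborel \<Gamma>"
    by (subst nn_integral_cmult_indicator) auto
  finally show ?thesis by (simp add: mult.commute)
qed

text \<open>Parseval: distinct integer frequencies are orthogonal over a full period.\<close>

lemma nn_integral_sum_cis_period:
  fixes s :: "'a \<Rightarrow> int"
  assumes W: "finite W" and inj: "inj_on s W" and q: "q > 0"
  shows "(\<integral>\<^sup>+x. ennreal ((norm (\<Sum>w\<in>W. cis (2 * pi * (of_int (s w) * (q * x)))))\<^sup>2) * indicator {a..a + 1 / q} x \<partial>lborel)
    = ennreal (real (card W) / q)"
proof -
  have fourier: "(\<integral>x. cos (2 * pi * of_int n * q * x) * indicator {a..a + 1 / q} x \<partial>lborel) = (if n = 0 then 1 / q else 0)" for n :: int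
  proof (cases "n = 0")
    case True then show ?thesis using q by simp
  next
    case False
    define b where "b = 2 * pi * of_int n * q"
    have b0: "b \<noteq> 0" using False q by (simp add: b_def)
    have "(\<integral>x. cos (b * x) * indicator {a..a + 1 / q} x \<partial>lborel) = sin (b * (a + 1 / q)) / b - sin (b * a) / b"
    proof (rule integral_FTC_Icc_real[where F = "\<lambda>x. sin (b * x) / b"])
      show "((\<lambda>x. sin (b * x) / b) has_real_derivative cos (b * x)) (at x)" for x
        using b0 by (auto intro!: derivative_eq_intros)
      show "isCont (\<lambda>x. cos (b * x)) x" for x by (intro continuous_intros)
    qed (use q in simp)
    moreover have "b * (a + 1 / q) = b * a + 2 * pi * of_int n" using q by (simp add: b_def field_simps)
    moreover have "sin (b * a + 2 * pi * of_int n) = sin (b * a)"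
      using sin_add[of "b * a" "2 * pi * of_int n"] sin_integer_2pi[of "of_int n"] cos_integer_2pi[of "of_int n"] by simp
    ultimately show ?thesis using False by (simp add: b_def)
  qed
  define I where "I p x = cos (2 * pi * of_int (s (fst p) - s (snd p)) * q * x) * indicator {a..a + 1 / q} x" for p x
  have intI: "integrable lborel (I p)" for p
    using borel_integrable_atLeastAtMost'[of a "a + 1 / q" "\<lambda>x. cos (2 * pi * of_int (s (fst p) - s (snd p)) * q * x)"]
    by (simp add: set_integrable_def mult.commute continuous_intros I_def[abs_def])
  have FI: "(norm (\<Sum>w\<in>W. cis (2 * pi * (of_int (s w) * (q * x)))))\<^sup>2 * indicator {a..a + 1 / q} x = (\<Sum>p\<in>W \<times> W. I p x)" for x
    unfolding norm_sum_cis_sq sum.cartesian_product I_def sum_distrib_right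
    by (intro sum.cong refl) (auto simp: mult.assoc)
  have "(\<integral>\<^sup>+x. ennreal ((norm (\<Sum>w\<in>W. cis (2 * pi * (of_int (s w) * (q * x)))))\<^sup>2) * indicator {a..a + 1 / q} x \<partial>lborel)
    = (\<integral>\<^sup>+x. ennreal (\<Sum>p\<in>W \<times> W. I p x) \<partial>lborel)"
    unfolding FI[symmetric] by (intro nn_integral_cong) (auto simp: indicator_def)
  also have "\<dots> = ennreal (\<integral>x. (\<Sum>p\<in>W \<times> W. I p x) \<partial>lborel)"
  proof (rule nn_integral_eq_integral)
    show "integrable lborel (\<lambda>x. \<Sum>p\<in>W \<times> W. I p x)"
      using intI by (intro Bochner_Integration.integrable_sum) auto
    show "AE x in lborel. 0 \<le> (\<Sum>p\<in>W \<times> W. I p x)" unfolding FI[symmetric] by simp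
  qed
  also have "(\<integral>x. (\<Sum>p\<in>W \<times> W. I p x) \<partial>lborel) = (\<Sum>p\<in>W \<times> W. \<integral>x. I p x \<partial>lborel)"
    using intI by (intro Bochner_Integration.integral_sum) auto
  also have "\<dots> = (\<Sum>p\<in>W \<times> W. if s (fst p) - s (snd p) = 0 then 1 / q else 0)"
    unfolding I_def fourier by simp
  also have "\<dots> = (\<Sum>w\<in>W. \<Sum>w'\<in>W. if w = w' then 1 / q else 0)"
    unfolding sum.cartesian_product using inj by (intro sum.cong refl) (auto simp: inj_on_def)
  also have "\<dots> = real (card W) / q" using W by simp
  finally show ?thesis .
qed

text \<open>An integer copy of \<open>sig K real\<close>: Parseval needs distinct integer
  frequencies, and base-\<open>K\<close> expansions with digits below \<open>K\<close> provide
  them.\<close>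

primrec nsig :: "nat \<Rightarrow> nat list \<Rightarrow> nat" where
  "nsig K [] = 0"
| "nsig K (a # w) = a + K * nsig K w"

lemma sig_real_eq: "sig K real w = real (nsig K w)"
  by (induction w) auto

lemma inj_on_nsig:
  assumes "A \<subseteq> {0..<K}"
  shows "inj_on (nsig K) (words A n)"
proof (induction n)
  case (Suc n)
  show ?case
  proof (rule inj_onI)
    fix w u assume "w \<in> words A (Suc n)" "u \<in> words A (Suc n)" and eq: "nsig K w = nsig K u"
    then obtain a w' b u' where wu: "w = a # w'" "u = b # u'" "a \<in> A" "b \<in> A" "w' \<in> words A n" "u' \<in> words A n"
      by (auto simp: words_Suc)
    have lt: "a < K" "b < K" using wu assms by auto
    have "(a + K * nsig K w') mod K = (b + K * nsig K u') mod K" using eq wu by simp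
    then have ab: "a = b" using lt by simp
    then have "nsig K w' = nsig K u'" using eq wu lt by simp
    then show "w = u" using Suc wu ab by (auto dest: inj_onD)
  qed
qed simp

lemma nn_integral_expsum_period:
  assumes A: "A \<subseteq> {0..<K}" and K: "K \<ge> 1"
  shows "(\<integral>\<^sup>+x. ennreal ((norm (expsum K A real n (real K ^ j * x)))\<^sup>2) * indicator {a..a + 1 / real K ^ j} x \<partial>lborel)
    = ennreal (real (card A) ^ n / real K ^ j)"
proof -
  have fA: "finite A" using A finite_subset by blast
  have "inj_on (\<lambda>w. int (nsig K w)) (words A n)" using inj_on_nsig[OF A] by (auto simp: inj_on_def)
  from nn_integral_sum_cis_period[OF _ this, of "real K ^ j" a]
  show ?thesis using fA K by (simp add: expsum_def sig_real_eq card_words)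
qed

text \<open>The interval is covered by \<open>2 * K ^ m + 1 <= 3 * K ^ m\<close> periods of length
  \<open>1 / K ^ m\<close>.\<close>

lemma nn_integral_expsum_unit:
  assumes A: "A \<subseteq> {0..<K}" and K: "K \<ge> 1"
  shows "(\<integral>\<^sup>+x. ennreal ((norm (expsum K A real n (real K ^ m * x)))\<^sup>2) * indicator {-1..1} x \<partial>lborel)
    \<le> ennreal (3 * real (card A) ^ n)"
proof -
  define g where "g x = ennreal ((norm (expsum K A real n (real K ^ m * x)))\<^sup>2)" for x
  have gm [measurable]: "g \<in> borel_measurable borel" unfolding g_def by measurable
  define a where "a j = -1 + real j / real K ^ m" for j
  have Km: "real K ^ m > 0" using K by simp
  have "g x * indicator {-1..1} x \<le> (\<Sum>j\<le>2 * K ^ m. g x * indicator {a j..a j + 1 / real K ^ m} x)" for x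
  proof (cases "x \<in> {-1..1}")
    case True
    define j where "j = nat \<lfloor>(x + 1) * real K ^ m\<rfloor>"
    have j1: "real j \<le> (x + 1) * real K ^ m" "(x + 1) * real K ^ m < real j + 1"
    proof -
      have "0 \<le> (x + 1) * real K ^ m" using True by simp
      then show "real j \<le> (x + 1) * real K ^ m" "(x + 1) * real K ^ m < real j + 1" unfolding j_def by linarith+
    qed
    have "(x + 1) * real K ^ m \<le> 2 * real K ^ m" using True by (intro mult_right_mono) auto
    then have "real j \<le> real (2 * K ^ m)" using j1 by simp
    then have j2: "j \<le> 2 * K ^ m" by (simp only: of_nat_le_iff)
    have "x \<in> {a j..a j + 1 / real K ^ m}"
      using j1 Km by (auto simp: a_def field_simps)
    then have "g x * indicator {-1..1} x = g x * indicator {a j..a j + 1 / real K ^ m} x" using True by simp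
    also have "\<dots> \<le> (\<Sum>j\<le>2 * K ^ m. g x * indicator {a j..a j + 1 / real K ^ m} x)"
      using j2 by (intro member_le_sum) auto
    finally show ?thesis by simp
  qed simp
  then have "(\<integral>\<^sup>+x. g x * indicator {-1..1} x \<partial>lborel) \<le> (\<integral>\<^sup>+x. (\<Sum>j\<le>2 * K ^ m. g x * indicator {a j..a j + 1 / real K ^ m} x) \<partial>lborel)"
    by (intro nn_integral_mono)
  also have "\<dots> = (\<Sum>j\<le>2 * K ^ m. \<integral>\<^sup>+x. g x * indicator {a j..a j + 1 / real K ^ m} x \<partial>lborel)"
    by (intro nn_integral_sum) measurable
  also have "\<dots> = (\<Sum>j\<le>2 * K ^ m. ennreal (real (card A) ^ n / real K ^ m))"
    unfolding g_def by (intro sum.cong refl nn_integral_expsum_period A K)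
  also have "\<dots> = ennreal (real (2 * K ^ m + 1) * (real (card A) ^ n / real K ^ m))"
    by (subst sum_ennreal) auto
  also have "\<dots> \<le> ennreal (3 * real (card A) ^ n)"
  proof (rule ennreal_leI)
    have "1 \<le> real K ^ m" using K by (intro one_le_power) auto
    then have "real (2 * K ^ m + 1) \<le> 3 * real K ^ m" by simp
    then have "real (2 * K ^ m + 1) * (real (card A) ^ n / real K ^ m) \<le> 3 * real K ^ m * (real (card A) ^ n / real K ^ m)"
      by (intro mult_right_mono) auto
    then show "real (2 * K ^ m + 1) * (real (card A) ^ n / real K ^ m) \<le> 3 * real (card A) ^ n" using K by simp
  qed
  finally show ?thesis by (simp add: g_def)
qed

text \<open>Dirichlet's argument with measures: for each new frequency \<open>l\<close> the points
  are sorted by the cell of \<open>l * x\<close> modulo 1 among \<open>Q\<close> cells, and the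
  heaviest class is kept, at the cost of a factor \<open>Q\<close>.\<close>

lemma pigeonhole_frequencies:
  fixes F :: "real set" and Q :: nat
  assumes F: "finite F" and Q: "Q \<ge> 1" and c: "c \<ge> 0"
  shows "\<exists>\<Gamma>\<in>sets borel. \<Gamma> \<subseteq> {0..c} \<and> c \<le> real Q ^ card F * measure lborel \<Gamma> \<and>
    (\<forall>x\<in>\<Gamma>. \<forall>y\<in>\<Gamma>. \<forall>l\<in>F. dint (l * (x - y)) \<le> 1 / real Q)"
  using F
proof (induction F)
  case empty
  show ?case using c by (intro bexI[of _ "{0..c}"]) auto
next
  case (insert l F)
  then obtain \<Gamma> where G: "\<Gamma> \<in> sets borel" "\<Gamma> \<subseteq> {0..c}" "c \<le> real Q ^ card F * measure lborel \<Gamma>"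
    "\<forall>x\<in>\<Gamma>. \<forall>y\<in>\<Gamma>. \<forall>l\<in>F. dint (l * (x - y)) \<le> 1 / real Q" by auto
  define f where "f x = \<lfloor>real Q * frac (l * x)\<rfloor>" for x
  define H where "H j = {x \<in> \<Gamma>. f x = int j}" for j
  have Hm: "H j \<in> sets borel" for j
  proof -
    have [measurable]: "(\<lambda>x. real Q * frac (l * x)) \<in> borel_measurable borel" unfolding frac_def by measurable
    have "{x. real j \<le> real Q * frac (l * x) \<and> real Q * frac (l * x) < real j + 1} \<in> sets borel" by measurable
    moreover have "H j = \<Gamma> \<inter> {x. real j \<le> real Q * frac (l * x) \<and> real Q * frac (l * x) < real j + 1}"
      unfolding H_def f_def floor_eq_iff by auto
    ultimately show ?thesis using G(1) by (simp only: sets.Int)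
  qed
  have Hfin: "emeasure lborel (H j) \<noteq> \<infinity>" for j
  proof -
    have "emeasure lborel (H j) \<le> emeasure lborel {0..c}" using G(2) by (intro emeasure_mono) (auto simp: H_def)
    then show ?thesis using c by (auto simp: top_unique)
  qed
  have "\<Gamma> = (\<Union>j\<in>{..<Q}. H j)"
  proof (intro equalityI subsetI)
    fix x assume x: "x \<in> \<Gamma>"
    have f: "0 \<le> real Q * frac (l * x)" "real Q * frac (l * x) < real Q"
      using Q frac_lt_1[of "l * x"] by auto
    then have "0 \<le> f x" "f x < int Q" unfolding f_def by linarith+
    then show "x \<in> (\<Union>j\<in>{..<Q}. H j)" using x by (auto simp: H_def intro!: bexI[of _ "nat (f x)"])
  qed (auto simp: H_def)
  then have "measure lborel \<Gamma> = (\<Sum>j<Q. measure lborel (H j))"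
    using Hm Hfin by (simp only:) (rule measure_finite_Union, auto simp: disjoint_family_on_def H_def[of _])
  moreover have "\<exists>j<Q. measure lborel \<Gamma> \<le> real Q * measure lborel (H j)"
  proof (rule ccontr)
    assume "\<not> ?thesis"
    then have "\<And>j. j < Q \<Longrightarrow> real Q * measure lborel (H j) < measure lborel \<Gamma>" by (auto simp: not_le)
    then have "(\<Sum>j<Q. real Q * measure lborel (H j)) < (\<Sum>j<Q. measure lborel \<Gamma>)"
      using Q by (intro sum_strict_mono) (auto simp: lessThan_empty_iff)
    then show False using calculation Q by (simp add: sum_distrib_left[symmetric])
  qed
  then obtain j where j: "j < Q" "measure lborel \<Gamma> \<le> real Q * measure lborel (H j)" by auto
  have "dint (l * (x - y)) \<le> 1 / real Q" if "x \<in> H j" "y \<in> H j" for x y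
  proof -
    have "f x = f y" using that by (simp add: H_def)
    then have "\<bar>real Q * frac (l * x) - real Q * frac (l * y)\<bar> \<le> 1" unfolding f_def by linarith
    then have "real Q * \<bar>frac (l * x) - frac (l * y)\<bar> \<le> 1"
      by (metis abs_mult abs_of_nat right_diff_distrib)
    then have 1: "\<bar>frac (l * x) - frac (l * y)\<bar> \<le> 1 / real Q" using Q by (simp add: le_divide_eq mult.commute)
    have "dint (l * (x - y)) \<le> \<bar>l * (x - y) - of_int (\<lfloor>l * x\<rfloor> - \<lfloor>l * y\<rfloor>)\<bar>" by (rule dint_le)
    also have "\<dots> = \<bar>frac (l * x) - frac (l * y)\<bar>" by (simp add: frac_def algebra_simps)
    finally show ?thesis using 1 by linarith
  qed
  moreover have "c \<le> real Q ^ card (insert l F) * measure lborel (H j)"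
  proof -
    have "c \<le> real Q ^ card F * (real Q * measure lborel (H j))"
      using G(3) mult_left_mono[OF j(2), of "real Q ^ card F"] by simp
    then show ?thesis using insert by (simp add: mult_ac)
  qed
  ultimately show ?case using G Hm[of j] by (intro bexI[of _ "H j"]) (auto simp: H_def)
qed

text \<open>For fixed \<open>x\<close> the substitution \<open>v = t * x\<close> costs
  \<open>1 / |x| <= 1 / \<kappa>\<close> and makes the integral of \<open>g\<close> independent of
  \<open>x\<close>, so the two integrals separate. This is why frequencies near 0 have to be
  excluded.\<close>

lemma nn_integral_slopes_le:
  fixes f g :: "real \<Rightarrow> ennreal"
  assumes [measurable]: "f \<in> borel_measurable borel" "g \<in> borel_measurable borel" and \<kappa>: "0 < \<kappa>"
  shows "ennreal \<kappa> * (\<integral>\<^sup>+t. (\<integral>\<^sup>+x. f x * g (t * x) * indicator {x. \<kappa> \<le> \<bar>x\<bar> \<and> \<bar>x\<bar> \<le> 1} x \<partial>lborel) * indicator {-1..1} t \<partial>lborel)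
    \<le> (\<integral>\<^sup>+x. f x * indicator {-1..1} x \<partial>lborel) * (\<integral>\<^sup>+x. g x * indicator {-1..1} x \<partial>lborel)"
proof -
  define Ig where "Ig = (\<integral>\<^sup>+x. g x * indicator {-1..1} x \<partial>lborel)"
  define X where "X = {x::real. \<kappa> \<le> \<bar>x\<bar> \<and> \<bar>x\<bar> \<le> 1}"
  have [measurable]: "X \<in> sets borel" unfolding X_def by measurable
  have scale: "ennreal \<kappa> * (\<integral>\<^sup>+t. g (t * x) * indicator {-1..1} t \<partial>lborel) \<le> Ig" if "x \<in> X" for x
  proof -
    have x: "x \<noteq> 0" "\<kappa> \<le> \<bar>x\<bar>" "\<bar>x\<bar> \<le> 1" using that \<kappa> by (auto simp: X_def)
    have "ennreal \<kappa> * (\<integral>\<^sup>+t. g (t * x) * indicator {-1..1} t \<partial>lborel)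
       \<le> ennreal \<bar>x\<bar> * (\<integral>\<^sup>+t. g (0 + x * t) * indicator {-\<bar>x\<bar>..\<bar>x\<bar>} (0 + x * t) \<partial>lborel)"
    proof (rule mult_mono[OF ennreal_leI[OF x(2)] nn_integral_mono])
      fix t :: real
      have "\<bar>x * t\<bar> \<le> \<bar>x\<bar>" if "t \<in> {-1..1}"
        using that mult_left_mono[of "\<bar>t\<bar>" 1 "\<bar>x\<bar>"] by (auto simp: abs_mult)
      then have "0 + x * t \<in> {-\<bar>x\<bar>..\<bar>x\<bar>}" if "t \<in> {-1..1}" using that by (simp only: abs_le_iff) auto
      then show "g (t * x) * indicator {-1..1} t \<le> g (0 + x * t) * indicator {-\<bar>x\<bar>..\<bar>x\<bar>} (0 + x * t)"
        by (cases "t \<in> {-1..1}") (simp_all add: mult.commute[of t x])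
    qed simp_all
    also have "\<dots> = (\<integral>\<^sup>+v. g v * indicator {-\<bar>x\<bar>..\<bar>x\<bar>} v \<partial>lborel)"
      using nn_integral_real_affine[of "\<lambda>v. g v * indicator {-\<bar>x\<bar>..\<bar>x\<bar>} v" x 0] x by simp
    also have "\<dots> \<le> Ig" unfolding Ig_def using x by (intro nn_integral_mono) (auto simp: indicator_def)
    finally show ?thesis .
  qed
  have "(\<integral>\<^sup>+t. (\<integral>\<^sup>+x. f x * g (t * x) * indicator X x \<partial>lborel) * indicator {-1..1} t \<partial>lborel)
     = (\<integral>\<^sup>+t. (\<integral>\<^sup>+x. f x * g (t * x) * indicator X x * indicator {-1..1} t \<partial>lborel) \<partial>lborel)"
    by (intro nn_integral_cong nn_integral_multc[symmetric]) measurable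
  also have "\<dots> = (\<integral>\<^sup>+x. (\<integral>\<^sup>+t. f x * g (t * x) * indicator X x * indicator {-1..1} t \<partial>lborel) \<partial>lborel)"
    by (rule lborel_pair.Fubini') measurable
  also have "\<dots> = (\<integral>\<^sup>+x. f x * indicator X x * (\<integral>\<^sup>+t. g (t * x) * indicator {-1..1} t \<partial>lborel) \<partial>lborel)"
    by (subst nn_integral_cmult[symmetric]) (auto simp: mult_ac)
  finally have "ennreal \<kappa> * (\<integral>\<^sup>+t. (\<integral>\<^sup>+x. f x * g (t * x) * indicator X x \<partial>lborel) * indicator {-1..1} t \<partial>lborel)
    = (\<integral>\<^sup>+x. ennreal \<kappa> * (f x * indicator X x * (\<integral>\<^sup>+t. g (t * x) * indicator {-1..1} t \<partial>lborel)) \<partial>lborel)"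
    by (simp only:) (intro nn_integral_cmult[symmetric], measurable)
  also have "\<dots> \<le> (\<integral>\<^sup>+x. f x * indicator {-1..1} x * Ig \<partial>lborel)"
  proof (rule nn_integral_mono)
    fix x
    show "ennreal \<kappa> * (f x * indicator X x * (\<integral>\<^sup>+t. g (t * x) * indicator {-1..1} t \<partial>lborel)) \<le> f x * indicator {-1..1} x * Ig"
    proof (cases "x \<in> X")
      case True
      then have "x \<in> {-1..1}" by (auto simp: X_def)
      moreover have "f x * (ennreal \<kappa> * (\<integral>\<^sup>+t. g (t * x) * indicator {-1..1} t \<partial>lborel)) \<le> f x * Ig"
        by (intro mult_left_mono scale True) auto
      ultimately show ?thesis using True by (simp add: mult_ac)
    qed simp
  qed
  also have "\<dots> = (\<integral>\<^sup>+x. f x * indicator {-1..1} x \<partial>lborel) * Ig" by (intro nn_integral_multc) measurable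
  finally show ?thesis by (simp add: Ig_def X_def)
qed

section \<open>Neighbourhoods of zeros and shells of frequencies\<close>

definition near_set :: "nat \<Rightarrow> real set \<Rightarrow> nat \<Rightarrow> real \<Rightarrow> real set" where
  "near_set K Z m \<eta> = {x. \<exists>k<m. \<exists>z\<in>Z. dint (real K ^ k * x - z) < \<eta>}"

text \<open>The inner radius is where the first \<open>m\<close> factors are still free of
  cancellation by \<open>norm_expsum_ge\<close>. The strict inner inequality makes the copies scaled
  by powers of \<open>K ^ m\<close> disjoint.\<close>

definition shell :: "nat \<Rightarrow> nat \<Rightarrow> real set" where
  "shell K m = {x. 1 / 32 / real K ^ m < \<bar>x\<bar> \<and> \<bar>x\<bar> \<le> 1 / 32}"

lemma shell_borel [measurable, simp]: "shell K m \<in> sets borel"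
  unfolding shell_def by measurable

lemma near_set_borel [measurable, simp]:
  assumes "finite Z"
  shows "near_set K Z m \<eta> \<in> sets borel"
proof -
  have "near_set K Z m \<eta> = (\<Union>k\<in>{..<m}. \<Union>z\<in>Z. {x. dint (real K ^ k * x - z) < \<eta>})"
    by (auto simp: near_set_def)
  moreover have "{x. dint (real K ^ k * x - z) < \<eta>} \<in> sets borel" for k z
  proof -
    have "{x. dint (real K ^ k * x - z) < \<eta>} = (\<Union>j::int. {x. \<bar>real K ^ k * x - z - of_int j\<bar> < \<eta>})"
      using dint_le by (auto simp: dint_def intro: le_less_trans)
    moreover have "{x. \<bar>real K ^ k * x - z - of_int j\<bar> < \<eta>} \<in> sets borel" for j :: int by measurable
    ultimately show ?thesis by (simp only:) (intro sets.countable_UN, auto)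
  qed
  ultimately show ?thesis using assms by (simp only:) (intro sets.finite_UN, auto)
qed

lemma sum_power_le: "K \<ge> 2 \<Longrightarrow> (\<Sum>k<m. real K ^ k) \<le> real K ^ m"
proof (induction m)
  case (Suc m)
  have "2 * real K ^ m \<le> real K * real K ^ m" using Suc by (intro mult_right_mono) auto
  then show ?case unfolding sum.lessThan_Suc power_Suc using Suc.IH[OF Suc.prems] by linarith
qed simp

text \<open>The set is covered by about \<open>K\<^sup>m\<close> intervals, on each of which the first \<open>p\<close> factors are bounded
  trivially and the others are integrated over a full period. Compared with the integral over
  \<open>[-1,1]\<close>, of order \<open>|A|\<^bsup>p+n\<^esup>\<close>, this gains \<open>(|A|/K)\<^sup>p\<close>.\<close>

lemma nn_integral_near_set:
  fixes Z :: "real set"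
  assumes A: "A \<subseteq> {0..<K}" and K: "K \<ge> 2" and Z: "finite Z" "\<And>z. z \<in> Z \<Longrightarrow> \<bar>z\<bar> \<le> 1"
    and \<eta>: "\<eta> = 1 / (2 * real K ^ (m + p))"
  shows "(\<integral>\<^sup>+x. ennreal ((norm (expsum K A real (p + n) (real K ^ m * x)))\<^sup>2) * indicator (near_set K Z m \<eta>) x * indicator {-1..1} x \<partial>lborel)
    \<le> ennreal (7 * real (card Z) * real (card A) ^ (2 * p + n) / real K ^ p)"
proof -
  have fA: "finite A" using A finite_subset by blast
  have Km: "real K ^ k > 0" for k using K by simp
  have \<eta>0: "\<eta> > 0" using K by (simp add: \<eta>)
  define g where "g x = ennreal ((norm (expsum K A real n (real K ^ (m + p) * x)))\<^sup>2)" for x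
  have [measurable]: "g \<in> borel_measurable borel" unfolding g_def by measurable
  define a where "a k z j = (z + of_int j - \<eta>) / real K ^ k" for k z and j :: int
  define R where "R k = {- int (K ^ k + 2)..int (K ^ k + 2)}" for k
  \<comment> \<open>A neighbourhood of radius \<open>\<eta> / K ^ k\<close> has length at most
    \<open>2 * \<eta> = 1 / K ^ (m + p)\<close>, so it fits into one period of the last
    \<open>n\<close> factors; this fixes the choice of \<open>\<eta>\<close>.\<close>
  define Y where "Y k z j = {a k z j..a k z j + 1 / real K ^ (m + p)}" for k z j
  define cA where "cA = ennreal (real (card A) ^ (2 * p))"
  have pw: "ennreal ((norm (expsum K A real (p + n) (real K ^ m * x)))\<^sup>2) * indicator (near_set K Z m \<eta>) x * indicator {-1..1} x
    \<le> (\<Sum>k<m. \<Sum>z\<in>Z. \<Sum>j\<in>R k. cA * (g x * indicator (Y k z j) x))" for x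
  proof (cases "x \<in> near_set K Z m \<eta> \<and> x \<in> {-1..1}")
    case True
    then obtain k z where k: "k < m" "z \<in> Z" "dint (real K ^ k * x - z) < \<eta>" and x: "\<bar>x\<bar> \<le> 1"
      by (auto simp: near_set_def abs_le_iff)
    define j where "j = round (real K ^ k * x - z)"
    have j: "\<bar>real K ^ k * x - z - of_int j\<bar> < \<eta>" using k(3) by (simp add: dint_def j_def)
    have "\<eta> \<le> 1" using K by (simp add: \<eta> divide_le_eq) (metis add.commute le_add_same_cancel2 mult_2 one_le_power of_nat_le_iff of_nat_1 order_trans one_le_numeral zero_le_one)
    have "\<bar>real K ^ k * x\<bar> \<le> real K ^ k" using x by (simp add: abs_mult mult_left_le)
    then have "\<bar>real_of_int j\<bar> \<le> real K ^ k + 2" using j \<open>\<eta> \<le> 1\<close> Z(2)[OF k(2)] by linarith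
    then have "\<bar>real_of_int j\<bar> \<le> real_of_int (int (K ^ k + 2))" by simp
    then have jR: "j \<in> R k" unfolding R_def by (simp only: atLeastAtMost_iff) linarith
    have xY: "x \<in> Y k z j"
    proof -
      have lo: "a k z j \<le> x"
        using j Km[of k] by (simp add: a_def divide_le_eq mult.commute)
      have "x \<le> (z + of_int j + \<eta>) / real K ^ k"
        using j Km[of k] by (simp add: le_divide_eq mult.commute)
      also have "\<dots> = a k z j + 2 * \<eta> / real K ^ k" by (simp add: a_def diff_divide_distrib add_divide_distrib)
      also have "2 * \<eta> / real K ^ k \<le> 2 * \<eta> / 1"
        using \<eta>0 K by (intro divide_left_mono) (auto intro: one_le_power)
      finally show ?thesis using lo by (simp add: Y_def \<eta>)
    qed
    have "norm (expsum K A real (p + n) (real K ^ m * x)) \<le> real (card A) ^ p * norm (expsum K A real n (real K ^ (m + p) * x))"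
      unfolding expsum_add norm_mult using norm_expsum_le[OF fA, of K real p "real K ^ m * x"]
      by (simp add: power_add mult_ac mult_right_mono)
    then have "(norm (expsum K A real (p + n) (real K ^ m * x)))\<^sup>2 \<le> (real (card A) ^ p * norm (expsum K A real n (real K ^ (m + p) * x)))\<^sup>2"
      by (intro power_mono) auto
    also have "\<dots> = real (card A) ^ (2 * p) * (norm (expsum K A real n (real K ^ (m + p) * x)))\<^sup>2"
      by (simp add: power_mult_distrib power_mult[symmetric] mult.commute)
    finally have "ennreal ((norm (expsum K A real (p + n) (real K ^ m * x)))\<^sup>2) \<le> cA * g x"
      unfolding cA_def g_def by (subst ennreal_mult[symmetric]) (auto intro: ennreal_leI)
    also have "\<dots> = cA * (g x * indicator (Y k z j) x)" using xY by simp
    also have "\<dots> \<le> (\<Sum>j\<in>R k. cA * (g x * indicator (Y k z j) x))"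
      using jR by (intro member_le_sum) (auto simp: R_def)
    also have "\<dots> \<le> (\<Sum>z\<in>Z. \<Sum>j\<in>R k. cA * (g x * indicator (Y k z j) x))"
      using k Z by (intro member_le_sum[where f = "\<lambda>z. \<Sum>j\<in>R k. cA * (g x * indicator (Y k z j) x)"]) auto
    also have "\<dots> \<le> (\<Sum>k<m. \<Sum>z\<in>Z. \<Sum>j\<in>R k. cA * (g x * indicator (Y k z j) x))"
      using k by (intro member_le_sum[where f = "\<lambda>k. \<Sum>z\<in>Z. \<Sum>j\<in>R k. cA * (g x * indicator (Y k z j) x)"]) auto
    finally show ?thesis using True by simp
  qed auto
  have "(\<integral>\<^sup>+x. ennreal ((norm (expsum K A real (p + n) (real K ^ m * x)))\<^sup>2) * indicator (near_set K Z m \<eta>) x * indicator {-1..1} x \<partial>lborel)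
    \<le> (\<integral>\<^sup>+x. (\<Sum>k<m. \<Sum>z\<in>Z. \<Sum>j\<in>R k. cA * (g x * indicator (Y k z j) x)) \<partial>lborel)"
    by (intro nn_integral_mono pw)
  also have "\<dots> = (\<Sum>k<m. \<Sum>z\<in>Z. \<Sum>j\<in>R k. cA * (\<integral>\<^sup>+x. g x * indicator (Y k z j) x \<partial>lborel))"
    by (simp add: nn_integral_sum nn_integral_cmult Y_def)
  also have "\<dots> = (\<Sum>k<m. \<Sum>z\<in>Z. \<Sum>j\<in>R k. cA * ennreal (real (card A) ^ n / real K ^ (m + p)))"
    unfolding g_def Y_def using A K by (intro sum.cong refl arg_cong2[where f = "(*)"] nn_integral_expsum_period) auto
  also have "\<dots> = ennreal (\<Sum>k<m. \<Sum>z\<in>Z. \<Sum>j\<in>R k. real (card A) ^ (2 * p) * (real (card A) ^ n / real K ^ (m + p)))"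
    unfolding cA_def by (simp add: ennreal_mult'[symmetric] sum_ennreal sum_nonneg del: sum_constant)
  also have "\<dots> \<le> ennreal (7 * real (card Z) * real (card A) ^ (2 * p + n) / real K ^ p)"
  proof (rule ennreal_leI)
    define b where "b = real (card A) ^ (2 * p) * (real (card A) ^ n / real K ^ (m + p))"
    have b0: "b \<ge> 0" by (simp add: b_def)
    have cR: "real (card (R k)) \<le> 7 * real K ^ k" for k
    proof -
      have "real (card (R k)) = 2 * real K ^ k + 5" by (simp add: R_def of_nat_nat)
      moreover have "1 \<le> real K ^ k" using K by (intro one_le_power) auto
      ultimately show ?thesis by linarith
    qed
    have "(\<Sum>k<m. \<Sum>z\<in>Z. \<Sum>j\<in>R k. b) = (\<Sum>k<m. real (card Z) * b * real (card (R k)))" by (simp add: mult_ac)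
    also have "\<dots> \<le> (\<Sum>k<m. real (card Z) * b * (7 * real K ^ k))"
      using b0 by (intro sum_mono mult_left_mono cR) auto
    also have "\<dots> = 7 * real (card Z) * b * (\<Sum>k<m. real K ^ k)" by (simp add: sum_distrib_left mult_ac)
    also have "\<dots> \<le> 7 * real (card Z) * b * real K ^ m"
      using b0 sum_power_le[OF K] by (intro mult_left_mono) auto
    also have "\<dots> = 7 * real (card Z) * real (card A) ^ (2 * p + n) / real K ^ p"
      using K by (simp add: b_def power_add)
    finally show "(\<Sum>k<m. \<Sum>z\<in>Z. \<Sum>j\<in>R k. real (card A) ^ (2 * p) * (real (card A) ^ n / real K ^ (m + p)))
       \<le> 7 * real (card Z) * real (card A) ^ (2 * p + n) / real K ^ p" by (simp only: b_def)
  qed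
  finally show ?thesis .
qed

section \<open>Bounds for shell integrals from above and below\<close>

context digits
begin

abbreviation "T n x \<equiv> ennreal ((norm (expsum K D v n x))\<^sup>2)"

lemma scale_integral:
  fixes f :: "real \<Rightarrow> ennreal"
  assumes [measurable]: "f \<in> borel_measurable borel" and c: "c > 0"
  shows "(\<integral>\<^sup>+x. f (c * x) \<partial>lborel) = ennreal (1 / c) * (\<integral>\<^sup>+x. f x \<partial>lborel)"
proof -
  have "(\<integral>\<^sup>+x. f x \<partial>lborel) = ennreal c * (\<integral>\<^sup>+x. f (c * x) \<partial>lborel)"
    using nn_integral_real_affine[of f c 0] c by simp
  then have "ennreal (1 / c) * (\<integral>\<^sup>+x. f x \<partial>lborel) = (ennreal (1 / c) * ennreal c) * (\<integral>\<^sup>+x. f (c * x) \<partial>lborel)"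
    by (simp add: mult.assoc)
  also have "ennreal (1 / c) * ennreal c = 1" using c by (simp add: ennreal_mult'[symmetric])
  finally show ?thesis by simp
qed

text \<open>Scaled by \<open>K ^ (j * m)\<close> downwards, the shells are disjoint and share one
  integral of \<open>T N\<close>. On the \<open>j\<close>-th copy the first \<open>j * m\<close>
  factors are at least half of \<open>K ^ (j * m)\<close>. Their square gives two powers of
  \<open>K ^ (j * m)\<close>; the change of variables takes one, the other is the weight. The
  constant is \<open>320 = 4 * 80\<close>.\<close>

lemma shell_sum_le:
  assumes m: "m \<ge> 1" and J: "J * m \<le> N"
  shows "(\<Sum>j<J. ennreal (real K ^ (j * m)) * (\<integral>\<^sup>+x. T (N - j * m) x * indicator (shell K m) x \<partial>lborel))
    \<le> ennreal (320 * real (En N))"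
proof -
  define Y where "Y j = {x. real K ^ (j * m) * x \<in> shell K m}" for j
  have Km: "real K ^ k > 0" for k using K_ge by simp
  have Ym [measurable]: "Y j \<in> sets borel" for j
  proof -
    have "(\<lambda>x. real K ^ (j * m) * x) -` shell K m \<inter> space borel \<in> sets borel"
      by (rule measurable_sets[of _ _ borel]) measurable
    then show ?thesis by (simp add: Y_def vimage_def)
  qed
  have Yeq: "x \<in> Y j \<longleftrightarrow> 1 / 32 / real K ^ (Suc j * m) < \<bar>x\<bar> \<and> \<bar>x\<bar> \<le> 1 / 32 / real K ^ (j * m)" for x j
    using Km[of "j * m"] Km[of m] by (auto simp: Y_def shell_def abs_mult field_simps power_add)
  have disj: "x \<notin> Y j'" if "x \<in> Y j" "j < j'" for x j j'
  proof
    assume "x \<in> Y j'"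
    then have "\<bar>x\<bar> \<le> 1 / 32 / real K ^ (j' * m)" by (simp add: Yeq)
    also have "\<dots> \<le> 1 / 32 / real K ^ (Suc j * m)"
      using that(2) K_ge by (intro divide_left_mono power_increasing mult_right_mono) auto
    finally show False using that(1) by (simp add: Yeq)
  qed
  have pw: "(\<Sum>j<J. T N x * indicator (Y j) x) \<le> T N x * indicator {-1/2..1/2} x" for x
  proof (cases "\<exists>j<J. x \<in> Y j")
    case True
    then obtain j where j: "j < J" "x \<in> Y j" by auto
    then have "x \<notin> Y i" if "i \<noteq> j" for i using disj that by (meson nat_neq_iff)
    then have "(\<Sum>i<J. T N x * indicator (Y i) x) = (\<Sum>i<J. if i = j then T N x else 0)"
      using j by (intro sum.cong refl) auto
    also have "\<dots> = T N x" using j by simp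
    finally have sumT: "(\<Sum>i<J. T N x * indicator (Y i) x) = T N x" .
    have "x \<in> {-1/2..1/2}"
    proof -
      have "1 \<le> real K ^ (j * m)" using K_ge by (intro one_le_power) auto
      then have "1 / 32 / real K ^ (j * m) \<le> 1 / 32" by (simp add: divide_le_eq)
      moreover have "\<bar>x\<bar> \<le> 1 / 32 / real K ^ (j * m)" using j(2) by (simp add: Yeq)
      ultimately show ?thesis unfolding atLeastAtMost_iff by linarith
    qed
    then show ?thesis unfolding sumT by simp
  next
    case False
    then have "(\<Sum>i<J. T N x * indicator (Y i) x) = 0" by (intro sum.neutral) auto
    then show ?thesis by (simp only: zero_le)
  qed
  have term_le: "ennreal (real K ^ (j * m)) * (\<integral>\<^sup>+x. T (N - j * m) x * indicator (shell K m) x \<partial>lborel)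
    \<le> 4 * (\<integral>\<^sup>+x. T N x * indicator (Y j) x \<partial>lborel)" if "j < J" for j
  proof -
    define q where "q = real K ^ (j * m)"
    have q: "q > 0" using Km by (simp add: q_def)
    have jm: "j * m \<le> N" using that J by (meson less_imp_le_nat mult_le_mono1 order_trans)
    define I where "I = (\<integral>\<^sup>+x. T (N - j * m) x * indicator (shell K m) x \<partial>lborel)"
    have "ennreal q * I = ennreal (q\<^sup>2) * (ennreal (1 / q) * I)"
      using q by (simp add: mult.assoc[symmetric] ennreal_mult'[symmetric] power2_eq_square)
    also have "ennreal (1 / q) * I = (\<integral>\<^sup>+x. T (N - j * m) (q * x) * indicator (shell K m) (q * x) \<partial>lborel)"
      unfolding I_def using q by (intro scale_integral[symmetric]) measurable
    also have "ennreal (q\<^sup>2) * \<dots> = (\<integral>\<^sup>+x. ennreal (q\<^sup>2) * (T (N - j * m) (q * x) * indicator (shell K m) (q * x)) \<partial>lborel)"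
      by (intro nn_integral_cmult[symmetric]) measurable
    also have "\<dots> \<le> (\<integral>\<^sup>+x. 4 * (T N x * indicator (Y j) x) \<partial>lborel)"
    proof (rule nn_integral_mono)
      fix x
      show "ennreal (q\<^sup>2) * (T (N - j * m) (q * x) * indicator (shell K m) (q * x)) \<le> 4 * (T N x * indicator (Y j) x)"
      proof (cases "x \<in> Y j")
        case True
        then have "q * \<bar>x\<bar> \<le> 1 / 32" using q unfolding Yeq q_def[symmetric] by (simp add: field_simps)
        then have "q / 2 \<le> norm (expsum K D v (j * m) x)"
          unfolding q_def using card_D v_le K_ge by (intro norm_expsum_ge) auto
        then have "(q / 2) * norm (expsum K D v (N - j * m) (q * x)) \<le> norm (expsum K D v (j * m) x) * norm (expsum K D v (N - j * m) (q * x))"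
          by (intro mult_right_mono) auto
        also have "\<dots> = norm (expsum K D v N x)"
          using expsum_add[of K D v "j * m" "N - j * m" x] jm by (simp add: norm_mult q_def)
        finally have "((q / 2) * norm (expsum K D v (N - j * m) (q * x)))\<^sup>2 \<le> (norm (expsum K D v N x))\<^sup>2"
          using q by (intro power_mono) auto
        then have "q\<^sup>2 * (norm (expsum K D v (N - j * m) (q * x)))\<^sup>2 \<le> 4 * (norm (expsum K D v N x))\<^sup>2"
          by (simp add: power_mult_distrib power_divide)
        then have "ennreal (q\<^sup>2 * (norm (expsum K D v (N - j * m) (q * x)))\<^sup>2) \<le> ennreal (4 * (norm (expsum K D v N x))\<^sup>2)"
          by (rule ennreal_leI)
        then show ?thesis using True by (simp add: ennreal_mult Y_def q_def)
      qed (auto simp: Y_def q_def)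
    qed
    also have "\<dots> = 4 * (\<integral>\<^sup>+x. T N x * indicator (Y j) x \<partial>lborel)" by (intro nn_integral_cmult) measurable
    finally show ?thesis by (simp add: I_def q_def)
  qed
  have "(\<Sum>j<J. ennreal (real K ^ (j * m)) * (\<integral>\<^sup>+x. T (N - j * m) x * indicator (shell K m) x \<partial>lborel))
     \<le> (\<Sum>j<J. 4 * (\<integral>\<^sup>+x. T N x * indicator (Y j) x \<partial>lborel))" by (intro sum_mono term_le) auto
  also have "\<dots> = 4 * (\<integral>\<^sup>+x. (\<Sum>j<J. T N x * indicator (Y j) x) \<partial>lborel)"
    by (subst nn_integral_sum) (auto simp: sum_distrib_left)
  also have "\<dots> \<le> 4 * (\<integral>\<^sup>+x. T N x * indicator {-1/2..1/2} x \<partial>lborel)"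
    by (intro mult_left_mono nn_integral_mono pw) auto
  also have "\<dots> \<le> 4 * ennreal (80 * real (En N))"
    by (intro mult_left_mono nn_integral_norm_expsum_le) auto
  also have "\<dots> = ennreal (320 * real (En N))" by (subst ennreal_numeral[symmetric], subst ennreal_mult'[symmetric]) auto
  finally show ?thesis .
qed

text \<open>Positive definiteness is applied to the \<open>r\<close> high factors on
  \<open>\<Gamma>\<close>, and the differences \<open>u\<close> are split. Near 0, rescaling leads
  to the energy bound; on \<open>S\<close> nothing is done; on the rest of the shell
  \<open>large\<close> inserts the missing \<open>m\<close> low factors at the price
  \<open>\<Lambda>\<close>.\<close>

lemma large_set_lower_bound:
  assumes G [measurable]: "\<Gamma> \<in> sets borel" and G01: "\<Gamma> \<subseteq> {0..1/32}" and S [measurable]: "S \<in> sets borel"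
    and \<Lambda>: "\<Lambda> \<ge> 0"
    and large: "\<And>x y. x \<in> \<Gamma> \<Longrightarrow> y \<in> \<Gamma> \<Longrightarrow> x - y \<notin> S \<Longrightarrow> 1 \<le> \<Lambda> * (norm (expsum K D v m (x - y)))\<^sup>2"
  shows "ennreal (real K ^ r * measure lborel \<Gamma>) \<le> ennreal (80 * real (En r) / real K ^ m)
    + (\<integral>\<^sup>+x. T r (real K ^ m * x) * indicator S x * indicator (shell K m) x \<partial>lborel)
    + ennreal \<Lambda> * (\<integral>\<^sup>+x. T (m + r) x * indicator (shell K m) x \<partial>lborel)"
proof (cases "measure lborel \<Gamma> = 0")
  case False
  have Km: "real K ^ k > 0" for k using K_ge by simp
  define g where "g = measure lborel \<Gamma>"
  have efin: "emeasure lborel \<Gamma> < \<infinity>"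
  proof -
    have "emeasure lborel \<Gamma> \<le> emeasure lborel {0..1/32::real}" using G01 by (intro emeasure_mono) auto
    also have "\<dots> < \<infinity>" by simp
    finally show ?thesis .
  qed
  have eg: "emeasure lborel \<Gamma> = ennreal g" unfolding g_def using efin by (intro emeasure_eq_ennreal_measure) auto
  have g0: "g > 0" using False unfolding g_def by (simp add: less_le)
  define F where "F x = T r (real K ^ m * x) * indicator {x. real K ^ m * x \<in> {-1/2..1/2}} x
     + T r (real K ^ m * x) * indicator S x * indicator (shell K m) x
     + ennreal \<Lambda> * (T (m + r) x * indicator (shell K m) x)" for x
  have Fm [measurable]: "F \<in> borel_measurable borel" unfolding F_def by measurable
  have le_F: "T r (real K ^ m * (x - y)) \<le> F (x - y)" if x: "x \<in> \<Gamma>" and y: "y \<in> \<Gamma>" for x y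
  proof -
    define u where "u = x - y"
    have "x \<in> {0..1/32}" "y \<in> {0..1/32}" using x y G01 by blast+
    then have u32: "\<bar>u\<bar> \<le> 1 / 32" unfolding u_def abs_le_iff by auto
    show ?thesis
    proof (cases "u \<in> shell K m")
      case False
      then have "\<bar>u\<bar> \<le> 1 / 32 / real K ^ m" using u32 by (auto simp: shell_def)
      then have "\<bar>real K ^ m * u\<bar> \<le> 1 / 32" using Km[of m] by (simp add: abs_mult field_simps)
      then have "real K ^ m * u \<in> {-1/2..1/2}" by (auto simp: abs_le_iff)
      then show ?thesis unfolding F_def u_def[symmetric] by simp
    next
      case True
      show ?thesis
      proof (cases "u \<in> S")
        case True
        then show ?thesis using \<open>u \<in> shell K m\<close> unfolding F_def u_def[symmetric] by (simp add: add_increasing)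
      next
        case False
        then have "1 \<le> \<Lambda> * (norm (expsum K D v m u))\<^sup>2" using large[OF x y] by (simp add: u_def)
        then have "1 * (norm (expsum K D v r (real K ^ m * u)))\<^sup>2
          \<le> (\<Lambda> * (norm (expsum K D v m u))\<^sup>2) * (norm (expsum K D v r (real K ^ m * u)))\<^sup>2"
          by (intro mult_right_mono) auto
        also have "\<dots> = \<Lambda> * (norm (expsum K D v (m + r) u))\<^sup>2"
          by (simp add: expsum_add norm_mult power_mult_distrib)
        finally have "T r (real K ^ m * u) \<le> ennreal \<Lambda> * T (m + r) u"
          using \<Lambda> by (subst ennreal_mult[symmetric]) (auto intro: ennreal_leI)
        then show ?thesis using \<open>u \<in> shell K m\<close> unfolding F_def u_def[symmetric]
          by (simp add: add_increasing)
      qed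
    qed
  qed
  have "ennreal (real (card (words D r)) * g\<^sup>2) = ennreal (real (card (words D r)) * (measure (restrict_space lborel \<Gamma>) (space (restrict_space lborel \<Gamma>)))\<^sup>2)"
    by (simp add: g_def measure_restrict_space space_restrict_space)
  also have "\<dots> \<le> (\<integral>\<^sup>+y. \<integral>\<^sup>+x. ennreal ((norm (\<Sum>w\<in>words D r. cis (2 * pi * ((sig K v w * real K ^ m) * (x - y)))))\<^sup>2)
       \<partial>restrict_space lborel \<Gamma> \<partial>restrict_space lborel \<Gamma>)"
    by (rule nn_integral_diff_norm_sum_cis_ge[where \<Gamma> = \<Gamma>])
       (use efin in \<open>auto simp: space_restrict_space intro!: finite_measureI simp: emeasure_restrict_space\<close>)
  also have "\<dots> = (\<integral>\<^sup>+y. (\<integral>\<^sup>+x. T r (real K ^ m * (x - y)) * indicator \<Gamma> x \<partial>lborel) * indicator \<Gamma> y \<partial>lborel)"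
    by (simp add: nn_integral_restrict_space expsum_def mult.assoc)
  also have "\<dots> \<le> (\<integral>\<^sup>+y. (\<integral>\<^sup>+x. F (x - y) * indicator \<Gamma> x \<partial>lborel) * indicator \<Gamma> y \<partial>lborel)"
  proof (rule nn_integral_mono)
    fix y
    show "(\<integral>\<^sup>+x. T r (real K ^ m * (x - y)) * indicator \<Gamma> x \<partial>lborel) * indicator \<Gamma> y
      \<le> (\<integral>\<^sup>+x. F (x - y) * indicator \<Gamma> x \<partial>lborel) * indicator \<Gamma> y"
    proof (cases "y \<in> \<Gamma>")
      case True
      then have "T r (real K ^ m * (x - y)) * indicator \<Gamma> x \<le> F (x - y) * indicator \<Gamma> x" for x
        using le_F[of x y] by (cases "x \<in> \<Gamma>") auto
      then show ?thesis by (intro mult_right_mono[OF nn_integral_mono]) auto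
    qed simp
  qed
  also have "\<dots> \<le> emeasure lborel \<Gamma> * (\<integral>\<^sup>+u. F u * indicator {-(1/32)..1/32} u \<partial>lborel)"
    by (rule nn_integral_diff_le[OF Fm G G01])
  also have "\<dots> \<le> ennreal g * (\<integral>\<^sup>+u. F u \<partial>lborel)"
    unfolding eg by (intro mult_left_mono nn_integral_mono) (auto simp: indicator_def)
  finally have main: "ennreal (real (card (words D r)) * g\<^sup>2) \<le> ennreal g * (\<integral>\<^sup>+u. F u \<partial>lborel)" .
  have "ennreal (real K ^ r * g) = ennreal (1 / g) * ennreal (real (card (words D r)) * g\<^sup>2)"
    using g0 by (subst ennreal_mult'[symmetric]) (auto simp: card_words card_D power2_eq_square)
  also have "\<dots> \<le> ennreal (1 / g) * (ennreal g * (\<integral>\<^sup>+u. F u \<partial>lborel))"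
    by (intro mult_left_mono main) auto
  also have "\<dots> = (\<integral>\<^sup>+u. F u \<partial>lborel)"
    using g0 by (simp add: mult.assoc[symmetric] ennreal_mult'[symmetric])
  also have "\<dots> = (\<integral>\<^sup>+x. T r (real K ^ m * x) * indicator {x. real K ^ m * x \<in> {-1/2..1/2}} x \<partial>lborel)
     + (\<integral>\<^sup>+x. T r (real K ^ m * x) * indicator S x * indicator (shell K m) x \<partial>lborel)
     + ennreal \<Lambda> * (\<integral>\<^sup>+x. T (m + r) x * indicator (shell K m) x \<partial>lborel)"
    unfolding F_def by (simp add: nn_integral_add nn_integral_cmult)
  also have "(\<integral>\<^sup>+x. T r (real K ^ m * x) * indicator {x. real K ^ m * x \<in> {-1/2..1/2}} x \<partial>lborel)
     = (\<integral>\<^sup>+x. T r (real K ^ m * x) * indicator {-1/2..1/2} (real K ^ m * x) \<partial>lborel)"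
    by (intro nn_integral_cong) (auto simp: indicator_def)
  also have "\<dots> = ennreal (1 / real K ^ m) * (\<integral>\<^sup>+x. T r x * indicator {-1/2..1/2} x \<partial>lborel)"
    by (rule scale_integral[of "\<lambda>x. T r x * indicator {-1/2..1/2} x"]) (use Km in auto)
  also have "\<dots> \<le> ennreal (1 / real K ^ m) * ennreal (80 * real (En r))"
    by (intro mult_left_mono nn_integral_norm_expsum_le) auto
  also have "\<dots> = ennreal (80 * real (En r) / real K ^ m)" by (subst ennreal_mult'[symmetric]) auto
  finally show ?thesis by (simp add: g_def add_right_mono)
qed simp

end

section \<open>Slopes with small energy\<close>

abbreviation slope_val :: "real \<Rightarrow> nat \<times> nat \<Rightarrow> real" where
  "slope_val t \<equiv> \<lambda>(a, b). real a + t * real b"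

locale product_digits =
  fixes K :: nat and A B :: "nat set"
  assumes A_sub: "A \<subseteq> {0..<K}" and B_sub: "B \<subseteq> {0..<K}" and card_AB: "card A * card B = K"
    and card_A: "card A > 1" and card_B: "card B > 1"
begin

lemma K4: "K \<ge> 4"
  using mult_le_mono[of 2 "card A" 2 "card B"] card_A card_B card_AB by simp

lemma K2: "K \<ge> 2" and K1: "K \<ge> 1" and K_real: "real K > 0"
  using K4 by auto

lemma fin [simp]: "finite A" "finite B"
  using A_sub B_sub finite_subset by blast+

text \<open>Both digit sets have at least two elements. The ratio \<open>1 / 2\<close> becomes the
  gain \<open>2 ^ p\<close> in \<open>slopes_near_set\<close>.\<close>

lemma card_half: "2 * card A \<le> K" "2 * card B \<le> K"
  using mult_le_mono[of 2 "card B" "card A" "card A"] mult_le_mono[of 2 "card A" "card B" "card B"]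
    card_A card_B card_AB by (auto simp: mult.commute)

lemma digits_slope:
  assumes "t \<in> {-1..1}"
  shows "digits K (A \<times> B) (slope_val t)"
proof
  fix d assume "d \<in> A \<times> B"
  then obtain a b where d: "d = (a, b)" "a \<in> A" "b \<in> B" by auto
  have ab: "real a \<le> real K - 1" "real b \<le> real K - 1" using d A_sub B_sub by auto
  have "\<bar>t * real b\<bar> \<le> 1 * real b" unfolding abs_mult using assms by (intro mult_mono) auto
  then have "\<bar>real a + t * real b\<bar> \<le> real a + real b" by linarith
  then show "\<bar>slope_val t d\<bar> \<le> 2 * (real K - 1)" using ab d by simp
qed (use card_AB K2 in \<open>auto simp: card_cartesian_product\<close>)

lemma expsum_slope:
  "expsum K (A \<times> B) (slope_val t) n (real K ^ m * x) = expsum K A real n (real K ^ m * x) * expsum K B real n (real K ^ m * (t * x))"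
  unfolding expsum_Times by (simp add: mult_ac)

text \<open>If \<open>x\<close> is near a zero, only the \<open>A\<close> factor has to be small
  there; if \<open>t * x\<close> is, only the \<open>B\<close> factor. Averaging over
  \<open>t\<close> reduces each case to \<open>nn_integral_near_set\<close> for one digit set and a
  trivial bound for the other. The constant is \<open>672 = 32 * 7 * 3\<close>, with
  \<open>32 * K ^ m\<close> from the inner radius of the shell.\<close>

lemma slopes_near_set:
  assumes Z: "finite Z" "\<And>z. z \<in> Z \<Longrightarrow> \<bar>z\<bar> \<le> 1" and Y: "finite Y" "\<And>z. z \<in> Y \<Longrightarrow> \<bar>z\<bar> \<le> 1"
    and \<eta>: "\<eta> = 1 / (2 * real K ^ (m + p))"
  shows "(\<integral>\<^sup>+t. (\<integral>\<^sup>+x. ennreal ((norm (expsum K (A \<times> B) (slope_val t) (p + n) (real K ^ m * x)))\<^sup>2)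
      * indicator {x. x \<in> near_set K Z m \<eta> \<or> t * x \<in> near_set K Y m \<eta>} x * indicator (shell K m) x \<partial>lborel) * indicator {-1..1} t \<partial>lborel)
    \<le> ennreal (672 * real (card Z + card Y) * real K ^ m * real K ^ (p + n) / 2 ^ p)"
proof -
  define \<kappa> where "\<kappa> = 1 / 32 / real K ^ m"
  have \<kappa>: "\<kappa> > 0" using K_real by (simp add: \<kappa>_def)
  define f where "f x = ennreal ((norm (expsum K A real (p + n) (real K ^ m * x)))\<^sup>2)" for x
  define g where "g x = ennreal ((norm (expsum K B real (p + n) (real K ^ m * x)))\<^sup>2)" for x
  define f' where "f' x = f x * indicator (near_set K Z m \<eta>) x" for x
  define g' where "g' x = g x * indicator (near_set K Y m \<eta>) x" for x
  have [measurable]: "f \<in> borel_measurable borel" "g \<in> borel_measurable borel" unfolding f_def g_def by measurable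
  have [measurable]: "near_set K Z m \<eta> \<in> sets borel" "near_set K Y m \<eta> \<in> sets borel" using Z Y by auto
  have [measurable]: "f' \<in> borel_measurable borel" "g' \<in> borel_measurable borel" unfolding f'_def g'_def by measurable
  define X where "X = {x::real. \<kappa> \<le> \<bar>x\<bar> \<and> \<bar>x\<bar> \<le> 1}"
  have [measurable]: "X \<in> sets borel" unfolding X_def by measurable
  have shellX: "shell K m \<subseteq> X" by (auto simp: shell_def X_def \<kappa>_def)
  have T: "ennreal ((norm (expsum K (A \<times> B) (slope_val t) (p + n) (real K ^ m * x)))\<^sup>2) = f x * g (t * x)" for t x
    unfolding expsum_slope f_def g_def norm_mult by (simp add: ennreal_mult power_mult_distrib)
  have bound: "real (card D) ^ (2 * p + n) / real K ^ p * real (card D') ^ (p + n) \<le> real K ^ (p + n) / 2 ^ p"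
    if D: "card D * card D' = K" "2 * card D \<le> K" for D D' :: "nat set"
  proof -
    have "real (card D) ^ (2 * p + n) * real (card D') ^ (p + n) = real (card D) ^ p * (real (card D) * real (card D')) ^ (p + n)"
    proof -
      have e: "2 * p + n = p + (p + n)" by simp
      show ?thesis unfolding e power_mult_distrib power_add by (simp only: mult_ac)
    qed
    also have "real (card D) * real (card D') = real K" using D(1) by (metis of_nat_mult)
    finally have "real (card D) ^ (2 * p + n) / real K ^ p * real (card D') ^ (p + n) = real (card D) ^ p / real K ^ p * real K ^ (p + n)"
      by simp
    also have "\<dots> = (real (card D) / real K) ^ p * real K ^ (p + n)" by (simp add: power_divide)
    also have "\<dots> \<le> (1 / 2) ^ p * real K ^ (p + n)"
    proof (intro mult_right_mono power_mono)
      have "real (2 * card D) \<le> real K" using D(2) by (simp only: of_nat_le_iff)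
      then show "real (card D) / real K \<le> 1 / 2" using K_real by (simp add: divide_le_eq)
    qed auto
    finally show ?thesis by (simp add: power_divide)
  qed
  define I1 where "I1 = (\<integral>\<^sup>+t. (\<integral>\<^sup>+x. f' x * g (t * x) * indicator X x \<partial>lborel) * indicator {-1..1} t \<partial>lborel)"
  define I2 where "I2 = (\<integral>\<^sup>+t. (\<integral>\<^sup>+x. f x * g' (t * x) * indicator X x \<partial>lborel) * indicator {-1..1} t \<partial>lborel)"
  define c where "c = real K ^ (p + n) / 2 ^ p"
  have c0: "c \<ge> 0" by (simp add: c_def)
  have "ennreal \<kappa> * I1 \<le> (\<integral>\<^sup>+x. f' x * indicator {-1..1} x \<partial>lborel) * (\<integral>\<^sup>+x. g x * indicator {-1..1} x \<partial>lborel)"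
    unfolding I1_def X_def by (rule nn_integral_slopes_le) (use \<kappa> in auto)
  also have "\<dots> \<le> ennreal (7 * real (card Z) * real (card A) ^ (2 * p + n) / real K ^ p) * ennreal (3 * real (card B) ^ (p + n))"
    unfolding f'_def f_def g_def
    by (intro mult_mono nn_integral_near_set[OF A_sub K2 Z \<eta>] nn_integral_expsum_unit[OF B_sub K1]) auto
  also have "\<dots> = ennreal (21 * real (card Z) * (real (card A) ^ (2 * p + n) / real K ^ p * real (card B) ^ (p + n)))"
    by (subst ennreal_mult[symmetric]) (auto simp: mult_ac)
  also have "\<dots> \<le> ennreal (21 * real (card Z) * c)"
    unfolding c_def using bound[of A B] card_AB card_half by (intro ennreal_leI mult_left_mono) auto
  finally have b1: "ennreal \<kappa> * I1 \<le> ennreal (21 * real (card Z) * c)" .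
  have "ennreal \<kappa> * I2 \<le> (\<integral>\<^sup>+x. f x * indicator {-1..1} x \<partial>lborel) * (\<integral>\<^sup>+x. g' x * indicator {-1..1} x \<partial>lborel)"
    unfolding I2_def X_def by (rule nn_integral_slopes_le) (use \<kappa> in auto)
  also have "\<dots> \<le> ennreal (3 * real (card A) ^ (p + n)) * ennreal (7 * real (card Y) * real (card B) ^ (2 * p + n) / real K ^ p)"
    unfolding g'_def f_def g_def
    by (intro mult_mono nn_integral_near_set[OF B_sub K2 Y \<eta>] nn_integral_expsum_unit[OF A_sub K1]) auto
  also have "\<dots> = ennreal (21 * real (card Y) * (real (card B) ^ (2 * p + n) / real K ^ p * real (card A) ^ (p + n)))"
    by (subst ennreal_mult[symmetric]) (auto simp: mult_ac)
  also have "\<dots> \<le> ennreal (21 * real (card Y) * c)"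
    unfolding c_def using bound[of B A] card_AB card_half by (intro ennreal_leI mult_left_mono) (auto simp: mult.commute)
  finally have b2: "ennreal \<kappa> * I2 \<le> ennreal (21 * real (card Y) * c)" .
  define I where "I = (\<integral>\<^sup>+t. (\<integral>\<^sup>+x. ennreal ((norm (expsum K (A \<times> B) (slope_val t) (p + n) (real K ^ m * x)))\<^sup>2)
      * indicator {x. x \<in> near_set K Z m \<eta> \<or> t * x \<in> near_set K Y m \<eta>} x * indicator (shell K m) x \<partial>lborel) * indicator {-1..1} t \<partial>lborel)"
  have "I \<le> (\<integral>\<^sup>+t. (\<integral>\<^sup>+x. f' x * g (t * x) * indicator X x + f x * g' (t * x) * indicator X x \<partial>lborel) * indicator {-1..1} t \<partial>lborel)"
    unfolding I_def T
    by (intro nn_integral_mono mult_right_mono) (use shellX in \<open>auto simp: indicator_def f'_def g'_def\<close>)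
  also have "\<dots> = (\<integral>\<^sup>+t. (\<integral>\<^sup>+x. f' x * g (t * x) * indicator X x \<partial>lborel) * indicator {-1..1} t
      + (\<integral>\<^sup>+x. f x * g' (t * x) * indicator X x \<partial>lborel) * indicator {-1..1} t \<partial>lborel)"
    by (intro nn_integral_cong) (simp add: nn_integral_add distrib_right)
  also have "\<dots> = I1 + I2"
    unfolding I1_def I2_def by (rule nn_integral_add) measurable
  finally have "ennreal \<kappa> * I \<le> ennreal \<kappa> * I1 + ennreal \<kappa> * I2"
    by (metis distrib_left mult_left_mono zero_le)
  also have "\<dots> \<le> ennreal (21 * real (card Z) * c) + ennreal (21 * real (card Y) * c)"
    by (intro add_mono b1 b2)
  also have "\<dots> = ennreal (21 * real (card Z + card Y) * c)"
    using c0 by (subst ennreal_plus[symmetric]) (auto simp: algebra_simps)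
  finally have \<kappa>I: "ennreal \<kappa> * I \<le> ennreal (21 * real (card Z + card Y) * c)" .
  have "I = ennreal (1 / \<kappa>) * (ennreal \<kappa> * I)"
    using \<kappa> by (simp add: mult.assoc[symmetric] ennreal_mult'[symmetric])
  also have "\<dots> \<le> ennreal (1 / \<kappa>) * ennreal (21 * real (card Z + card Y) * c)"
    by (intro mult_left_mono \<kappa>I) auto
  also have "\<dots> = ennreal (672 * real (card Z + card Y) * real K ^ m * real K ^ (p + n) / 2 ^ p)"
    using c0 \<kappa> by (subst ennreal_mult'[symmetric]) (auto simp: \<kappa>_def c_def mult_ac)
  finally show ?thesis by (simp add: I_def)
qed

text \<open>Over \<open>4 * i\<close> scales, density \<open>1 / 12\<close> for each digit set gives
  about \<open>2 * i / 3\<close> constraints. Each costs \<open>16 * K <= K ^ 3\<close> in measure,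
  in total \<open>K ^ (2 * i)\<close> up to a constant. All constraints are on differences, as the
  pigeonhole principle requires. The parameter \<open>q\<close> stays free to make the
  neighbourhoods of the zeros as thin as needed.\<close>

lemma large_difference_sets:
  fixes q :: nat
  shows "\<exists>Z Y c lam. finite Z \<and> (\<forall>z\<in>Z. \<bar>z\<bar> \<le> 1) \<and> finite Y \<and> (\<forall>z\<in>Y. \<bar>z\<bar> \<le> 1) \<and> c > 0 \<and> lam \<ge> 1 \<and>
    (\<forall>i\<ge>1. \<forall>t. \<exists>\<Gamma>\<in>sets borel. \<Gamma> \<subseteq> {0..1/32} \<and> c \<le> real K ^ (2 * i) * measure lborel \<Gamma> \<and>
      (\<forall>x\<in>\<Gamma>. \<forall>y\<in>\<Gamma>.
         x - y \<notin> near_set K Z (4 * i) (1 / (2 * real K ^ (4 * i + q * (4 * i)))) \<longrightarrow>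
         t * (x - y) \<notin> near_set K Y (4 * i) (1 / (2 * real K ^ (4 * i + q * (4 * i)))) \<longrightarrow>
         1 \<le> lam ^ (4 * i) * (norm (expsum K (A \<times> B) (slope_val t) (4 * i) (x - y)))\<^sup>2))"
proof -
  have ne: "A \<noteq> {}" "B \<noteq> {}" using card_A card_B by auto
  obtain Z cA dA CA where ZA: "finite Z" "\<forall>z\<in>Z. \<bar>z\<bar> \<le> 1" "0 < cA" "cA \<le> 1" "0 \<le> CA"
    "\<And>m. \<exists>P. finite P \<and> real (card P) \<le> (1 / 12) * real m + CA \<and>
      (\<forall>y \<eta>. 0 < \<eta> \<longrightarrow> \<eta> \<le> 1 \<longrightarrow> (\<forall>p\<in>P. dint (real K ^ p * y) \<le> 1 / (16 * real K)) \<longrightarrow>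
        (\<forall>k<m. \<forall>z\<in>Z. dint (real K ^ k * y - z) \<ge> \<eta>) \<longrightarrow>
        (\<Prod>k<m. norm (charsum A (real K ^ k * y))) \<ge> cA ^ m * \<eta> ^ dA)"
    using charsum_orbit_lower_bound[OF fin(1) ne(1) K2, of "1 / 12"] by auto
  obtain Y cB dB CB where YB: "finite Y" "\<forall>z\<in>Y. \<bar>z\<bar> \<le> 1" "0 < cB" "cB \<le> 1" "0 \<le> CB"
    "\<And>m. \<exists>P. finite P \<and> real (card P) \<le> (1 / 12) * real m + CB \<and>
      (\<forall>y \<eta>. 0 < \<eta> \<longrightarrow> \<eta> \<le> 1 \<longrightarrow> (\<forall>p\<in>P. dint (real K ^ p * y) \<le> 1 / (16 * real K)) \<longrightarrow>
        (\<forall>k<m. \<forall>z\<in>Y. dint (real K ^ k * y - z) \<ge> \<eta>) \<longrightarrow>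
        (\<Prod>k<m. norm (charsum B (real K ^ k * y))) \<ge> cB ^ m * \<eta> ^ dB)"
    using charsum_orbit_lower_bound[OF fin(2) ne(2) K2, of "1 / 12"] by auto
  \<comment> \<open>Absorbs the additive constants of the two sparse digit sets, after the factor 3
    from \<open>16 * K <= K ^ 3\<close>.\<close>
  define C where "C = nat \<lceil>3 * (CA + CB)\<rceil>"
  define c where "c = 1 / (32 * real K ^ C)"
  \<comment> \<open>Chosen so that \<open>b ^ m\<close> is below the neighbourhood radius; thus
    powers of the radius become \<open>m\<close>-th powers and \<open>lam\<close> does not depend on
    \<open>i\<close>.\<close>
  define b where "b = 1 / (2 * real K ^ (1 + q))"
  define \<mu> where "\<mu> = cA * cB * b ^ (dA + dB)"
  have b: "0 < b" "b \<le> 1"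
  proof -
    have "1 \<le> real K ^ (1 + q)" using K1 by (intro one_le_power) auto
    then have "1 \<le> 2 * real K ^ (1 + q)" by linarith
    then show "0 < b" "b \<le> 1" using K_real by (auto simp: b_def divide_le_eq)
  qed
  have \<mu>: "0 < \<mu>" "\<mu> \<le> 1"
    using ZA YB b by (auto simp: \<mu>_def intro!: mult_le_one power_le_one)
  define lam where "lam = 1 / \<mu>\<^sup>2"
  have "\<mu>\<^sup>2 \<le> 1" using \<mu> by (intro power_le_one) auto
  then have lam1: "lam \<ge> 1" using \<mu> by (simp add: lam_def le_divide_eq)
  have c0: "c > 0" using K_real by (simp add: c_def)
  have "\<exists>\<Gamma>\<in>sets borel. \<Gamma> \<subseteq> {0..1/32} \<and> c \<le> real K ^ (2 * i) * measure lborel \<Gamma> \<and>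
      (\<forall>x\<in>\<Gamma>. \<forall>y\<in>\<Gamma>.
         x - y \<notin> near_set K Z (4 * i) (1 / (2 * real K ^ (4 * i + q * (4 * i)))) \<longrightarrow>
         t * (x - y) \<notin> near_set K Y (4 * i) (1 / (2 * real K ^ (4 * i + q * (4 * i)))) \<longrightarrow>
         1 \<le> lam ^ (4 * i) * (norm (expsum K (A \<times> B) (slope_val t) (4 * i) (x - y)))\<^sup>2)" if i: "i \<ge> 1" for i t
  proof -
    define m where "m = 4 * i"
    define \<eta> where "\<eta> = 1 / (2 * real K ^ (m + q * m))"
    have \<eta>: "0 < \<eta>" "\<eta> \<le> 1"
    proof -
      have "1 \<le> real K ^ (m + q * m)" using K1 by (intro one_le_power) auto
      then have "1 \<le> 2 * real K ^ (m + q * m)" by linarith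
      then show "0 < \<eta>" "\<eta> \<le> 1" using K_real by (auto simp: \<eta>_def divide_le_eq)
    qed
    have b\<eta>: "b ^ m \<le> \<eta>"
    proof -
      have "m + q * m = (1 + q) * m" by simp
      then have "real K ^ (m + q * m) = (real K ^ (1 + q)) ^ m" by (simp only: power_mult)
      moreover have "(2::real) ^ 1 \<le> 2 ^ m" using i by (intro power_increasing) (auto simp: m_def)
      ultimately have "2 * real K ^ (m + q * m) \<le> (2 * real K ^ (1 + q)) ^ m"
        by (simp add: power_mult_distrib mult_right_mono)
      then show ?thesis unfolding b_def \<eta>_def power_divide power_one
        using K_real by (intro divide_left_mono) auto
    qed
    obtain P where P: "finite P" "real (card P) \<le> (1 / 12) * real m + CA"
      "\<And>y \<eta>. 0 < \<eta> \<Longrightarrow> \<eta> \<le> 1 \<Longrightarrow> (\<forall>p\<in>P. dint (real K ^ p * y) \<le> 1 / (16 * real K)) \<Longrightarrow>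
        (\<forall>k<m. \<forall>z\<in>Z. dint (real K ^ k * y - z) \<ge> \<eta>) \<Longrightarrow>
        (\<Prod>k<m. norm (charsum A (real K ^ k * y))) \<ge> cA ^ m * \<eta> ^ dA"
      using ZA(6)[of m] by blast
    obtain R where R: "finite R" "real (card R) \<le> (1 / 12) * real m + CB"
      "\<And>y \<eta>. 0 < \<eta> \<Longrightarrow> \<eta> \<le> 1 \<Longrightarrow> (\<forall>p\<in>R. dint (real K ^ p * y) \<le> 1 / (16 * real K)) \<Longrightarrow>
        (\<forall>k<m. \<forall>z\<in>Y. dint (real K ^ k * y - z) \<ge> \<eta>) \<Longrightarrow>
        (\<Prod>k<m. norm (charsum B (real K ^ k * y))) \<ge> cB ^ m * \<eta> ^ dB"
      using YB(6)[of m] by blast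
    define F where "F = (\<lambda>p. real K ^ p) ` P \<union> (\<lambda>p. t * real K ^ p) ` R"
    have fF: "finite F" using P R by (simp add: F_def)
    have Q1: "16 * K \<ge> 1" using K1 by simp
    obtain \<Gamma> where G: "\<Gamma> \<in> sets borel" "\<Gamma> \<subseteq> {0..1/32}" "1 / 32 \<le> real (16 * K) ^ card F * measure lborel \<Gamma>"
      "\<forall>x\<in>\<Gamma>. \<forall>y\<in>\<Gamma>. \<forall>l\<in>F. dint (l * (x - y)) \<le> 1 / real (16 * K)"
      using pigeonhole_frequencies[OF fF Q1, of "1 / 32"] by auto
    have "card F \<le> card P + card R"
      unfolding F_def by (rule order_trans[OF card_Un_le add_mono[OF card_image_le[OF P(1)] card_image_le[OF R(1)]]])
    then have "real (3 * card F) \<le> 3 * (real (card P) + real (card R))" by simp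
    also have "\<dots> \<le> real (2 * i) + 3 * (CA + CB)" using P(2) R(2) by (simp add: m_def)
    also have "\<dots> \<le> real (2 * i + C)" unfolding C_def by simp linarith
    finally have cF: "3 * card F \<le> 2 * i + C" by (simp only: of_nat_le_iff)
    have "real (16 * K) \<le> real K ^ 3"
    proof -
      have "4 * 4 \<le> K * K" using K4 by (intro mult_le_mono) auto
      then have "16 * K \<le> K ^ 3" by (simp add: power3_eq_cube)
      then show ?thesis by (metis of_nat_le_iff of_nat_power)
    qed
    then have "real (16 * K) ^ card F \<le> (real K ^ 3) ^ card F" by (intro power_mono) auto
    also have "\<dots> = real K ^ (3 * card F)" by (simp add: power_mult)
    also have "\<dots> \<le> real K ^ (2 * i + C)" using cF K1 by (intro power_increasing) auto
    finally have "1 / 32 \<le> real K ^ (2 * i + C) * measure lborel \<Gamma>"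
      using G(3) by (meson measure_nonneg mult_right_mono order_trans)
    then have cG: "c \<le> real K ^ (2 * i) * measure lborel \<Gamma>"
      using K_real by (simp add: c_def power_add divide_le_eq mult_ac)
    have "1 \<le> lam ^ m * (norm (expsum K (A \<times> B) (slope_val t) m (x - y)))\<^sup>2"
      if xy: "x \<in> \<Gamma>" "y \<in> \<Gamma>" and n1: "x - y \<notin> near_set K Z m \<eta>" and n2: "t * (x - y) \<notin> near_set K Y m \<eta>" for x y
    proof -
      define u where "u = x - y"
      have dF: "dint (l * u) \<le> 1 / (16 * real K)" if "l \<in> F" for l using G(4) xy that by (simp add: u_def)
      have "cA ^ m * \<eta> ^ dA \<le> (\<Prod>k<m. norm (charsum A (real K ^ k * u)))"
      proof (intro P(3) \<eta> ballI dF)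
        show "\<forall>k<m. \<forall>z\<in>Z. \<eta> \<le> dint (real K ^ k * u - z)"
          using n1 unfolding near_set_def u_def mem_Collect_eq by (meson not_le)
      qed (auto simp: F_def)
      moreover have "cB ^ m * \<eta> ^ dB \<le> (\<Prod>k<m. norm (charsum B (real K ^ k * (t * u))))"
      proof (intro R(3) \<eta> ballI)
        fix p assume "p \<in> R"
        then have "dint ((t * real K ^ p) * u) \<le> 1 / (16 * real K)" by (intro dF) (auto simp: F_def)
        then show "dint (real K ^ p * (t * u)) \<le> 1 / (16 * real K)" by (simp add: mult_ac)
      next
        show "\<forall>k<m. \<forall>z\<in>Y. \<eta> \<le> dint (real K ^ k * (t * u) - z)"
          using n2 unfolding near_set_def u_def mem_Collect_eq by (meson not_le)
      qed
      ultimately have "(cA ^ m * \<eta> ^ dA) * (cB ^ m * \<eta> ^ dB)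
        \<le> norm (expsum K A real m u) * norm (expsum K B real m (t * u))"
        unfolding expsum_nat_prod prod_norm[symmetric] using ZA YB \<eta> by (intro mult_mono prod_nonneg) auto
      also have "\<dots> = norm (expsum K (A \<times> B) (slope_val t) m u)" by (simp add: expsum_Times norm_mult)
      finally have 1: "(cA * cB) ^ m * \<eta> ^ (dA + dB) \<le> norm (expsum K (A \<times> B) (slope_val t) m u)"
        by (simp add: power_mult_distrib power_add mult_ac)
      have "\<mu> ^ m = (cA * cB) ^ m * (b ^ m) ^ (dA + dB)"
        by (simp add: \<mu>_def power_mult_distrib power_mult[symmetric] mult.commute)
      also have "\<dots> \<le> (cA * cB) ^ m * \<eta> ^ (dA + dB)"
        using b b\<eta> ZA YB by (intro mult_left_mono power_mono) auto
      finally have "\<mu> ^ m \<le> norm (expsum K (A \<times> B) (slope_val t) m u)" using 1 by linarith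
      then have "(\<mu> ^ m)\<^sup>2 \<le> (norm (expsum K (A \<times> B) (slope_val t) m u))\<^sup>2" using \<mu> by (intro power_mono) auto
      then have "lam ^ m * (\<mu> ^ m)\<^sup>2 \<le> lam ^ m * (norm (expsum K (A \<times> B) (slope_val t) m u))\<^sup>2"
        using lam1 by (intro mult_left_mono) auto
      moreover have "lam ^ m * (\<mu> ^ m)\<^sup>2 = 1"
        using \<mu> by (simp add: lam_def power_divide power_mult[symmetric] mult.commute)
      ultimately show ?thesis by (simp add: u_def)
    qed
    then show ?thesis using G cG unfolding m_def \<eta>_def by blast
  qed
  then show ?thesis using ZA YB c0 lam1 by blast
qed


section \<open>Measure of the flat slopes\<close>

definition slope_energy :: "real \<Rightarrow> nat \<Rightarrow> nat" where
  "slope_energy t n = energy K (A \<times> B) (slope_val t) n"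

lemma borel_measurable_sig [measurable]: "(\<lambda>t. sig K (slope_val t) w) \<in> borel_measurable borel"
proof (induction w)
  case (Cons d w)
  then have [measurable]: "(\<lambda>t. sig K (slope_val t) w) \<in> borel_measurable borel" .
  show ?case by (cases d) simp
qed simp

lemma slope_energy_borel [measurable]: "(\<lambda>t. real (slope_energy t n)) \<in> borel_measurable borel"
proof -
  have eq: "real (slope_energy t n) = (\<Sum>w\<in>words (A \<times> B) n. \<Sum>w'\<in>words (A \<times> B) n.
      indicator {t. \<bar>sig K (slope_val t) w - sig K (slope_val t) w'\<bar> \<le> 4} t)" for t
  proof -
    define W where "W = words (A \<times> B) n"
    have fW: "finite W" by (simp add: W_def)
    have "slope_energy t n = card (Sigma W (\<lambda>w. {w' \<in> W. \<bar>sig K (slope_val t) w - sig K (slope_val t) w'\<bar> \<le> 4}))"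
      unfolding slope_energy_def energy_def near_pairs_def W_def by (rule arg_cong[where f = card]) auto
    also have "\<dots> = (\<Sum>w\<in>W. card {w' \<in> W. \<bar>sig K (slope_val t) w - sig K (slope_val t) w'\<bar> \<le> 4})"
      using fW by (subst card_SigmaI) auto
    finally have "real (slope_energy t n) = (\<Sum>w\<in>W. real (card {w' \<in> W. \<bar>sig K (slope_val t) w - sig K (slope_val t) w'\<bar> \<le> 4}))"
      by simp
    also have "\<dots> = (\<Sum>w\<in>W. \<Sum>w'\<in>W. indicator {t. \<bar>sig K (slope_val t) w - sig K (slope_val t) w'\<bar> \<le> 4} t)"
      using fW by (intro sum.cong refl) (simp add: indicator_def sum.If_cases Int_def)
    finally show ?thesis by (simp only: W_def)
  qed
  have "{t. \<bar>sig K (slope_val t) w - sig K (slope_val t) w'\<bar> \<le> 4} \<in> sets borel" for w w' by measurable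
  then show ?thesis unfolding eq by (intro borel_measurable_sum borel_measurable_indicator) auto
qed

definition flat_slopes :: "real \<Rightarrow> nat \<Rightarrow> real set" where
  "flat_slopes L N = {t \<in> {-1..1}. \<forall>k\<le>N. real (slope_energy t k) \<le> 2 * L * real K ^ k}"

lemma flat_slopes_borel [measurable, simp]: "flat_slopes L N \<in> sets borel"
proof -
  have "{t. real (slope_energy t k) \<le> 2 * L * real K ^ k} \<in> sets borel" for k by measurable
  then have "{-1..1} \<inter> (\<Inter>k\<in>{..N}. {t. real (slope_energy t k) \<le> 2 * L * real K ^ k}) \<in> sets borel"
    by (intro sets.Int sets.finite_INT) auto
  moreover have "flat_slopes L N = {-1..1} \<inter> (\<Inter>k\<in>{..N}. {t. real (slope_energy t k) \<le> 2 * L * real K ^ k})"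
    by (auto simp: flat_slopes_def)
  ultimately show ?thesis by simp
qed

lemma emeasure_flat_slopes_finite: "emeasure lborel (flat_slopes L N) = ennreal (measure lborel (flat_slopes L N))"
proof -
  have "emeasure lborel (flat_slopes L N) \<le> emeasure lborel {-1..1::real}"
    by (intro emeasure_mono) (auto simp: flat_slopes_def)
  also have "\<dots> < \<infinity>" by simp
  finally show ?thesis by (intro emeasure_eq_ennreal_measure) auto
qed

definition slope_shell :: "nat \<Rightarrow> nat \<Rightarrow> real \<Rightarrow> ennreal" where
  "slope_shell m l t = (\<integral>\<^sup>+x. ennreal ((norm (expsum K (A \<times> B) (slope_val t) l x))\<^sup>2) * indicator (shell K m) x \<partial>lborel)"

lemma slope_shell_borel [measurable]: "slope_shell m l \<in> borel_measurable borel"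
  unfolding slope_shell_def expsum_Times by measurable

text \<open>\<open>large_set_lower_bound\<close> is integrated over the flat slopes, where the
  energy at level \<open>r\<close> is at most \<open>2 * L * K ^ r\<close>. The part near the zeros
  is integrated over all of \<open>{-1..1}\<close> and falls to \<open>slopes_near_set\<close>;
  \<open>q * m\<close> of the \<open>r\<close> levels are reserved for its gain.\<close>

lemma flat_slopes_block:
  assumes i: "i \<ge> 1" and L: "L \<ge> 0" and r: "r \<le> N"
    and Z: "finite Z" "\<And>z. z \<in> Z \<Longrightarrow> \<bar>z\<bar> \<le> 1" and Y: "finite Y" "\<And>z. z \<in> Y \<Longrightarrow> \<bar>z\<bar> \<le> 1"
    and m: "m = 4 * i" and rp: "r = q * m + n" and c: "c \<ge> 0" and lam: "lam \<ge> 0"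
    and large: "\<And>t. \<exists>\<Gamma>\<in>sets borel. \<Gamma> \<subseteq> {0..1/32} \<and> c \<le> real K ^ (2 * i) * measure lborel \<Gamma> \<and>
      (\<forall>x\<in>\<Gamma>. \<forall>y\<in>\<Gamma>.
         x - y \<notin> near_set K Z m (1 / (2 * real K ^ (m + q * m))) \<longrightarrow>
         t * (x - y) \<notin> near_set K Y m (1 / (2 * real K ^ (m + q * m))) \<longrightarrow>
         1 \<le> lam * (norm (expsum K (A \<times> B) (slope_val t) m (x - y)))\<^sup>2)"
  defines "\<tau> \<equiv> measure lborel (flat_slopes L N)"
  shows "ennreal (real K ^ r * (c / real K ^ (2 * i)) * \<tau>)
    \<le> ennreal (160 * L * real K ^ r / real K ^ m * \<tau>
        + 672 * real (card Z + card Y) * real K ^ m * real K ^ r / 2 ^ (q * m))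
      + ennreal lam * (\<integral>\<^sup>+t. slope_shell m (m + r) t * indicator (flat_slopes L N) t \<partial>lborel)"
proof -
  define \<eta> where "\<eta> = 1 / (2 * real K ^ (m + q * m))"
  define S where "S t = {x. x \<in> near_set K Z m \<eta> \<or> t * x \<in> near_set K Y m \<eta>}" for t
  define E where "E = flat_slopes L N"
  define X where "X t = (\<integral>\<^sup>+x. ennreal ((norm (expsum K (A \<times> B) (slope_val t) r (real K ^ m * x)))\<^sup>2)
      * indicator (S t) x * indicator (shell K m) x \<partial>lborel)" for t
  have [measurable]: "near_set K Z m \<eta> \<in> sets borel" "near_set K Y m \<eta> \<in> sets borel" using Z Y by auto
  have [measurable]: "E \<in> sets borel" by (simp add: E_def)
  have Sm: "S t \<in> sets borel" for t unfolding S_def by measurable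
  have Xm [measurable]: "X \<in> borel_measurable borel"
  proof -
    \<comment> \<open>This exhibits the slope-dependent indicator as jointly measurable in
      \<open>t\<close> and \<open>x\<close>.\<close>
    have eq: "indicator (S t) x = max (indicator (near_set K Z m \<eta>) x) (indicator (near_set K Y m \<eta>) (t * x) :: ennreal)" for t x
      by (auto simp: S_def indicator_def max_def)
    show ?thesis unfolding X_def eq expsum_Times by measurable
  qed
  have Kp: "real K ^ k > 0" for k using K_real by simp
  define a where "a = real K ^ r * (c / real K ^ (2 * i))"
  define b where "b = 160 * L * real K ^ r / real K ^ m"
  have a0: "a \<ge> 0" using c Kp by (simp add: a_def less_imp_le)
  have b0: "b \<ge> 0" using L Kp by (simp add: b_def less_imp_le)
  have pt: "ennreal a \<le> ennreal b + X t + ennreal lam * slope_shell m (m + r) t" if t: "t \<in> E" for t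
  proof -
    have t1: "t \<in> {-1..1}" and en: "real (slope_energy t r) \<le> 2 * L * real K ^ r"
      using t r by (auto simp: E_def flat_slopes_def)
    interpret digits K "A \<times> B" "slope_val t" by (rule digits_slope[OF t1])
    obtain \<Gamma> where G: "\<Gamma> \<in> sets borel" "\<Gamma> \<subseteq> {0..1/32}" "c \<le> real K ^ (2 * i) * measure lborel \<Gamma>"
      "\<And>x y. x \<in> \<Gamma> \<Longrightarrow> y \<in> \<Gamma> \<Longrightarrow> x - y \<notin> S t \<Longrightarrow> 1 \<le> lam * (norm (expsum K (A \<times> B) (slope_val t) m (x - y)))\<^sup>2"
      using large[of t] unfolding S_def \<eta>_def by blast
    have "a \<le> real K ^ r * measure lborel \<Gamma>"
      unfolding a_def using G(3) Kp by (intro mult_left_mono) (auto simp: divide_le_eq mult.commute)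
    then have "ennreal a \<le> ennreal (real K ^ r * measure lborel \<Gamma>)" by (rule ennreal_leI)
    also have "\<dots> \<le> ennreal (80 * real (energy K (A \<times> B) (slope_val t) r) / real K ^ m) + X t + ennreal lam * slope_shell m (m + r) t"
      unfolding X_def slope_shell_def by (rule large_set_lower_bound[OF G(1,2) Sm lam G(4)])
    also have "80 * real (energy K (A \<times> B) (slope_val t) r) / real K ^ m \<le> b"
      using en Kp[of m] unfolding b_def slope_energy_def by (intro divide_right_mono) auto
    finally show ?thesis by (simp add: add_right_mono ennreal_leI)
  qed
  have "ennreal (a * \<tau>) = (\<integral>\<^sup>+t. ennreal a * indicator E t \<partial>lborel)"
    using a0 by (simp add: \<tau>_def E_def emeasure_flat_slopes_finite ennreal_mult nn_integral_cmult_indicator)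
  also have "\<dots> \<le> (\<integral>\<^sup>+t. ennreal b * indicator E t + X t * indicator {-1..1} t + ennreal lam * (slope_shell m (m + r) t * indicator E t) \<partial>lborel)"
  proof (rule nn_integral_mono)
    fix t
    show "ennreal a * indicator E t \<le> ennreal b * indicator E t + X t * indicator {-1..1} t + ennreal lam * (slope_shell m (m + r) t * indicator E t)"
    proof (cases "t \<in> E")
      case True
      then have "t \<in> {-1..1}" by (auto simp: E_def flat_slopes_def)
      then show ?thesis using pt[OF True] True by simp
    qed simp
  qed
  also have "\<dots> = (\<integral>\<^sup>+t. ennreal b * indicator E t \<partial>lborel) + (\<integral>\<^sup>+t. X t * indicator {-1..1} t \<partial>lborel)
     + ennreal lam * (\<integral>\<^sup>+t. slope_shell m (m + r) t * indicator E t \<partial>lborel)"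
    by (simp add: nn_integral_add nn_integral_cmult)
  also have "(\<integral>\<^sup>+t. ennreal b * indicator E t \<partial>lborel) = ennreal (b * \<tau>)"
    using b0 by (simp add: \<tau>_def E_def emeasure_flat_slopes_finite ennreal_mult nn_integral_cmult_indicator)
  also have "(\<integral>\<^sup>+t. X t * indicator {-1..1} t \<partial>lborel) \<le> ennreal (672 * real (card Z + card Y) * real K ^ m * real K ^ r / 2 ^ (q * m))"
    unfolding X_def S_def rp by (rule slopes_near_set[OF Z Y \<eta>_def])
  also have "ennreal (b * \<tau>) + ennreal (672 * real (card Z + card Y) * real K ^ m * real K ^ r / 2 ^ (q * m))
     = ennreal (b * \<tau> + 672 * real (card Z + card Y) * real K ^ m * real K ^ r / 2 ^ (q * m))"
    using b0 by (subst ennreal_plus) (auto simp: \<tau>_def)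
  finally show ?thesis by (simp add: a_def b_def E_def add_right_mono add_left_mono)
qed

text \<open>All shells draw on the single energy bound at level \<open>N\<close>, so on average a
  shell gets only a fraction \<open>1 / J\<close> of it. This is the pigeonhole principle in summed
  form, already integrated over the slopes.\<close>

lemma flat_slopes_shell_sum:
  assumes L: "L \<ge> 0" and m: "m \<ge> 1" and J: "J * m \<le> N"
  defines "\<tau> \<equiv> measure lborel (flat_slopes L N)"
  shows "(\<Sum>j<J. ennreal (real K ^ (j * m)) * (\<integral>\<^sup>+t. slope_shell m (N - j * m) t * indicator (flat_slopes L N) t \<partial>lborel))
    \<le> ennreal (640 * L * real K ^ N * \<tau>)"
proof -
  define E where "E = flat_slopes L N"
  have [measurable]: "E \<in> sets borel" by (simp add: E_def)
  have "(\<Sum>j<J. ennreal (real K ^ (j * m)) * (\<integral>\<^sup>+t. slope_shell m (N - j * m) t * indicator E t \<partial>lborel))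
    = (\<integral>\<^sup>+t. (\<Sum>j<J. ennreal (real K ^ (j * m)) * slope_shell m (N - j * m) t) * indicator E t \<partial>lborel)"
    by (simp add: sum_distrib_right nn_integral_sum nn_integral_cmult mult.assoc)
  also have "\<dots> \<le> (\<integral>\<^sup>+t. ennreal (640 * L * real K ^ N) * indicator E t \<partial>lborel)"
  proof (rule nn_integral_mono)
    fix t
    show "(\<Sum>j<J. ennreal (real K ^ (j * m)) * slope_shell m (N - j * m) t) * indicator E t \<le> ennreal (640 * L * real K ^ N) * indicator E t"
    proof (cases "t \<in> E")
      case True
      have t1: "t \<in> {-1..1}" and en: "real (slope_energy t N) \<le> 2 * L * real K ^ N"
        using True by (auto simp: E_def flat_slopes_def)
      interpret digits K "A \<times> B" "slope_val t" by (rule digits_slope[OF t1])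
      have "(\<Sum>j<J. ennreal (real K ^ (j * m)) * slope_shell m (N - j * m) t) \<le> ennreal (320 * real (energy K (A \<times> B) (slope_val t) N))"
        unfolding slope_shell_def by (rule shell_sum_le[OF m J])
      also have "\<dots> \<le> ennreal (640 * L * real K ^ N)"
        using en by (intro ennreal_leI) (simp add: slope_energy_def)
      finally show ?thesis by (intro mult_right_mono) auto
    qed simp
  qed
  also have "\<dots> = ennreal (640 * L * real K ^ N * \<tau>)"
    using L by (simp add: \<tau>_def E_def emeasure_flat_slopes_finite ennreal_mult nn_integral_cmult_indicator)
  finally show ?thesis by (simp add: E_def)
qed

text \<open>Suppose the measure \<open>\<tau>\<close> exceeds \<open>1 / u\<close> with
  \<open>u = K ^ i\<close>. In units of \<open>K ^ (M - m) * \<tau>\<close> each weighted block has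
  main term \<open>c / u ^ 2\<close> and errors of order \<open>1 / u ^ 3\<close>, so for large
  \<open>u\<close> its shell term is at least \<open>c / (2 * u ^ 2)\<close>. Adding up
  \<open>J\<close> blocks gives \<open>J * c <= 1280 * lam ^ m * u ^ 7\<close>, which fails for
  \<open>J >= lam ^ m * u ^ 8\<close>.\<close>

lemma flat_slopes_small:
  "\<exists>\<kappa> i0. \<forall>i\<ge>i0. \<forall>N\<ge>K ^ (\<kappa> * i). measure lborel (flat_slopes (real K ^ i) N) \<le> 1 / real K ^ i"
proof -
  \<comment> \<open>From \<open>K <= 2 ^ K\<close> the gain \<open>2 ^ (q * m)\<close> is at least
    \<open>K ^ (4 * m) = u ^ 16\<close>, well above the loss \<open>K ^ m = u ^ 4\<close>.\<close>
  define q where "q = 4 * K"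
  have "(2::real) ^ q \<ge> real K ^ 4"
  proof -
    have "K \<le> 2 ^ K" using less_exp[of K] by simp
    then have "real K \<le> 2 ^ K" by (metis of_nat_le_iff of_nat_numeral of_nat_power)
    then have "real K ^ 4 \<le> (2 ^ K) ^ 4" by (intro power_mono) auto
    then show ?thesis by (simp add: q_def power_mult[symmetric] mult.commute)
  qed
  then have q: "real K ^ (4 * m) \<le> 2 ^ (q * m)" for m
    using power_mono[of "real K ^ 4" "2 ^ q" m] by (simp add: power_mult[symmetric])
  obtain Z Y c lam where ZY: "finite Z" "\<And>z. z \<in> Z \<Longrightarrow> \<bar>z\<bar> \<le> 1" "finite Y" "\<And>z. z \<in> Y \<Longrightarrow> \<bar>z\<bar> \<le> 1"
    "c > 0" "lam \<ge> 1"
    "\<And>i t. i \<ge> 1 \<Longrightarrow> \<exists>\<Gamma>\<in>sets borel. \<Gamma> \<subseteq> {0..1/32} \<and> c \<le> real K ^ (2 * i) * measure lborel \<Gamma> \<and>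
      (\<forall>x\<in>\<Gamma>. \<forall>y\<in>\<Gamma>.
         x - y \<notin> near_set K Z (4 * i) (1 / (2 * real K ^ (4 * i + q * (4 * i)))) \<longrightarrow>
         t * (x - y) \<notin> near_set K Y (4 * i) (1 / (2 * real K ^ (4 * i + q * (4 * i)))) \<longrightarrow>
         1 \<le> lam ^ (4 * i) * (norm (expsum K (A \<times> B) (slope_val t) (4 * i) (x - y)))\<^sup>2)"
    using large_difference_sets[of q] by metis
  define z where "z = real (card Z + card Y)"
  \<comment> \<open>This makes \<open>J = K ^ (e * i)\<close> at least
    \<open>lam ^ m * u ^ 8\<close>.\<close>
  obtain e where e: "lam ^ 4 * real K ^ 8 \<le> real K ^ e"
    using real_arch_pow[of "real K" "lam ^ 4 * real K ^ 8"] K4 by (auto intro: less_imp_le)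
  \<comment> \<open>One summand makes the error terms at most half of the main term, the second
    yields the final contradiction.\<close>
  obtain i1 where i1: "2 * (160 + 672 * z) / c + 1280 / c + 1 < real K ^ i1"
    using real_arch_pow[of "real K"] K4 by auto
  \<comment> \<open>From \<open>M = m * (1 + q + J) <= K ^ i * K ^ ((q + 1) * i) * K ^ (e *
    i)\<close>.\<close>
  define \<kappa> where "\<kappa> = q + e + 2"
  define i0 where "i0 = i1 + 1"
  have "measure lborel (flat_slopes (real K ^ i) N) \<le> 1 / real K ^ i" if i: "i \<ge> i0" and N: "N \<ge> K ^ (\<kappa> * i)" for i N
  proof (rule ccontr)
    assume neg: "\<not> ?thesis"
    have i_1: "i \<ge> 1" using i by (simp add: i0_def)
    have Kp: "real K ^ k > 0" for k using K_real by simp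
    have K1r: "real K \<ge> 1" using K1 by simp
    define L where "L = real K ^ i"
    define m where "m = 4 * i"
    define J where "J = K ^ (e * i)"
    define M where "M = m + q * m + J * m"
    define \<tau> where "\<tau> = measure lborel (flat_slopes L M)"
    have m1: "m \<ge> 1" using i_1 by (simp add: m_def)
    have L0: "L \<ge> 0" by (simp add: L_def)
    have "M \<le> N"
    proof -
      have "4 * i \<le> 4 ^ i"
        using i_1 by (induction i rule: dec_induct) auto
      also have "(4::nat) ^ i \<le> K ^ i" using K4 by (intro power_mono) auto
      finally have mK: "m \<le> K ^ i" by (simp add: m_def)
      have J1: "1 \<le> J" unfolding J_def using K1 by (intro one_le_power) auto
      have "q + 2 \<le> K ^ (q + 1)"
      proof -
        have "q + 2 \<le> 2 ^ (q + 1)" by (induction q) auto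
        also have "(2::nat) ^ (q + 1) \<le> K ^ (q + 1)" using K2 by (intro power_mono) auto
        finally show ?thesis .
      qed
      also have "\<dots> \<le> K ^ ((q + 1) * i)" using K1 mult_le_mono2[OF i_1, of "q + 1"] by (intro power_increasing) auto
      finally have q2: "q + 2 \<le> K ^ ((q + 1) * i)" .
      have "M = m * (1 + q + J)" by (simp add: M_def algebra_simps)
      also have "\<dots> \<le> m * ((q + 2) * J)" using mult_le_mono2[OF J1, of "q + 1"] by (intro mult_le_mono2) (auto simp: algebra_simps)
      also have "\<dots> \<le> K ^ i * (K ^ ((q + 1) * i) * K ^ (e * i))"
        unfolding J_def by (intro mult_le_mono mK q2) auto
      also have "\<dots> = K ^ (\<kappa> * i)" by (simp add: \<kappa>_def power_add[symmetric] algebra_simps)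
      finally show ?thesis using N by simp
    qed
    \<comment> \<open>Flat sets decrease with the number of levels, so exactly \<open>M\<close>
      levels may be used.\<close>
    then have "flat_slopes L N \<subseteq> flat_slopes L M" by (auto simp: flat_slopes_def)
    then have "emeasure lborel (flat_slopes L N) \<le> emeasure lborel (flat_slopes L M)" by (intro emeasure_mono) auto
    then have "measure lborel (flat_slopes L N) \<le> \<tau>"
      unfolding emeasure_flat_slopes_finite \<tau>_def by simp
    then have \<tau>: "\<tau> > 1 / real K ^ i" using neg by (simp add: L_def)
    then have \<tau>0: "\<tau> > 0" using Kp[of i] by (meson divide_pos_pos less_trans zero_less_one)
    define s where "s j = (\<integral>\<^sup>+t. slope_shell m (M - j * m) t * indicator (flat_slopes L M) t \<partial>lborel)" for j
    define a where "a = real K ^ (M - m) * (c / real K ^ (2 * i)) * \<tau>"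
    define b where "b = 160 * L * real K ^ (M - m) / real K ^ m * \<tau>
        + 672 * z * real K ^ m * real K ^ (M - m) / 2 ^ (q * m)"
    have b0: "b \<ge> 0" using L0 \<tau>0 by (auto simp: b_def z_def intro!: add_nonneg_nonneg)
    \<comment> \<open>The \<open>j\<close>-th block uses \<open>r = q * m + (J - j) * m\<close> high
      factors. After multiplication by \<open>K ^ (j * m)\<close> all blocks have the same main term
      \<open>a\<close> and the same error \<open>b\<close>.\<close>
    have block: "ennreal a \<le> ennreal b + ennreal (lam ^ m) * (ennreal (real K ^ (j * m)) * s j)" if j: "j < J" for j
    proof -
      define n where "n = (J - j) * m"
      define r where "r = q * m + n"
      have jJ: "J * m = j * m + n" using j by (simp add: n_def diff_mult_distrib)
      have Mr: "M - j * m = m + r" "M - m = j * m + r" "r \<le> M" by (simp_all add: M_def r_def jJ)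
      have "ennreal (real K ^ r * (c / real K ^ (2 * i)) * \<tau>)
        \<le> ennreal (160 * L * real K ^ r / real K ^ m * \<tau> + 672 * z * real K ^ m * real K ^ r / 2 ^ (q * m))
          + ennreal (lam ^ m) * s j"
        unfolding \<tau>_def s_def Mr(1) z_def
        by (rule flat_slopes_block[OF i_1 L0 Mr(3) ZY(1-4) m_def r_def])
           (use ZY(5,6) ZY(7)[OF i_1] in \<open>auto simp: m_def\<close>)
      then have "ennreal (real K ^ (j * m)) * ennreal (real K ^ r * (c / real K ^ (2 * i)) * \<tau>)
        \<le> ennreal (real K ^ (j * m)) * (ennreal (160 * L * real K ^ r / real K ^ m * \<tau> + 672 * z * real K ^ m * real K ^ r / 2 ^ (q * m))
          + ennreal (lam ^ m) * s j)" by (intro mult_left_mono) auto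
      also have "\<dots> = ennreal (real K ^ (j * m)) * ennreal (160 * L * real K ^ r / real K ^ m * \<tau> + 672 * z * real K ^ m * real K ^ r / 2 ^ (q * m))
          + ennreal (lam ^ m) * (ennreal (real K ^ (j * m)) * s j)"
        by (simp add: distrib_left mult_ac)
      also have "ennreal (real K ^ (j * m)) * ennreal (real K ^ r * (c / real K ^ (2 * i)) * \<tau>) = ennreal a"
        by (subst ennreal_mult'[symmetric]) (auto simp: a_def Mr(2) power_add mult_ac)
      also have "ennreal (real K ^ (j * m)) * ennreal (160 * L * real K ^ r / real K ^ m * \<tau> + 672 * z * real K ^ m * real K ^ r / 2 ^ (q * m)) = ennreal b"
        by (subst ennreal_mult'[symmetric]) (auto simp: b_def Mr(2) power_add algebra_simps)
      finally show ?thesis .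
    qed
    have "ennreal (real J * a) = (\<Sum>j<J. ennreal a)" by (simp add: ennreal_mult' ennreal_of_nat_eq_real_of_nat)
    also have "\<dots> \<le> (\<Sum>j<J. ennreal b + ennreal (lam ^ m) * (ennreal (real K ^ (j * m)) * s j))"
      by (intro sum_mono block) auto
    also have "\<dots> = ennreal (real J * b) + ennreal (lam ^ m) * (\<Sum>j<J. ennreal (real K ^ (j * m)) * s j)"
      by (simp add: sum.distrib sum_distrib_left ennreal_mult' ennreal_of_nat_eq_real_of_nat)
    also have "\<dots> \<le> ennreal (real J * b) + ennreal (lam ^ m) * ennreal (640 * L * real K ^ M * \<tau>)"
      unfolding s_def \<tau>_def
      by (intro add_left_mono mult_left_mono flat_slopes_shell_sum L0 m1) (auto simp: M_def)
    also have "\<dots> = ennreal (real J * b + lam ^ m * (640 * L * real K ^ M * \<tau>))"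
      using b0 L0 \<tau>0 ZY(6) by (subst ennreal_mult[symmetric], auto simp flip: ennreal_plus)
    finally have main: "real J * a \<le> real J * b + lam ^ m * (640 * L * real K ^ M * \<tau>)"
      using b0 L0 \<tau>0 ZY(6) by (subst (asm) ennreal_le_iff) auto
    define u where "u = real K ^ i"
    have u: "u > 0" "u \<ge> 1" using Kp K1r by (auto simp: u_def intro: one_le_power)
    have Kpow: "real K ^ (d * i) = u ^ d" for d by (simp add: u_def power_mult[symmetric] mult.commute)
    have Km: "real K ^ m = u ^ 4" using Kpow[of 4] by (simp add: m_def)
    have MK: "real K ^ M = real K ^ (M - m) * u ^ 4"
    proof -
      have "M = (M - m) + m" by (simp add: M_def)
      then show ?thesis unfolding Km[symmetric] by (metis power_add)
    qed
    have a_eq: "a = real K ^ (M - m) * (\<tau> * (c / u ^ 2))" by (simp add: a_def Kpow)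
    have "672 * z * real K ^ m / 2 ^ (q * m) \<le> 672 * z / u ^ 12"
    proof -
      have "u ^ 16 \<le> 2 ^ (q * m)" using q[of m] Kpow[of 16] by (simp add: m_def)
      then have "672 * z * u ^ 4 / 2 ^ (q * m) \<le> 672 * z * u ^ 4 / u ^ 16"
        using u by (intro divide_left_mono) (auto simp: z_def)
      also have "\<dots> = 672 * z / u ^ 12" using u by (simp add: field_simps flip: power_add)
      finally show ?thesis by (simp add: Km)
    qed
    \<comment> \<open>The error near the zeros carries no factor \<open>\<tau>\<close>; the
      assumption \<open>\<tau> > 1 / u\<close> supplies one at the cost of a power of
      \<open>u\<close>.\<close>
    also have "\<dots> \<le> \<tau> * (672 * z / u ^ 3)"
    proof -
      have "672 * z / u ^ 12 = (1 / u) * (672 * z / u ^ 11)" by (simp add: field_simps flip: power_Suc)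
      also have "\<dots> \<le> \<tau> * (672 * z / u ^ 3)"
        using \<tau> \<tau>0 u by (intro mult_mono divide_left_mono power_increasing) (auto simp: u_def z_def)
      finally show ?thesis .
    qed
    finally have "real K ^ (M - m) * (672 * z * real K ^ m / 2 ^ (q * m)) \<le> real K ^ (M - m) * (\<tau> * (672 * z / u ^ 3))"
      by (intro mult_left_mono) auto
    moreover have "160 * L * real K ^ (M - m) / real K ^ m * \<tau> = real K ^ (M - m) * (\<tau> * (160 / u ^ 3))"
    proof -
      have u4: "u / u ^ 4 = 1 / u ^ 3" using u by (simp add: field_simps flip: power_Suc)
      have "160 * L * real K ^ (M - m) / real K ^ m * \<tau> = real K ^ (M - m) * (\<tau> * (160 * (u / u ^ 4)))"
        by (simp add: L_def u_def[symmetric] Km)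
      then show ?thesis unfolding u4 by simp
    qed
    ultimately have b_le: "b \<le> real K ^ (M - m) * (\<tau> * ((160 + 672 * z) / u ^ 3))"
      by (simp add: b_def algebra_simps add_divide_distrib)
    have u_large: "2 * (160 + 672 * z) / c + 1280 / c + 1 < u"
    proof -
      have "real K ^ i1 \<le> u" unfolding u_def using K1r i by (intro power_increasing) (auto simp: i0_def)
      then show ?thesis using i1 by linarith
    qed
    have z0: "z \<ge> 0" by (simp add: z_def)
    have "(160 + 672 * z) / u ^ 3 \<le> (c / u ^ 2) / 2"
    proof -
      have "2 * (160 + 672 * z) / c \<le> u" using u_large ZY(5) by (smt (verit) divide_nonneg_pos)
      then have "2 * (160 + 672 * z) \<le> c * u" using ZY(5) by (simp add: divide_le_eq mult.commute)
      then have "2 * (160 + 672 * z) / u ^ 3 \<le> c * u / u ^ 3" using u by (intro divide_right_mono) auto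
      also have "c * u / u ^ 3 = c / u ^ 2" using u by (simp add: field_simps power2_eq_square power3_eq_cube)
      finally have "2 * ((160 + 672 * z) / u ^ 3) \<le> c / u ^ 2" by (simp only: times_divide_eq_right)
      moreover have "x \<le> y / 2" if "2 * x \<le> y" for x y :: real using that by simp
      ultimately show ?thesis by blast
    qed
    then have "b \<le> real K ^ (M - m) * (\<tau> * ((c / u ^ 2) / 2))"
      using \<tau>0 by (intro order_trans[OF b_le] mult_left_mono) auto
    then have "b \<le> a / 2" by (simp add: a_eq)
    then have "real J * b \<le> real J * (a / 2)" by (intro mult_left_mono) auto
    then have "real J * (a / 2) \<le> lam ^ m * (640 * L * real K ^ M * \<tau>)" using main by (simp add: algebra_simps)
    then have "real K ^ (M - m) * \<tau> * (real J * (c / u ^ 2) / 2) \<le> real K ^ (M - m) * \<tau> * (lam ^ m * 640 * u * u ^ 4)"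
      by (simp add: a_eq MK L_def u_def[symmetric] mult_ac)
    then have "real J * (c / u ^ 2) / 2 \<le> lam ^ m * 640 * u * u ^ 4"
      using \<tau>0 Kp[of "M - m"] by (subst (asm) mult_le_cancel_left_pos) auto
    then have "real J * (c / u ^ 2) / 2 * (2 * u ^ 2) \<le> lam ^ m * 640 * u * u ^ 4 * (2 * u ^ 2)"
      using u by (intro mult_right_mono) auto
    moreover have "real J * (c / u ^ 2) / 2 * (2 * u ^ 2) = real J * c" using u by simp
    moreover have "lam ^ m * 640 * u * u ^ 4 * (2 * u ^ 2) = 1280 * (lam ^ m * u ^ 7)"
      by (simp add: eval_nat_numeral)
    ultimately have "real J * c \<le> 1280 * (lam ^ m * u ^ 7)" by simp
    moreover have "real J \<ge> lam ^ m * u ^ 8"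
    proof -
      have "lam ^ m * u ^ 8 = (lam ^ 4 * real K ^ 8) ^ i"
        by (simp add: m_def u_def power_mult_distrib power_mult[symmetric] mult.commute)
      also have "\<dots> \<le> (real K ^ e) ^ i" using e ZY(6) by (intro power_mono) auto
      finally show ?thesis by (simp add: J_def power_mult)
    qed
    ultimately have "lam ^ m * u ^ 8 * c \<le> 1280 * (lam ^ m * u ^ 7)"
      using ZY(5) by (meson less_imp_le mult_right_mono order_trans)
    then have "(lam ^ m * u ^ 7) * (u * c) \<le> (lam ^ m * u ^ 7) * 1280"
      by (simp add: eval_nat_numeral mult_ac)
    moreover have "lam ^ m * u ^ 7 > 0" using ZY(6) u by simp
    ultimately have "u * c \<le> 1280" by (simp only: mult_le_cancel_left_pos)
    then have "u \<le> 1280 / c" using ZY(5) by (simp add: le_divide_eq)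
    then show False using u_large ZY(5) z0 by (smt (verit) divide_nonneg_pos)
  qed
  then show ?thesis by blast
qed

end

section \<open>The Favard length\<close>

text \<open>The word lists the digits from \<open>j = n\<close> down to \<open>j = 1\<close>, so
  that its head is the lowest digit.\<close>

lemma sig_digit_sum:
  assumes "K > 0" "\<forall>j\<in>{1..n}. d j \<in> D"
  shows "\<exists>w\<in>words D n. sig K v w = real K ^ n * (\<Sum>j=1..n. v (d j) / real K ^ j)"
  using assms(2)
proof (induction n)
  case (Suc n)
  then obtain w where w: "w \<in> words D n" "sig K v w = real K ^ n * (\<Sum>j=1..n. v (d j) / real K ^ j)" by auto
  have "sig K v (d (Suc n) # w) = real K ^ Suc n * (\<Sum>j=1..Suc n. v (d j) / real K ^ j)"
    using assms(1) by (simp add: w(2) algebra_simps)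
  then show ?case using w(1) Suc.prems by (intro bexI[of _ "d (Suc n) # w"]) auto
qed simp

abbreviation angle_val :: "real \<Rightarrow> nat \<times> nat \<Rightarrow> real" where
  "angle_val \<theta> \<equiv> \<lambda>(a, b). real a * cos \<theta> + real b * sin \<theta>"

text \<open>In units of \<open>1 / K ^ n\<close>, points of a square project within
  \<open>|cos \<theta>| + |sin \<theta>| <= 2\<close> of the image of its bottom left
  corner.\<close>

lemma proj_cantor_iter_subset:
  assumes K: "K > 0"
  shows "proj \<theta> ` cantor_iter K A B n \<subseteq> cover K (A \<times> B) (angle_val \<theta>) n"
proof
  fix x assume "x \<in> proj \<theta> ` cantor_iter K A B n"
  then obtain a b u w where ab: "\<forall>j\<in>{1..n}. a j \<in> A" "\<forall>j\<in>{1..n}. b j \<in> B"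
    and uw: "u \<in> {0..1 / real K ^ n}" "w \<in> {0..1 / real K ^ n}"
    and x: "x = ((\<Sum>j=1..n. real (a j) / real K ^ j) + u) * cos \<theta> + ((\<Sum>j=1..n. real (b j) / real K ^ j) + w) * sin \<theta>"
    by (auto simp: cantor_iter_def digit_sums_def proj_def elim!: set_plus_elim)
  have "\<forall>j\<in>{1..n}. (a j, b j) \<in> A \<times> B" using ab by auto
  from sig_digit_sum[OF K this, of "angle_val \<theta>"] obtain s where s: "s \<in> words (A \<times> B) n"
    "sig K (angle_val \<theta>) s = real K ^ n * (\<Sum>j=1..n. angle_val \<theta> (a j, b j) / real K ^ j)" by blast
  have "(\<Sum>j=1..n. angle_val \<theta> (a j, b j) / real K ^ j)
     = (\<Sum>j=1..n. real (a j) / real K ^ j) * cos \<theta> + (\<Sum>j=1..n. real (b j) / real K ^ j) * sin \<theta>"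
    by (simp add: sum_distrib_right sum.distrib add_divide_distrib)
  then have "real K ^ n * x - sig K (angle_val \<theta>) s = (real K ^ n * u) * cos \<theta> + (real K ^ n * w) * sin \<theta>"
    by (simp add: s(2) x algebra_simps)
  moreover have "\<bar>(real K ^ n * u) * cos \<theta>\<bar> \<le> 1 * 1" "\<bar>(real K ^ n * w) * sin \<theta>\<bar> \<le> 1 * 1"
    unfolding abs_mult[of "real K ^ n * _"] using uw K by (intro mult_mono; auto simp: abs_mult field_simps)+
  ultimately have "\<bar>real K ^ n * x - sig K (angle_val \<theta>) s\<bar> \<le> 2" by linarith
  then show "x \<in> cover K (A \<times> B) (angle_val \<theta>) n" using s(1) by (auto simp: cover_def)
qed

text \<open>Reflection in the diagonal exchanges the two digit sets, so that steep directions become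
  shallow ones with slopes in \<open>{-1..1}\<close>.\<close>

lemma proj_cantor_iter_swap:
  "proj \<theta> ` cantor_iter K A B n = proj (pi / 2 - \<theta>) ` cantor_iter K B A n"
proof -
  have "proj \<theta> ` cantor_iter K A B n \<subseteq> proj (pi / 2 - \<theta>) ` cantor_iter K B A n" for \<theta> A B
  proof
    fix x assume "x \<in> proj \<theta> ` cantor_iter K A B n"
    then obtain a b c d where z: "a \<in> digit_sums K A n" "b \<in> digit_sums K B n"
      "c \<in> {0..1 / real K ^ n}" "d \<in> {0..1 / real K ^ n}" "x = proj \<theta> ((a, b) + (c, d))"
      by (force simp: cantor_iter_def elim!: set_plus_elim)
    then have "(b, a) + (d, c) \<in> cantor_iter K B A n" unfolding cantor_iter_def by (intro set_plus_intro) auto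
    moreover have "x = proj (pi / 2 - \<theta>) ((b, a) + (d, c))"
      using z(5) by (simp add: proj_def cos_diff sin_diff)
    ultimately show "x \<in> proj (pi / 2 - \<theta>) ` cantor_iter K B A n" by blast
  qed
  from this[of \<theta> A B] this[of "pi / 2 - \<theta>" B A] show ?thesis by auto
qed

text \<open>The condition on \<open>sin\<close> and \<open>cos\<close> confines the angle to
  \<open>{-(pi/4)..pi/4}\<close>, where \<open>tan\<close> is a substitution with derivative at
  least 1.\<close>

lemma nn_integral_tan_le:
  assumes F [measurable]: "F \<in> sets borel" and F1: "F \<subseteq> {-1..1}"
  shows "(\<integral>\<^sup>+x. indicator {x. \<bar>sin x\<bar> \<le> \<bar>cos x\<bar> \<and> tan x \<in> F} x * indicator {-(pi/2)..pi/2} x \<partial>lborel) \<le> emeasure lborel F"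
proof -
  have cos_pos: "cos x > 0" if "x \<in> {-(pi/4)..pi/4}" for x
    using that pi_gt_zero unfolding atLeastAtMost_iff by (intro cos_gt_zero_pi) linarith+
  have small: "\<bar>x\<bar> \<le> pi / 4" if "\<bar>x\<bar> \<le> pi / 2" "\<bar>sin x\<bar> \<le> \<bar>cos x\<bar>" for x :: real
  proof (rule ccontr)
    assume "\<not> \<bar>x\<bar> \<le> pi / 4"
    then have "cos \<bar>x\<bar> < cos (pi / 2 - \<bar>x\<bar>)" using that by (intro cos_monotone_0_pi) auto
    also have "cos (pi / 2 - \<bar>x\<bar>) = sin \<bar>x\<bar>" by (simp add: cos_diff)
    also have "sin \<bar>x\<bar> \<le> \<bar>sin x\<bar>" by (cases "x \<ge> 0") auto
    finally have "cos x < \<bar>sin x\<bar>" by simp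
    moreover have "cos x \<ge> 0" using that by (intro cos_ge_zero) (auto simp: abs_le_iff)
    ultimately show False using that(2) by simp
  qed
  have "(\<integral>\<^sup>+x. indicator {x. \<bar>sin x\<bar> \<le> \<bar>cos x\<bar> \<and> tan x \<in> F} x * indicator {-(pi/2)..pi/2} x \<partial>lborel)
    \<le> (\<integral>\<^sup>+x. ennreal (indicator F (tan x) * inverse ((cos x)\<^sup>2) * indicator {-(pi/4)..pi/4} x) \<partial>lborel)"
  proof (rule nn_integral_mono)
    fix x :: real
    show "indicator {x. \<bar>sin x\<bar> \<le> \<bar>cos x\<bar> \<and> tan x \<in> F} x * indicator {-(pi/2)..pi/2} x
      \<le> ennreal (indicator F (tan x) * inverse ((cos x)\<^sup>2) * indicator {-(pi/4)..pi/4} x)"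
    proof (cases "\<bar>sin x\<bar> \<le> \<bar>cos x\<bar> \<and> tan x \<in> F \<and> x \<in> {-(pi/2)..pi/2}")
      case True
      have "\<bar>x\<bar> \<le> pi / 2" using True unfolding atLeastAtMost_iff by linarith
      then have "\<bar>x\<bar> \<le> pi / 4" using True by (intro small) auto
      then have x: "x \<in> {-(pi/4)..pi/4}" unfolding atLeastAtMost_iff by linarith
      have "(cos x)\<^sup>2 \<le> 1" by (simp add: abs_square_le_1)
      then have "1 \<le> inverse ((cos x)\<^sup>2)" using cos_pos[OF x] by (simp add: one_le_inverse_iff)
      then have "ennreal 1 \<le> ennreal (inverse ((cos x)\<^sup>2))" by (rule ennreal_leI)
      then show ?thesis using True x by simp
    qed auto
  qed
  also have "\<dots> = (\<integral>\<^sup>+x. ennreal (indicator F x * indicator {tan (-(pi/4))..tan (pi/4)} x) \<partial>lborel)"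
  proof (rule nn_integral_substitution[symmetric])
    show "set_borel_measurable borel {tan (-(pi/4))..tan (pi/4)} (indicator F :: real \<Rightarrow> real)"
      unfolding set_borel_measurable_def by measurable
    show "(tan has_real_derivative inverse ((cos x)\<^sup>2)) (at x)" if "x \<in> {-(pi/4)..pi/4}" for x
      using cos_pos[OF that] by (intro DERIV_tan) auto
    show "continuous_on {-(pi/4)..pi/4} (\<lambda>x. inverse ((cos x)\<^sup>2))"
      using cos_pos by (intro continuous_intros) force
  qed auto
  also have "\<dots> = (\<integral>\<^sup>+x. indicator F x \<partial>lborel)"
    using F1 by (intro nn_integral_cong) (auto simp: indicator_def tan_45)
  also have "\<dots> = emeasure lborel F" by simp
  finally show ?thesis .
qed

section \<open>From slopes back to angles\<close>

context product_digits
begin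

lemma digits_angle: "digits K (A \<times> B) (angle_val \<theta>)"
proof
  fix d assume "d \<in> A \<times> B"
  then obtain a b where d: "d = (a, b)" "a \<in> A" "b \<in> B" by auto
  have ab: "real a \<le> real K - 1" "real b \<le> real K - 1" using d A_sub B_sub by auto
  have "\<bar>real a * cos \<theta>\<bar> \<le> real a * 1" "\<bar>real b * sin \<theta>\<bar> \<le> real b * 1"
    unfolding abs_mult by (intro mult_mono; simp)+
  then have "\<bar>real a * cos \<theta> + real b * sin \<theta>\<bar> \<le> real a + real b" by linarith
  then show "\<bar>angle_val \<theta> d\<bar> \<le> 2 * (real K - 1)" using ab d by simp
qed (use card_AB K2 in \<open>auto simp: card_cartesian_product\<close>)

lemma emeasure_proj_le_cover:
  "emeasure lebesgue (proj \<theta> ` cantor_iter K A B n) \<le> emeasure lborel (cover K (A \<times> B) (angle_val \<theta>) n)"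
proof -
  interpret digits K "A \<times> B" "angle_val \<theta>" by (rule digits_angle)
  have "emeasure lebesgue (proj \<theta> ` cantor_iter K A B n) \<le> emeasure lebesgue (cover K (A \<times> B) (angle_val \<theta>) n)"
    using proj_cantor_iter_subset[OF K_pos(1)] by (intro emeasure_mono) auto
  then show ?thesis by simp
qed

lemma emeasure_proj_le_8: "emeasure lebesgue (proj \<theta> ` cantor_iter K A B n) \<le> 8"
proof -
  interpret digits K "A \<times> B" "angle_val \<theta>" by (rule digits_angle)
  show ?thesis using emeasure_proj_le_cover emeasure_cover_le by (rule order_trans)
qed

text \<open>Angle values are \<open>cos \<theta>\<close> times slope values for
  \<open>tan \<theta>\<close>, and a factor of size at most 1 only brings words closer.\<close>

lemma slope_energy_le_angle:
  assumes "cos \<theta> \<noteq> 0"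
  shows "slope_energy (tan \<theta>) k \<le> energy K (A \<times> B) (angle_val \<theta>) k"
proof -
  have s: "sig K (angle_val \<theta>) w = cos \<theta> * sig K (slope_val (tan \<theta>)) w" for w
  proof (induction w)
    case (Cons d w)
    then show ?case using assms by (cases d) (simp add: tan_def field_simps)
  qed simp
  have "near_pairs K (A \<times> B) (slope_val (tan \<theta>)) k \<subseteq> near_pairs K (A \<times> B) (angle_val \<theta>) k"
  proof -
    have "\<bar>cos \<theta> * x - cos \<theta> * y\<bar> \<le> 4" if "\<bar>x - y\<bar> \<le> 4" for x y
    proof -
      have "\<bar>cos \<theta> * x - cos \<theta> * y\<bar> = \<bar>cos \<theta>\<bar> * \<bar>x - y\<bar>" by (simp add: abs_mult flip: right_diff_distrib)
      also have "\<dots> \<le> 1 * 4" using that by (intro mult_mono) auto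
      finally show ?thesis by simp
    qed
    then show ?thesis unfolding near_pairs_def s by auto
  qed
  moreover have "finite (near_pairs K (A \<times> B) (angle_val \<theta>) k)"
    by (rule finite_subset[of _ "words (A \<times> B) k \<times> words (A \<times> B) k"]) (auto simp: near_pairs_def)
  ultimately show ?thesis unfolding slope_energy_def energy_def by (rule card_mono[rotated])
qed

text \<open>If the slope is not flat, some level \<open>k <= N\<close> has large energy and
  \<open>emeasure_cover_stacked\<close> applies; on the small set of flat slopes the trivial bound 8
  is used.\<close>

lemma emeasure_proj_not_flat:
  assumes L: "L \<ge> 1" and \<theta>: "\<bar>sin \<theta>\<bar> \<le> \<bar>cos \<theta>\<bar>"
    and J: "real J \<ge> 8 * real K * L\<^sup>2" and n: "n \<ge> J * N"
  shows "emeasure lebesgue (proj \<theta> ` cantor_iter K A B n)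
    \<le> ennreal (84 / L) + 8 * indicator {x. \<bar>sin x\<bar> \<le> \<bar>cos x\<bar> \<and> tan x \<in> flat_slopes L N} \<theta>"
proof (cases "tan \<theta> \<in> flat_slopes L N")
  case True
  then show ?thesis using emeasure_proj_le_8[of \<theta> n] \<theta> by (simp add: add_increasing)
next
  case False
  interpret digits K "A \<times> B" "angle_val \<theta>" by (rule digits_angle)
  have c0: "cos \<theta> \<noteq> 0"
  proof
    assume "cos \<theta> = 0"
    then have "(sin \<theta>)\<^sup>2 + (cos \<theta>)\<^sup>2 = 0" using \<theta> by simp
    then show False using sin_cos_squared_add[of \<theta>] by linarith
  qed
  then have "\<bar>tan \<theta>\<bar> \<le> 1" using \<theta> by (simp add: tan_def divide_le_eq)
  then have "tan \<theta> \<in> {-1..1}" by (auto simp: abs_le_iff)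
  then obtain k where k: "k \<le> N" "real (slope_energy (tan \<theta>) k) > 2 * L * real K ^ k"
    using False by (auto simp: flat_slopes_def not_le)
  then have "real (En k) > 2 * L * real K ^ k"
    using slope_energy_le_angle[OF c0, of k] by (meson less_le_trans of_nat_le_iff)
  then have "emeasure lborel (cover K (A \<times> B) (angle_val \<theta>) n) \<le> ennreal (84 / L)"
    by (rule emeasure_cover_stacked[OF L k(1) _ J n])
  then have "emeasure lebesgue (proj \<theta> ` cantor_iter K A B n) \<le> ennreal (84 / L)"
    using emeasure_proj_le_cover by (rule order_trans[rotated])
  then show ?thesis by (simp add: add_increasing2)
qed

end

theorem theorem1p1:
  fixes K :: nat and A B :: "nat set" and \<theta>\<^sub>0 :: real
  assumes "A \<subseteq> {0..<K}" and "B \<subseteq> {0..<K}"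
    and "card A * card B = K"
    and "card A > 1" and "card B > 1"
    and "\<theta>\<^sub>0 \<in> {0..pi}"
    and "emeasure lebesgue (proj \<theta>\<^sub>0 ` cantor_limit K A B) > 0"
  shows "\<exists>p::real. p > 6 \<and>
           (\<exists>C::real. \<forall>n::nat. n \<ge> 1 \<longrightarrow>
              favard (cantor_iter K A B n) \<le> ennreal (C * real n powr (- 1 / p)))"
proof -
  interpret AB: product_digits K A B using assms by unfold_locales auto
  interpret BA: product_digits K B A using assms by unfold_locales (auto simp: mult.commute)
  have K4: "K \<ge> 4" by (rule AB.K4)
  have K1: "real K > 1" using K4 by simp
  obtain \<kappa>1 i1 where 1: "\<And>i N. i \<ge> i1 \<Longrightarrow> N \<ge> K ^ (\<kappa>1 * i) \<Longrightarrow> measure lborel (AB.flat_slopes (real K ^ i) N) \<le> 1 / real K ^ i"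
    using AB.flat_slopes_small by blast
  obtain \<kappa>2 i2 where 2: "\<And>i N. i \<ge> i2 \<Longrightarrow> N \<ge> K ^ (\<kappa>2 * i) \<Longrightarrow> measure lborel (BA.flat_slopes (real K ^ i) N) \<le> 1 / real K ^ i"
    using BA.flat_slopes_small by blast
  define \<kappa> where "\<kappa> = max \<kappa>1 \<kappa>2"
  define i0 where "i0 = max 1 (max i1 i2)"
  \<comment> \<open>For \<open>i >= 1\<close> this gives
    \<open>\<kappa> * i + 2 * i + 3 <= P * i\<close>, hence \<open>J * N <= n\<close> below; adding
    7 also ensures \<open>P > 6\<close>.\<close>
  define P where "P = \<kappa> + 7"
  have fav_trivial: "favard (cantor_iter K A B n) \<le> ennreal 32" for n
  proof -
    have "favard (cantor_iter K A B n) \<le> (\<integral>\<^sup>+\<theta>. 8 * indicator {0..pi} \<theta> \<partial>lebesgue)"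
      unfolding favard_def by (intro nn_integral_mono mult_right_mono AB.emeasure_proj_le_8) auto
    also have "\<dots> = 8 * ennreal pi" by (simp add: nn_integral_cmult_indicator)
    also have "\<dots> \<le> 8 * ennreal 4" using pi_less_4 by (intro mult_left_mono ennreal_leI) auto
    also have "\<dots> = ennreal 32" by (simp flip: ennreal_numeral ennreal_mult'')
    finally show ?thesis .
  qed
  have fav: "favard (cantor_iter K A B n) \<le> ennreal (360 / real K ^ i)" if i: "i \<ge> i0" and n: "n \<ge> K ^ (P * i)" for i n
  proof -
    define L where "L = real K ^ i"
    define N where "N = K ^ (\<kappa> * i)"
    \<comment> \<open>\<open>J = K ^ 3 * L^2\<close> dominates \<open>8 * K * L^2\<close>, because
      \<open>K ^ 2 >= 16\<close>.\<close>
    define J where "J = K ^ (2 * i + 3)"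
    have i_bounds: "i \<ge> 1" "i \<ge> i1" "i \<ge> i2" using i by (auto simp: i0_def)
    have L1: "L \<ge> 1" using K1 by (simp add: L_def one_le_power)
    have J: "real J \<ge> 8 * real K * L\<^sup>2"
    proof -
      have "(8::real) \<le> 4 * 4" by simp
      also have "\<dots> \<le> real K * real K" using K4 by (intro mult_mono) auto
      finally have "8 * (real K * L\<^sup>2) \<le> (real K * real K) * (real K * L\<^sup>2)" by (intro mult_right_mono) auto
      also have "\<dots> = real J"
        by (simp add: J_def L_def power_add power_mult[symmetric] power3_eq_cube mult_ac)
      finally show ?thesis by simp
    qed
    have JN: "J * N \<le> n"
    proof -
      have "J * N = K ^ (\<kappa> * i + 2 * i + 3)" by (simp add: J_def N_def power_add mult_ac)
      also have "\<dots> \<le> K ^ (P * i)" using K4 i_bounds by (intro power_increasing) (auto simp: P_def algebra_simps)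
      finally show ?thesis using n by simp
    qed
    define FA where "FA = AB.flat_slopes L N"
    define FB where "FB = BA.flat_slopes L N"
    define G where "G F = {x. \<bar>sin x\<bar> \<le> \<bar>cos x\<bar> \<and> tan x \<in> F}" for F :: "real set"
    have FAB [measurable]: "FA \<in> sets borel" "FB \<in> sets borel" by (auto simp: FA_def FB_def)
    have sub: "FA \<subseteq> {-1..1}" "FB \<subseteq> {-1..1}" by (auto simp: FA_def FB_def AB.flat_slopes_def BA.flat_slopes_def)
    have tanm [measurable]: "(tan :: real \<Rightarrow> real) \<in> borel_measurable borel"
      unfolding tan_def[abs_def] by measurable
    have Gm [measurable]: "G F \<in> sets borel" if [measurable]: "F \<in> sets borel" for F unfolding G_def by measurable
    have mFA: "emeasure lborel FA \<le> ennreal (1 / L)"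
      unfolding FA_def AB.emeasure_flat_slopes_finite L_def
    proof (intro ennreal_leI 1 i_bounds)
      show "K ^ (\<kappa>1 * i) \<le> N" unfolding N_def using K4 by (intro power_increasing) (auto simp: \<kappa>_def)
    qed
    have mFB: "emeasure lborel FB \<le> ennreal (1 / L)"
      unfolding FB_def BA.emeasure_flat_slopes_finite L_def
    proof (intro ennreal_leI 2 i_bounds)
      show "K ^ (\<kappa>2 * i) \<le> N" unfolding N_def using K4 by (intro power_increasing) (auto simp: \<kappa>_def)
    qed
    have pw: "emeasure lebesgue (proj \<theta> ` cantor_iter K A B n)
      \<le> ennreal (84 / L) + 8 * indicator (G FA) \<theta> + 8 * indicator (G FB) (pi / 2 - \<theta>)" for \<theta>
    proof (cases "\<bar>sin \<theta>\<bar> \<le> \<bar>cos \<theta>\<bar>")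
      case True
      then have "emeasure lebesgue (proj \<theta> ` cantor_iter K A B n) \<le> ennreal (84 / L) + 8 * indicator (G FA) \<theta>"
        unfolding G_def FA_def by (rule AB.emeasure_proj_not_flat[OF L1 _ J JN])
      then show ?thesis by (rule order_trans) (simp add: add_increasing2)
    next
      case False
      then have "\<bar>sin (pi / 2 - \<theta>)\<bar> \<le> \<bar>cos (pi / 2 - \<theta>)\<bar>" by (simp add: sin_diff cos_diff)
      then have "emeasure lebesgue (proj \<theta> ` cantor_iter K A B n) \<le> ennreal (84 / L) + 8 * indicator (G FB) (pi / 2 - \<theta>)"
        unfolding proj_cantor_iter_swap[of \<theta>] G_def FB_def by (rule BA.emeasure_proj_not_flat[OF L1 _ J JN])
      also have "\<dots> \<le> ennreal (84 / L) + 8 * indicator (G FA) \<theta> + 8 * indicator (G FB) (pi / 2 - \<theta>)"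
        by (intro add_right_mono) simp
      finally show ?thesis .
    qed
    define H where "H F = (\<integral>\<^sup>+x. indicator (G F) x * indicator {-(pi/2)..pi/2} x \<partial>lborel)" for F
    have HF: "H F \<le> emeasure lborel F" if "F \<in> sets borel" "F \<subseteq> {-1..1}" for F
      unfolding H_def G_def by (rule nn_integral_tan_le[OF that])
    have A_int: "(\<integral>\<^sup>+\<theta>. indicator (G FA) \<theta> * indicator {0..pi} \<theta> \<partial>lborel) \<le> 2 * ennreal (1 / L)"
    proof -
      \<comment> \<open>\<open>{0..pi}\<close> is covered by \<open>{-(pi/2)..pi/2}\<close> and its
        translate by \<open>pi\<close>, so the periodicity accounts for the factor 2.\<close>
      have periodic: "(\<theta> + pi \<in> G FA) = (\<theta> \<in> G FA)" for \<theta>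
        by (simp add: G_def sin_add cos_add tan_def)
      have "(\<integral>\<^sup>+\<theta>. indicator (G FA) \<theta> * indicator {0..pi} \<theta> \<partial>lborel)
        \<le> (\<integral>\<^sup>+\<theta>. indicator (G FA) \<theta> * indicator {-(pi/2)..pi/2} \<theta>
           + indicator (G FA) (- pi + 1 * \<theta>) * indicator {-(pi/2)..pi/2} (- pi + 1 * \<theta>) \<partial>lborel)"
      proof (rule nn_integral_mono)
        fix \<theta> :: real
        have "(- pi + 1 * \<theta> \<in> G FA) = (\<theta> \<in> G FA)" using periodic[of "\<theta> - pi"] by simp
        then show "indicator (G FA) \<theta> * indicator {0..pi} \<theta> \<le> indicator (G FA) \<theta> * indicator {-(pi/2)..pi/2} \<theta>
           + (indicator (G FA) (- pi + 1 * \<theta>) * indicator {-(pi/2)..pi/2} (- pi + 1 * \<theta>) :: ennreal)"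
          by (auto simp: indicator_def)
      qed
      also have "\<dots> = H FA + (\<integral>\<^sup>+\<theta>. indicator (G FA) (- pi + 1 * \<theta>) * indicator {-(pi/2)..pi/2} (- pi + 1 * \<theta>) \<partial>lborel)"
        unfolding H_def by (rule nn_integral_add) measurable
      also have "(\<integral>\<^sup>+\<theta>. indicator (G FA) (- pi + 1 * \<theta>) * indicator {-(pi/2)..pi/2} (- pi + 1 * \<theta>) \<partial>lborel) = H FA"
        unfolding H_def using nn_integral_real_affine[of "\<lambda>x. indicator (G FA) x * indicator {-(pi/2)..pi/2} x" 1 "- pi"] by simp
      also have "H FA + H FA \<le> ennreal (1 / L) + ennreal (1 / L)"
        using HF[OF FAB(1) sub(1)] mFA by (intro add_mono order_trans[OF _ mFA]) auto
      finally show ?thesis by (simp add: mult_2)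
    qed
    have B_int: "(\<integral>\<^sup>+\<theta>. indicator (G FB) (pi / 2 - \<theta>) * indicator {0..pi} \<theta> \<partial>lborel) \<le> ennreal (1 / L)"
    proof -
      \<comment> \<open>The reflection \<open>\<theta>\<close> to \<open>pi / 2 - \<theta>\<close>
        maps \<open>{0..pi}\<close> exactly onto \<open>{-(pi/2)..pi/2}\<close>, so one copy
        suffices.\<close>
      have "(\<integral>\<^sup>+\<theta>. indicator (G FB) (pi / 2 - \<theta>) * indicator {0..pi} \<theta> \<partial>lborel)
        = (\<integral>\<^sup>+\<theta>. indicator (G FB) (pi / 2 + (-1) * \<theta>) * indicator {-(pi/2)..pi/2} (pi / 2 + (-1) * \<theta>) \<partial>lborel)"
        by (intro nn_integral_cong) (auto simp: indicator_def)
      also have "\<dots> = H FB"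
        unfolding H_def using nn_integral_real_affine[of "\<lambda>x. indicator (G FB) x * indicator {-(pi/2)..pi/2} x" "-1" "pi / 2"] by simp
      also have "\<dots> \<le> ennreal (1 / L)" using HF[OF FAB(2) sub(2)] mFB by (rule order_trans)
      finally show ?thesis .
    qed
    have "favard (cantor_iter K A B n)
      \<le> (\<integral>\<^sup>+\<theta>. (ennreal (84 / L) + 8 * indicator (G FA) \<theta> + 8 * indicator (G FB) (pi / 2 - \<theta>)) * indicator {0..pi} \<theta> \<partial>lebesgue)"
      unfolding favard_def by (intro nn_integral_mono mult_right_mono pw) auto
    also have "\<dots> = (\<integral>\<^sup>+\<theta>. (ennreal (84 / L) + 8 * indicator (G FA) \<theta> + 8 * indicator (G FB) (pi / 2 - \<theta>)) * indicator {0..pi} \<theta> \<partial>lborel)"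
      by (intro nn_integral_completion) measurable
    also have "\<dots> = (\<integral>\<^sup>+\<theta>. ennreal (84 / L) * indicator {0..pi} \<theta> + 8 * (indicator (G FA) \<theta> * indicator {0..pi} \<theta>)
        + 8 * (indicator (G FB) (pi / 2 - \<theta>) * indicator {0..pi} \<theta>) \<partial>lborel)"
      by (intro nn_integral_cong) (simp add: distrib_right mult.assoc)
    also have "\<dots> = ennreal (84 / L) * ennreal pi + 8 * (\<integral>\<^sup>+\<theta>. indicator (G FA) \<theta> * indicator {0..pi} \<theta> \<partial>lborel)
       + 8 * (\<integral>\<^sup>+\<theta>. indicator (G FB) (pi / 2 - \<theta>) * indicator {0..pi} \<theta> \<partial>lborel)"
      by (simp add: nn_integral_add nn_integral_cmult nn_integral_cmult_indicator)
    also have "\<dots> \<le> ennreal (84 / L) * ennreal 4 + 8 * (2 * ennreal (1 / L)) + 8 * ennreal (1 / L)"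
      using pi_less_4 by (intro add_mono mult_left_mono A_int B_int ennreal_leI) auto
    also have "\<dots> = ennreal (84 / L * 4 + 8 * (2 * (1 / L)) + 8 * (1 / L))"
    proof -
      have e: "8 * ennreal y = ennreal (8 * y)" "2 * ennreal y = ennreal (2 * y)" if "y \<ge> 0" for y
        using that by (simp_all add: ennreal_mult)
      have "0 \<le> 1 / L" using L1 by simp
      then show ?thesis using L1
        by (subst ennreal_mult[symmetric], simp, simp, subst e, simp, subst e, simp, subst e, simp,
            subst ennreal_plus[symmetric], simp, simp, subst ennreal_plus[symmetric], auto)
    qed
    also have "84 / L * 4 + 8 * (2 * (1 / L)) + 8 * (1 / L) = 360 / real K ^ i" by (simp add: L_def)
    finally show ?thesis .
  qed
  \<comment> \<open>The first summand serves \<open>i >= i0\<close> and contains the factor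
    \<open>K\<close> lost between \<open>K ^ i\<close> and \<open>K ^ (i + 1)\<close>; the second
    covers the finitely many \<open>n\<close> with \<open>i < i0\<close> through the trivial bound
    32.\<close>
  define C where "C = 360 * real K + 32 * real K ^ i0"
  have "favard (cantor_iter K A B n) \<le> ennreal (C * real n powr (- 1 / real P))" if n: "n \<ge> 1" for n
  proof -
    \<comment> \<open>Thus \<open>K ^ (P * i) <= n < K ^ (P * (i + 1))\<close>: up to a factor
      \<open>K\<close>, \<open>K ^ i\<close> is the \<open>P\<close>-th root of
      \<open>n\<close>.\<close>
    define i where "i = (LEAST i. n < K ^ (P * (i + 1)))"
    have ex: "n < K ^ (P * (n + 1))"
    proof -
      have "n < 2 ^ n" by (rule less_exp)
      also have "(2::nat) ^ n \<le> K ^ n" using K4 by (intro power_mono) auto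
      also have "\<dots> \<le> K ^ (P * (n + 1))" using K4 by (intro power_increasing) (auto simp: P_def algebra_simps)
      finally show ?thesis .
    qed
    have up: "n < K ^ (P * (i + 1))" unfolding i_def by (rule LeastI[of "\<lambda>i. n < K ^ (P * (i + 1))", OF ex])
    have low: "K ^ (P * i) \<le> n"
    proof (cases i)
      case (Suc i')
      then show ?thesis using not_less_Least[of i' "\<lambda>i. n < K ^ (P * (i + 1))"] unfolding i_def[symmetric] by simp
    qed (use n in simp)
    have P0: "real P > 0" by (simp add: P_def)
    have "real n powr (1 / real P) \<le> (real K ^ (P * (i + 1))) powr (1 / real P)"
    proof (rule powr_mono2)
      show "real n \<le> real K ^ (P * (i + 1))" using up by (metis less_imp_le of_nat_le_iff of_nat_power)
    qed (use P0 in auto)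
    also have "\<dots> = real K ^ (i + 1)"
    proof -
      have "real K ^ (P * (i + 1)) = (real K ^ (i + 1)) powr real P"
      proof -
        have "real K ^ (P * (i + 1)) = (real K ^ (i + 1)) ^ P" by (simp only: power_mult[symmetric] mult.commute)
        also have "\<dots> = (real K ^ (i + 1)) powr real P" using K1 by (intro powr_realpow[symmetric]) auto
        finally show ?thesis .
      qed
      then show ?thesis using K1 P0 by (simp add: powr_powr)
    qed
    finally have np: "real n powr (1 / real P) \<le> real K ^ (i + 1)" .
    have npos: "real n powr (1 / real P) > 0" using n by simp
    have inv: "1 / real K ^ (i + 1) \<le> real n powr (- 1 / real P)"
    proof -
      have "1 / real K ^ (i + 1) \<le> 1 / real n powr (1 / real P)" using K1 by (intro divide_left_mono[OF np] mult_pos_pos npos) auto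
      also have "\<dots> = real n powr (- 1 / real P)" using powr_minus_divide[of "real n" "1 / real P"] by simp
      finally show ?thesis .
    qed
    have pw0: "real n powr (- 1 / real P) \<ge> 0" by simp
    show ?thesis
    proof (cases "i \<ge> i0")
      case True
      have "favard (cantor_iter K A B n) \<le> ennreal (360 / real K ^ i)" by (rule fav[OF True low])
      also have "\<dots> \<le> ennreal (C * real n powr (- 1 / real P))"
      proof (rule ennreal_leI)
        have "360 / real K ^ i = 360 * real K * (1 / real K ^ (i + 1))" using K1 by simp
        also have "\<dots> \<le> C * real n powr (- 1 / real P)"
          using inv K1 by (intro mult_mono) (auto simp: C_def)
        finally show "360 / real K ^ i \<le> C * real n powr (- 1 / real P)" .
      qed
      finally show ?thesis .
    next
      case False
      have "favard (cantor_iter K A B n) \<le> ennreal 32" by (rule fav_trivial)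
      also have "\<dots> \<le> ennreal (C * real n powr (- 1 / real P))"
      proof (rule ennreal_leI)
        have "real K ^ (i + 1) \<le> real K ^ i0" using False K1 by (intro power_increasing) auto
        then have "32 * 1 \<le> 32 * (real K ^ i0 / real K ^ (i + 1))" using K1 by (intro mult_left_mono) auto
        also have "\<dots> = 32 * real K ^ i0 * (1 / real K ^ (i + 1))" by simp
        also have "\<dots> \<le> C * real n powr (- 1 / real P)"
          using inv K1 by (intro mult_mono) (auto simp: C_def)
        finally show "32 \<le> C * real n powr (- 1 / real P)" by simp
      qed
      finally show ?thesis .
    qed
  qed
  moreover have "real P > 6" by (simp add: P_def)
  ultimately show ?thesis by blast
qed

end
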